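(* Let $F$ be a field of characteristic $0$, $V=V_0\oplus V_1$ a $\mathbb{Z}_2$-graded $F$-vector space with $\dim V_0=k<\infty$, $\dim V_1=\ell<\infty$, and let $\Omega\subseteq\mathbb{Y}$ be a filter with $\Omega\ne\mathbb{Y}$ which contains the rectangle $((\ell+1)^{k+1})$. Let $a=h_r(\Omega)$ (so $a\ge1$). Then $\mathrm{Exp}(A_\Omega)=a-1$.
   Context: $\mathbb{Y}$ is the set of all partitions (including the empty one) with inclusion $\mu\subseteq\lambda$ iff $\mu_i\le\lambda_i$ for all $i$; a filter is an upward-closed subset. $((\ell+1)^{k+1})$ is the rectangle with $k+1$ rows of length $\ell+1$. For integers $b\ge a_1,a_2\ge0$, $D(a_1,a_2,b)=(b^{a_1},a_2^{\,b-a_1})$. A filter $\Omega$ satisfies the $a$-th hook-rectangular condition ($a\ge0$ an integer) if there exists an integer $b>0$ with $D(a,0,b),D(a-1,1,b),\dots,D(0,a,b)\in\Omega$. For a nonempty filter $\Omega$, $h_r(\Omega)$ is the least $a\ge0$ such that $\Omega$ satisfies the $a$-th hook-rectangular condition. $T^n(V)=V^{\otimes n}$ carries the signed place-permutation right action of $S_n$ (for homogeneous $z_i$, $(z_1\otimes\cdots\otimes z_n)*\sigma=\pm z_{\sigma(1)}\otimes\cdots\otimes z_{\sigma(n)}$, sign $(-1)^N$, $N$ the number of pairs of odd factors with reversed order); $W_\lambda$ is the isotypic component of $\chi^\lambda$. $I_\Omega=\bigoplus_{\lambda\in\Omega}W_\lambda$ is an ideal of $T(V)$ and $A_\Omega=T(V)/I_\Omega$,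 $A_\Omega(n)\cong\bigoplus_{\lambda\vdash n,\lambda\notin\Omega}W_\lambda$. For a sequence $d_n$: $\mathrm{Exp}(d_n)\ge\alpha$ (resp. $\le\alpha$) means there is a polynomial $p$, positive for large $n$, with $d_n\ge p(n)\alpha^n$ (resp. $d_n\le p(n)\alpha^n$) for all large $n$; $\mathrm{Exp}(d_n)=\alpha$ if both hold; $\mathrm{Exp}(d_n)=0$ if $d_n=0$ for large $n$. $\mathrm{Exp}(A_\Omega)=\mathrm{Exp}(\dim A_\Omega(n))$. *)

theory Defs
  imports
    Complex_Main
    "HOL-Library.Function_Algebras"
    "HOL-Combinatorics.Permutations"
    "HOL-Computational_Algebra.Polynomial"
begin

section \<open>Partitions and filters\<close>

text \<open>Parts are indexed from 0 and a partition is padded with zeros, so that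
  inclusion \<open>\<mu> \<subseteq> \<nu>\<close> is the pointwise order \<open>\<mu> \<le> \<nu>\<close> on functions.\<close>

definition partitions :: "(nat \<Rightarrow> nat) set" where
  "partitions = {\<nu>. antimono \<nu> \<and> finite {i. \<nu> i \<noteq> 0}}"

definition psize :: "(nat \<Rightarrow> nat) \<Rightarrow> nat" where
  "psize \<nu> = (\<Sum>i | \<nu> i \<noteq> 0. \<nu> i)"

definition partition_filter :: "(nat \<Rightarrow> nat) set \<Rightarrow> bool" where
  "partition_filter \<Omega> \<longleftrightarrow>
     \<Omega> \<subseteq> partitions \<and> (\<forall>\<mu>\<in>\<Omega>. \<forall>\<nu>\<in>partitions. \<mu> \<le> \<nu> \<longrightarrow> \<nu> \<in> \<Omega>)"

definition rect :: "nat \<Rightarrow> nat \<Rightarrow> nat \<Rightarrow> nat" where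
  "rect rows len = (\<lambda>i. if i < rows then len else 0)"

definition hookrect :: "nat \<Rightarrow> nat \<Rightarrow> nat \<Rightarrow> nat \<Rightarrow> nat" where
  "hookrect a1 a2 b = (\<lambda>i. if i < a1 then b else if i < b then a2 else 0)"

text \<open>The shape \<open>hookrect a1 a2 b\<close> is only meaningful for \<open>a1, a2 \<le> b\<close>; for all
  the shapes with \<open>a1 + a2 = a\<close> together this means \<open>a \<le> b\<close>.\<close>

definition hook_rectangular_condition :: "(nat \<Rightarrow> nat) set \<Rightarrow> nat \<Rightarrow> bool" where
  "hook_rectangular_condition \<Omega> a \<longleftrightarrow>
     (\<exists>b>0. a \<le> b \<and> (\<forall>a1 a2. a1 + a2 = a \<longrightarrow> hookrect a1 a2 b \<in> \<Omega>))"

definition h_r :: "(nat \<Rightarrow> nat) set \<Rightarrow> nat" where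
  "h_r \<Omega> = (LEAST a. hook_rectangular_condition \<Omega> a)"


section \<open>Exponential growth\<close>

definition Exp_ge :: "(nat \<Rightarrow> real) \<Rightarrow> real \<Rightarrow> bool" where
  "Exp_ge d \<alpha> \<longleftrightarrow> (\<exists>p :: real poly.
     (\<forall>\<^sub>F n in sequentially. 0 < poly p (real n)) \<and>
     (\<forall>\<^sub>F n in sequentially. d n \<ge> poly p (real n) * \<alpha> ^ n))"

definition Exp_le :: "(nat \<Rightarrow> real) \<Rightarrow> real \<Rightarrow> bool" where
  "Exp_le d \<alpha> \<longleftrightarrow> (\<exists>p :: real poly.
     (\<forall>\<^sub>F n in sequentially. 0 < poly p (real n)) \<and>
     (\<forall>\<^sub>F n in sequentially. d n \<le> poly p (real n) * \<alpha> ^ n))"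

definition has_Exp :: "(nat \<Rightarrow> real) \<Rightarrow> real \<Rightarrow> bool" where
  "has_Exp d \<alpha> \<longleftrightarrow>
     (if \<alpha> = 0 then (\<forall>\<^sub>F n in sequentially. d n = 0) else Exp_ge d \<alpha> \<and> Exp_le d \<alpha>)"


section \<open>Function spaces as vector spaces, and dimension of a quotient\<close>

definition fscale :: "'f::field \<Rightarrow> ('x \<Rightarrow> 'f) \<Rightarrow> 'x \<Rightarrow> 'f" where
  "fscale c g = (\<lambda>x. c * g x)"

interpretation fun_vs: vector_space "fscale :: 'f::field \<Rightarrow> ('x \<Rightarrow> 'f) \<Rightarrow> 'x \<Rightarrow> 'f"
  by unfold_locales (auto simp: fscale_def algebra_simps fun_eq_iff)

definition linear_between :: "('x \<Rightarrow> 'f::field) set \<Rightarrow> (('x \<Rightarrow> 'f) \<Rightarrow> 'y \<Rightarrow> 'f) \<Rightarrow> bool" where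
  "linear_between U f \<longleftrightarrow>
     (\<forall>s\<in>U. \<forall>t\<in>U. f (s + t) = f s + f t) \<and> (\<forall>c. \<forall>t\<in>U. f (fscale c t) = fscale c (f t))"

text \<open>\<open>B\<close> represents a basis of \<open>(U + W)/W\<close>, the image of \<open>U\<close> in the quotient by \<open>W\<close>.\<close>

definition basis_mod ::
    "('x \<Rightarrow> 'f::field) set \<Rightarrow> ('x \<Rightarrow> 'f) set \<Rightarrow> ('x \<Rightarrow> 'f) set \<Rightarrow> bool" where
  "basis_mod U W B \<longleftrightarrow>
     B \<subseteq> U \<and> U \<subseteq> fun_vs.span (B \<union> W) \<and>
     (\<forall>S c. finite S \<and> S \<subseteq> B \<and> (\<Sum>b\<in>S. fscale (c b) b) \<in> W \<longrightarrow> (\<forall>b\<in>S. c b = 0))"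

definition quot_dim :: "('x \<Rightarrow> 'f::field) set \<Rightarrow> ('x \<Rightarrow> 'f) set \<Rightarrow> nat" where
  "quot_dim U W = card (SOME B. basis_mod U W B)"


section \<open>Superspaces and tensor powers\<close>

definition superspace ::
    "('f::field \<Rightarrow> 'v::ab_group_add \<Rightarrow> 'v) \<Rightarrow> 'v set \<Rightarrow> 'v set \<Rightarrow> bool" where
  "superspace scale V0 V1 \<longleftrightarrow>
     vector_space scale \<and> module.subspace scale V0 \<and> module.subspace scale V1 \<and>
     V0 \<inter> V1 = {0} \<and> (\<forall>v. \<exists>x\<in>V0. \<exists>y\<in>V1. v = x + y)"

text \<open>Finite-dimensionality is explicit because the library gives infinite-dimensional
  spaces the dimension 0.\<close>

definition has_findim ::
    "('f::field \<Rightarrow> 'v::ab_group_add \<Rightarrow> 'v) \<Rightarrow> 'v set \<Rightarrow> nat \<Rightarrow> bool" where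
  "has_findim scale U d \<longleftrightarrow>
     (\<exists>B. finite B \<and> module.span scale B = U) \<and> vector_space.dim scale U = d"

text \<open>Over a field, \<open>v\<^sub>1 \<otimes> \<dots> \<otimes> v\<^sub>n\<close> is determined by its values
  \<open>(\<phi>\<^sub>1, \<dots>, \<phi>\<^sub>n) \<mapsto> \<phi>\<^sub>1 v\<^sub>1 \<cdots> \<phi>\<^sub>n v\<^sub>n\<close> on linear functionals; \<open>V\<^sup>\<otimes>\<^sup>n\<close> is realised as the span
  of these functions. They are extended by 0 to lists of other lengths, so the sum of
  the spaces \<open>V\<^sup>\<otimes>\<^sup>n\<close> over all \<open>n\<close>, the tensor algebra, is direct.\<close>

definition tensor ::
    "('f::field \<Rightarrow> 'v::ab_group_add \<Rightarrow> 'v) \<Rightarrow> 'v list \<Rightarrow> ('v \<Rightarrow> 'f) list \<Rightarrow> 'f" where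
  "tensor scale vs = (\<lambda>\<phi>s.
     if length \<phi>s = length vs \<and> (\<forall>\<phi>\<in>set \<phi>s. Vector_Spaces.linear scale (*) \<phi>)
     then \<Prod>i<length vs. (\<phi>s ! i) (vs ! i) else 0)"

definition tensor_power ::
    "('f::field \<Rightarrow> 'v::ab_group_add \<Rightarrow> 'v) \<Rightarrow> nat \<Rightarrow> (('v \<Rightarrow> 'f) list \<Rightarrow> 'f) set" where
  "tensor_power scale n = fun_vs.span {tensor scale vs | vs. length vs = n}"

lemma tensor_add:
  fixes scale :: "'f::field \<Rightarrow> 'v::ab_group_add \<Rightarrow> 'v"
  assumes "i < length vs"
  shows "tensor scale (vs[i := x + y]) = tensor scale (vs[i := x]) + tensor scale (vs[i := y])"
proof
  fix \<phi>s :: "('v \<Rightarrow> 'f) list"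
  have P: "(\<Prod>j<length vs. (\<phi>s ! j) (vs[i := z] ! j)) =
      (\<phi>s ! i) z * (\<Prod>j\<in>{..<length vs} - {i}. (\<phi>s ! j) (vs ! j))" for z
    using assms by (subst prod.remove[of _ i]) (auto intro!: prod.cong)
  show "tensor scale (vs[i := x + y]) \<phi>s =
      (tensor scale (vs[i := x]) + tensor scale (vs[i := y])) \<phi>s"
  proof (cases "length \<phi>s = length vs \<and> (\<forall>\<phi>\<in>set \<phi>s. Vector_Spaces.linear scale (*) \<phi>)")
    case True
    then have "Vector_Spaces.linear scale (*) (\<phi>s ! i)"
      using assms by auto
    then have "(\<phi>s ! i) (x + y) = (\<phi>s ! i) x + (\<phi>s ! i) y"
      by (simp add: Vector_Spaces.linear_iff)
    then show ?thesis
      using True unfolding tensor_def by (simp add: P distrib_right)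
  next
    case False
    then show ?thesis unfolding tensor_def by auto
  qed
qed

lemma tensor_scale:
  fixes scale :: "'f::field \<Rightarrow> 'v::ab_group_add \<Rightarrow> 'v"
  assumes "i < length vs"
  shows "tensor scale (vs[i := scale c x]) = fscale c (tensor scale (vs[i := x]))"
proof
  fix \<phi>s :: "('v \<Rightarrow> 'f) list"
  have P: "(\<Prod>j<length vs. (\<phi>s ! j) (vs[i := z] ! j)) =
      (\<phi>s ! i) z * (\<Prod>j\<in>{..<length vs} - {i}. (\<phi>s ! j) (vs ! j))" for z
    using assms by (subst prod.remove[of _ i]) (auto intro!: prod.cong)
  show "tensor scale (vs[i := scale c x]) \<phi>s = fscale c (tensor scale (vs[i := x])) \<phi>s"
  proof (cases "length \<phi>s = length vs \<and> (\<forall>\<phi>\<in>set \<phi>s. Vector_Spaces.linear scale (*) \<phi>)")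
    case True
    then have "Vector_Spaces.linear scale (*) (\<phi>s ! i)"
      using assms by auto
    then have "(\<phi>s ! i) (scale c x) = c * (\<phi>s ! i) x"
      by (simp add: Vector_Spaces.linear_iff)
    then show ?thesis
      using True unfolding tensor_def by (simp add: P fscale_def)
  next
    case False
    then show ?thesis unfolding tensor_def by (auto simp: fscale_def)
  qed
qed


section \<open>The signed place-permutation action\<close>

text \<open>\<open>S\<^sub>n\<close> consists of the \<open>\<sigma>\<close> with \<open>\<sigma> permutes {..<n}\<close>, with composition as product.
  The predicate \<open>p\<close> tells which factors are odd.\<close>

definition odd_inversions :: "nat \<Rightarrow> (nat \<Rightarrow> bool) \<Rightarrow> (nat \<Rightarrow> nat) \<Rightarrow> nat" where
  "odd_inversions n p \<sigma> = card {(i, j). i < j \<and> j < n \<and> p (\<sigma> i) \<and> p (\<sigma> j) \<and> \<sigma> j < \<sigma> i}"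

definition is_signed_action ::
    "('f::field \<Rightarrow> 'v::ab_group_add \<Rightarrow> 'v) \<Rightarrow> 'v set \<Rightarrow> 'v set \<Rightarrow> nat \<Rightarrow> (nat \<Rightarrow> nat)
     \<Rightarrow> ((('v \<Rightarrow> 'f) list \<Rightarrow> 'f) \<Rightarrow> ('v \<Rightarrow> 'f) list \<Rightarrow> 'f) \<Rightarrow> bool" where
  "is_signed_action scale V0 V1 n \<sigma> f \<longleftrightarrow>
     linear_between (tensor_power scale n) f \<and>
     (\<forall>t. t \<notin> tensor_power scale n \<longrightarrow> f t = 0) \<and>
     (\<forall>zs p. length zs = n \<and> (\<forall>i<n. zs ! i \<in> (if p i then V1 else V0)) \<longrightarrow>
        f (tensor scale zs) =
          fscale ((-1) ^ odd_inversions n p \<sigma>) (tensor scale (map (\<lambda>i. zs ! \<sigma> i) [0..<n])))"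

definition signed_action ::
    "('f::field \<Rightarrow> 'v::ab_group_add \<Rightarrow> 'v) \<Rightarrow> 'v set \<Rightarrow> 'v set \<Rightarrow> nat \<Rightarrow> (nat \<Rightarrow> nat)
     \<Rightarrow> (('v \<Rightarrow> 'f) list \<Rightarrow> 'f) \<Rightarrow> ('v \<Rightarrow> 'f) list \<Rightarrow> 'f" where
  "signed_action scale V0 V1 n \<sigma> = (THE f. is_signed_action scale V0 V1 n \<sigma> f)"

lemma tensor_power_homogeneous:
  fixes scale :: "'f::field \<Rightarrow> 'v::ab_group_add \<Rightarrow> 'v"
  assumes sp: "superspace scale V0 V1" and "length vs = n"
  shows "tensor scale vs \<in> fun_vs.span {tensor scale zs | zs. length zs = n \<and> set zs \<subseteq> V0 \<union> V1}"
    (is "_ \<in> ?S")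
proof -
  have "tensor scale vs \<in> ?S"
    if "length vs = n" "\<And>i. j \<le> i \<Longrightarrow> i < n \<Longrightarrow> vs ! i \<in> V0 \<union> V1" for j vs
    using that
  proof (induction j arbitrary: vs)
    case 0
    then have "set vs \<subseteq> V0 \<union> V1"
      by (metis le0 in_set_conv_nth subsetI)
    then show ?case
      using 0 by (intro fun_vs.span_base) auto
  next
    case (Suc j)
    show ?case
    proof (cases "j < n")
      case False
      then show ?thesis using Suc by (intro Suc.IH) auto
    next
      case True
      obtain x y where xy: "x \<in> V0" "y \<in> V1" "vs ! j = x + y"
        using sp unfolding superspace_def by meson
      have "tensor scale (vs[j := z]) \<in> ?S" if "z \<in> V0 \<union> V1" for z
        using Suc.prems True that by (intro Suc.IH) (auto simp: nth_list_update)
      moreover have "tensor scale vs = tensor scale (vs[j := x]) + tensor scale (vs[j := y])"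
        using tensor_add[of j vs scale x y] True Suc.prems(1) xy(3) by (metis list_update_id)
      ultimately show ?thesis
        using xy by (metis (no_types, lifting) UnCI fun_vs.span_add)
    qed
  qed
  from this[of vs n] assms(2) show ?thesis by simp
qed

text \<open>The operators in the definition of \<open>signed_action\<close> exist and are unique.\<close>

lemma signed_action_ex1:
  fixes scale :: "'f::field \<Rightarrow> 'v::ab_group_add \<Rightarrow> 'v"
  assumes sp: "superspace scale V0 V1" and \<sigma>: "\<sigma> permutes {..<n}"
  shows "\<exists>!f. is_signed_action scale V0 V1 n \<sigma> f"
proof (rule ex_ex1I)
  interpret vector_space scale using sp by (simp add: superspace_def)
  have sub: "subspace V0" "subspace V1" and int: "V0 \<inter> V1 = {0}"
    and dec: "\<And>v. \<exists>x\<in>V0. \<exists>y\<in>V1. v = x + y"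
    using sp by (auto simp: superspace_def)
  have uniq: "x = x' \<and> y = y'" if "x \<in> V0" "x' \<in> V0" "y \<in> V1" "y' \<in> V1" "x + y = x' + y'"
    for x x' y y'
  proof -
    have "x - x' = y' - y" using that(5) by (simp add: algebra_simps)
    then have "x - x' \<in> V0 \<inter> V1"
      using that sub by (metis IntI subspace_diff)
    then show ?thesis using int that(5) by auto
  qed
  obtain \<pi>0 where "\<And>v. \<pi>0 v \<in> V0 \<and> (\<exists>y\<in>V1. v = \<pi>0 v + y)" using dec by metis
  then obtain \<pi>1 where \<pi>: "\<And>v. \<pi>0 v \<in> V0" "\<And>v. \<pi>1 v \<in> V1" "\<And>v. v = \<pi>0 v + \<pi>1 v" by metis
  have \<pi>I: "\<pi>0 v = x \<and> \<pi>1 v = y" if "x \<in> V0" "y \<in> V1" "v = x + y" for v x y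
    using uniq \<pi> that by metis
  define \<pi> where "\<pi> b = (if b then \<pi>1 else \<pi>0)" for b
  have add: "\<pi> b (u + v) = \<pi> b u + \<pi> b v" for b u v
  proof -
    have "u + v = (\<pi>0 u + \<pi>0 v) + (\<pi>1 u + \<pi>1 v)"
      using \<pi>(3)[of u] \<pi>(3)[of v] by (metis add.assoc add.commute)
    then show ?thesis
      using \<pi>I[of "\<pi>0 u + \<pi>0 v" "\<pi>1 u + \<pi>1 v" "u + v"] \<pi>(1,2) sub
      by (simp add: subspace_add \<pi>_def)
  qed
  have scl: "\<pi> b (scale c u) = scale c (\<pi> b u)" for b c u
  proof -
    have "scale c u = scale c (\<pi>0 u) + scale c (\<pi>1 u)"
      using \<pi>(3)[of u] by (metis scale_right_distrib)
    then show ?thesis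
      using \<pi>I[of "scale c (\<pi>0 u)" "scale c (\<pi>1 u)" "scale c u"] \<pi>(1,2) sub
      by (simp add: subspace_scale \<pi>_def)
  qed
  have \<pi>V: "\<pi> b z = (if b = p then z else 0)" if "z \<in> (if p then V1 else V0)" for b p z
    using that \<pi>I[of z 0 z] \<pi>I[of 0 z z] sub by (auto simp: \<pi>_def subspace_0 split: if_splits)
  have lin: "Vector_Spaces.linear scale (*) (\<lambda>v. \<phi> (\<pi> b v))"
    if "Vector_Spaces.linear scale (*) \<phi>" for \<phi> :: "'v \<Rightarrow> 'f" and b
    using that by (simp add: Vector_Spaces.linear_iff add scl)

  define \<tau> where "\<tau> = inv \<sigma>"
  have \<tau>: "\<tau> permutes {..<n}" unfolding \<tau>_def using \<sigma> by (rule permutes_inv)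
  have inv: "\<sigma> (\<tau> i) = i" "\<tau> (\<sigma> i) = i" for i
    unfolding \<tau>_def using \<sigma> by (simp_all add: permutes_inverses)
  define \<psi> :: "nat set \<Rightarrow> ('v \<Rightarrow> 'f) list \<Rightarrow> ('v \<Rightarrow> 'f) list" where
    "\<psi> A \<phi>s = map (\<lambda>m v. (\<phi>s ! \<tau> m) (\<pi> (m \<in> A) v)) [0..<n]" for A \<phi>s
  define ok :: "('v \<Rightarrow> 'f) list \<Rightarrow> bool" where
    "ok \<phi>s \<longleftrightarrow> length \<phi>s = n \<and> (\<forall>\<phi>\<in>set \<phi>s. Vector_Spaces.linear scale (*) \<phi>)" for \<phi>s
  define g :: "(('v \<Rightarrow> 'f) list \<Rightarrow> 'f) \<Rightarrow> ('v \<Rightarrow> 'f) list \<Rightarrow> 'f" where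
    "g t = (\<lambda>\<phi>s. if ok \<phi>s then
        \<Sum>A\<in>Pow {..<n}. (-1) ^ odd_inversions n (\<lambda>m. m \<in> A) \<sigma> * t (\<psi> A \<phi>s) else 0)" for t
  have g_add: "g (s + t) = g s + g t" for s t
    by (auto simp: g_def fun_eq_iff distrib_left sum.distrib)
  have g_scale: "g (fscale c t) = fscale c (g t)" for c t
    by (auto simp: g_def fscale_def fun_eq_iff sum_distrib_left mult.left_commute intro!: sum.cong)
  have g_tensor: "g (tensor scale zs) =
      fscale ((-1) ^ odd_inversions n p \<sigma>) (tensor scale (map (\<lambda>i. zs ! \<sigma> i) [0..<n]))"
    if zs: "length zs = n" "\<forall>i<n. zs ! i \<in> (if p i then V1 else V0)" for zs p
  proof
    fix \<phi>s
    let ?A = "{i. i < n \<and> p i}"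
    show "g (tensor scale zs) \<phi>s = fscale ((-1) ^ odd_inversions n p \<sigma>)
        (tensor scale (map (\<lambda>i. zs ! \<sigma> i) [0..<n])) \<phi>s"
    proof (cases "ok \<phi>s")
      case False
      then show ?thesis using zs(1) by (auto simp: g_def ok_def tensor_def fscale_def)
    next
      case True
      have lin\<phi>: "Vector_Spaces.linear scale (*) (\<phi>s ! m)" if "m < n" for m
        using True that by (auto simp: ok_def)
      have \<tau>n: "\<tau> m < n" if "m < n" for m using \<tau> that by (metis lessThan_iff permutes_in_image)
      have \<sigma>n: "\<sigma> m < n" if "m < n" for m using \<sigma> that by (metis lessThan_iff permutes_in_image)
      have zero: "(\<phi>s ! m) 0 = 0" if "m < n" for m
        using lin\<phi>[OF that] by (metis Vector_Spaces.linear_iff mult_zero_left scale_zero_left)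
      have T: "tensor scale zs (\<psi> A \<phi>s) = (\<Prod>m<n. (\<phi>s ! \<tau> m) (\<pi> (m \<in> A) (zs ! m)))" for A
      proof -
        have "\<forall>\<phi>\<in>set (\<psi> A \<phi>s). Vector_Spaces.linear scale (*) \<phi>"
          by (auto simp: \<psi>_def intro!: lin lin\<phi> \<tau>n)
        then show ?thesis using zs(1) by (auto simp: tensor_def \<psi>_def intro!: prod.cong)
      qed
      have T0: "tensor scale zs (\<psi> A \<phi>s) = 0" if "A \<in> Pow {..<n} - {?A}" for A
      proof -
        have "A \<noteq> ?A" "A \<subseteq> {..<n}" using that by auto
        then obtain m where m: "m < n" "(m \<in> A) \<noteq> p m" by blast
        then have "(\<phi>s ! \<tau> m) (\<pi> (m \<in> A) (zs ! m)) = 0"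
          using zs(2) \<pi>V[of "zs ! m" "p m" "m \<in> A"] zero[OF \<tau>n] by simp
        then show ?thesis unfolding T using m(1) by (intro prod_zero) auto
      qed
      have "tensor scale zs (\<psi> ?A \<phi>s) = (\<Prod>m<n. (\<phi>s ! \<tau> m) (zs ! m))"
        unfolding T using zs(2) \<pi>V by (intro prod.cong) auto
      also have "\<dots> = (\<Prod>i<n. (\<phi>s ! i) (zs ! \<sigma> i))"
        using prod.permute[OF \<sigma>, of "\<lambda>m. (\<phi>s ! \<tau> m) (zs ! m)"] by (simp add: inv o_def)
      also have "\<dots> = tensor scale (map (\<lambda>i. zs ! \<sigma> i) [0..<n]) \<phi>s"
        using True by (auto simp: tensor_def ok_def intro!: prod.cong)
      finally have T1: "tensor scale zs (\<psi> ?A \<phi>s) = tensor scale (map (\<lambda>i. zs ! \<sigma> i) [0..<n]) \<phi>s" .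
      have "odd_inversions n (\<lambda>m. m \<in> ?A) \<sigma> = odd_inversions n p \<sigma>"
        unfolding odd_inversions_def using \<sigma>n by (intro arg_cong[of _ _ card]) auto
      moreover have "g (tensor scale zs) \<phi>s =
          (-1) ^ odd_inversions n (\<lambda>m. m \<in> ?A) \<sigma> * tensor scale zs (\<psi> ?A \<phi>s)"
        using True T0 unfolding g_def
        by (simp only: if_True, subst sum.remove[of _ ?A]) (auto intro!: sum.neutral)
      ultimately show ?thesis by (simp add: T1 fscale_def)
    qed
  qed
  define f where "f t = (if t \<in> tensor_power scale n then g t else 0)" for t
  have "is_signed_action scale V0 V1 n \<sigma> f"
    unfolding is_signed_action_def linear_between_def
  proof (intro conjI allI impI ballI)
    fix s t assume "s \<in> tensor_power scale n" "t \<in> tensor_power scale n"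
    then show "f (s + t) = f s + f t"
      by (simp add: f_def g_add tensor_power_def fun_vs.span_add)
  next
    fix c t assume "t \<in> tensor_power scale n"
    then show "f (fscale c t) = fscale c (f t)"
      by (simp add: f_def g_scale tensor_power_def fun_vs.span_scale)
  next
    fix t assume "t \<notin> tensor_power scale n" then show "f t = 0" by (simp add: f_def)
  next
    fix zs p assume zs: "length zs = n \<and> (\<forall>i<n. zs ! i \<in> (if p i then V1 else V0))"
    then have "tensor scale zs \<in> tensor_power scale n"
      unfolding tensor_power_def by (intro fun_vs.span_base) auto
    then show "f (tensor scale zs) =
        fscale ((-1) ^ odd_inversions n p \<sigma>) (tensor scale (map (\<lambda>i. zs ! \<sigma> i) [0..<n]))"
      using zs g_tensor[of zs p] by (simp add: f_def)
  qed
  then show "\<exists>f. is_signed_action scale V0 V1 n \<sigma> f" by (rule exI[of _ f])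
next
  fix f g assume f: "is_signed_action scale V0 V1 n \<sigma> f" and g: "is_signed_action scale V0 V1 n \<sigma> g"
  let ?H = "{tensor scale zs | zs. length zs = n \<and> set zs \<subseteq> V0 \<union> V1}"
  have HT: "fun_vs.span ?H \<subseteq> tensor_power scale n"
    unfolding tensor_power_def by (intro fun_vs.span_mono) auto
  have TH: "tensor_power scale n \<subseteq> fun_vs.span ?H"
    unfolding tensor_power_def
    by (intro fun_vs.span_minimal) (auto intro: tensor_power_homogeneous[OF sp])
  have add: "f (s + t) = f s + f t" "g (s + t) = g s + g t"
    if "s \<in> tensor_power scale n" "t \<in> tensor_power scale n" for s t
    using f g that by (auto simp: is_signed_action_def linear_between_def)
  have scl: "f (fscale c t) = fscale c (f t)" "g (fscale c t) = fscale c (g t)"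
    if "t \<in> tensor_power scale n" for c t
    using f g that by (auto simp: is_signed_action_def linear_between_def)
  have T0: "0 \<in> tensor_power scale n" by (simp add: tensor_power_def fun_vs.span_zero)
  have z: "f 0 = 0" "g 0 = 0"
    using scl[OF T0, of 0] by (simp_all only: fun_vs.scale_zero_left)
  have "t \<in> tensor_power scale n \<and> f t = g t" if "t \<in> fun_vs.span ?H" for t
    using that
  proof (induction rule: fun_vs.span_induct_alt)
    case base
    show ?case using T0 by (simp only: z)
  next
    case (step c x y)
    then obtain zs where zs: "x = tensor scale zs" "length zs = n" "set zs \<subseteq> V0 \<union> V1" by blast
    have hom: "\<forall>i<n. zs ! i \<in> (if zs ! i \<in> V1 then V1 else V0)"
      using zs by (auto dest: nth_mem)
    have "h x = fscale ((-1) ^ odd_inversions n (\<lambda>i. zs ! i \<in> V1) \<sigma>)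
        (tensor scale (map (\<lambda>i. zs ! \<sigma> i) [0..<n]))"
      if "is_signed_action scale V0 V1 n \<sigma> h" for h
      using that[unfolded is_signed_action_def, THEN conjunct2, THEN conjunct2, rule_format,
          of zs "\<lambda>i. zs ! i \<in> V1"] zs(1,2) hom by simp
    then have "f x = g x" using f g by simp
    moreover have "x \<in> fun_vs.span ?H" using step(1) by (rule fun_vs.span_base)
    then have "x \<in> tensor_power scale n" "fscale c x \<in> tensor_power scale n"
      using HT fun_vs.span_scale by blast+
    moreover from this(2) have "fscale c x + y \<in> tensor_power scale n"
      unfolding tensor_power_def
      by (rule fun_vs.span_add) (use step.IH in \<open>simp add: tensor_power_def\<close>)
    ultimately show ?case using step.IH by (simp only: add scl)
  qed
  moreover have "f t = g t" if "t \<notin> tensor_power scale n" for t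
    using f g that by (simp add: is_signed_action_def)
  ultimately show "f = g" using TH by blast
qed


section \<open>Irreducible modules of the symmetric groups\<close>

text \<open>The entries \<open>0, \<dots>, n - 1\<close> are written into the diagram of \<open>\<nu>\<close> row by row; \<open>row_of\<close>
  and \<open>col_of\<close> locate an entry in this tableau.\<close>

definition row_of :: "(nat \<Rightarrow> nat) \<Rightarrow> nat \<Rightarrow> nat" where
  "row_of \<nu> m = (LEAST i. m < (\<Sum>r\<le>i. \<nu> r))"

definition col_of :: "(nat \<Rightarrow> nat) \<Rightarrow> nat \<Rightarrow> nat" where
  "col_of \<nu> m = m - (\<Sum>r<row_of \<nu> m. \<nu> r)"

definition row_stabilizer :: "(nat \<Rightarrow> nat) \<Rightarrow> (nat \<Rightarrow> nat) set" where
  "row_stabilizer \<nu> =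
     {\<sigma>. \<sigma> permutes {..<psize \<nu>} \<and> (\<forall>m<psize \<nu>. row_of \<nu> (\<sigma> m) = row_of \<nu> m)}"

definition col_stabilizer :: "(nat \<Rightarrow> nat) \<Rightarrow> (nat \<Rightarrow> nat) set" where
  "col_stabilizer \<nu> =
     {\<sigma>. \<sigma> permutes {..<psize \<nu>} \<and> (\<forall>m<psize \<nu>. col_of \<nu> (\<sigma> m) = col_of \<nu> m)}"

text \<open>An element \<open>\<Sum>\<^sub>\<sigma> x\<^sub>\<sigma> \<sigma>\<close> of the group algebra \<open>F S\<^sub>n\<close> is the function \<open>\<sigma> \<mapsto> x\<^sub>\<sigma>\<close>,
  vanishing outside \<open>S\<^sub>n\<close>.\<close>

definition young_symmetrizer :: "(nat \<Rightarrow> nat) \<Rightarrow> (nat \<Rightarrow> nat) \<Rightarrow> 'f::field" where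
  "young_symmetrizer \<nu> = (\<lambda>\<rho>.
     \<Sum>p\<in>row_stabilizer \<nu>. \<Sum>q\<in>col_stabilizer \<nu>. if p \<circ> q = \<rho> then of_int (sign q) else 0)"

definition right_mult :: "(nat \<Rightarrow> nat) \<Rightarrow> ((nat \<Rightarrow> nat) \<Rightarrow> 'f) \<Rightarrow> (nat \<Rightarrow> nat) \<Rightarrow> 'f::field" where
  "right_mult \<sigma> x = (\<lambda>\<rho>. x (\<rho> \<circ> inv \<sigma>))"

text \<open>The right ideal of \<open>F S\<^sub>n\<close> generated by the Young symmetrizer is the irreducible right
  module with character \<open>\<chi>\<^sup>\<nu>\<close>, in the convention where one-row partitions give the trivial
  character.\<close>

definition irreducible_module :: "(nat \<Rightarrow> nat) \<Rightarrow> ((nat \<Rightarrow> nat) \<Rightarrow> 'f::field) set" where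
  "irreducible_module \<nu> =
     fun_vs.span {right_mult \<sigma> (young_symmetrizer \<nu>) | \<sigma>. \<sigma> permutes {..<psize \<nu>}}"


section \<open>Isotypic components and the algebras attached to filters\<close>

definition submodule ::
    "('f::field \<Rightarrow> 'v::ab_group_add \<Rightarrow> 'v) \<Rightarrow> 'v set \<Rightarrow> 'v set \<Rightarrow> nat
     \<Rightarrow> (('v \<Rightarrow> 'f) list \<Rightarrow> 'f) set \<Rightarrow> bool" where
  "submodule scale V0 V1 n U \<longleftrightarrow>
     fun_vs.subspace U \<and> U \<subseteq> tensor_power scale n \<and>
     (\<forall>\<sigma>. \<sigma> permutes {..<n} \<longrightarrow> signed_action scale V0 V1 n \<sigma> ` U \<subseteq> U)"

definition affords ::
    "('f::field \<Rightarrow> 'v::ab_group_add \<Rightarrow> 'v) \<Rightarrow> 'v set \<Rightarrow> 'v set \<Rightarrow> (nat \<Rightarrow> nat)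
     \<Rightarrow> (('v \<Rightarrow> 'f) list \<Rightarrow> 'f) set \<Rightarrow> bool" where
  "affords scale V0 V1 \<nu> U \<longleftrightarrow>
     (\<exists>f. linear_between U f \<and> bij_betw f U (irreducible_module \<nu>) \<and>
        (\<forall>\<sigma>. \<sigma> permutes {..<psize \<nu>} \<longrightarrow>
           (\<forall>t\<in>U. f (signed_action scale V0 V1 (psize \<nu>) \<sigma> t) = right_mult \<sigma> (f t))))"

definition isotypic_component ::
    "('f::field \<Rightarrow> 'v::ab_group_add \<Rightarrow> 'v) \<Rightarrow> 'v set \<Rightarrow> 'v set \<Rightarrow> (nat \<Rightarrow> nat)
     \<Rightarrow> (('v \<Rightarrow> 'f) list \<Rightarrow> 'f) set" where
  "isotypic_component scale V0 V1 \<nu> =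
     fun_vs.span (\<Union>{U. submodule scale V0 V1 (psize \<nu>) U \<and> affords scale V0 V1 \<nu> U})"

definition filter_ideal ::
    "('f::field \<Rightarrow> 'v::ab_group_add \<Rightarrow> 'v) \<Rightarrow> 'v set \<Rightarrow> 'v set \<Rightarrow> (nat \<Rightarrow> nat) set
     \<Rightarrow> (('v \<Rightarrow> 'f) list \<Rightarrow> 'f) set" where
  "filter_ideal scale V0 V1 \<Omega> = fun_vs.span (\<Union>\<nu>\<in>\<Omega>. isotypic_component scale V0 V1 \<nu>)"

text \<open>The component of degree \<open>n\<close> of \<open>T(V)/I\<^sub>\<Omega>\<close> is the image of \<open>V\<^sup>\<otimes>\<^sup>n\<close> in this quotient.\<close>

definition dim_A ::
    "('f::field \<Rightarrow> 'v::ab_group_add \<Rightarrow> 'v) \<Rightarrow> 'v set \<Rightarrow> 'v set \<Rightarrow> (nat \<Rightarrow> nat) set \<Rightarrow> nat \<Rightarrow> nat" where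
  "dim_A scale V0 V1 \<Omega> n = quot_dim (tensor_power scale n) (filter_ideal scale V0 V1 \<Omega>)"

end

(* Lower bound. Minimality of a yields a1 + a2 = a - 1 such that no partition in Omega fits into an
   (a1, a2)-hook. Let U be a subsuperspace of V of dimension (a1, a2). The projection V -> U induces
   an equivariant projection T(V) -> T(U), and this kills the ideal, because the Young symmetrizer of
   a partition containing the box (a1 + 1, a2 + 1) acts as 0 on T(U). Hence T(U) embeds into the
   quotient, and dim T^n(U) = (a - 1)^n.

   Upper bound. Every nonzero S_n-module contains a highest weight vector, that is, a vector that is
   symmetric along the rows of some partition and satisfies the Garnir relations between them. Such
   vectors stay nonzero when antisymmetrized along columns. For a partition in Omega this gives a
   nonzero vector in the ideal. A partition outside Omega has i long rows and j long columns,
   i + j < a, and boundedly many other boxes, so one obtains a nonzero vector that is symmetric in i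
   blocks of positions and antisymmetric in j further ones. By Maschke's theorem T^n(V) is therefore
   the sum of its part in the ideal and of the spaces of such block-symmetric tensors. Each of these
   spaces has polynomially bounded dimension, because a tensor in it is determined by the
   coefficients of words up to permutation inside the blocks, and there are at most
   p(n) (a - 1)^n ways to choose the blocks. *)

theory Submission
  imports Defs
begin

section \<open>Right actions of the symmetric group\<close>

text \<open>Both bounds rest on one nonvanishing statement, \<open>alt_nonzero\<close>. For highest
  weight vectors it keeps the column antisymmetrizations nonzero. For the action twisted by the
  sign, where rows and columns exchange roles, it explains why the Young symmetrizer of a partition
  with a box in row \<open>card U0\<close> and column \<open>card U1\<close>, counted from 0,
  vanishes on T(U). A vector in its image satisfies relations along the columns. They survive when
  the positions of an even letter are deleted, and as an even letter occurs at most once in a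
  column, a position is left in each of \<open>card U1 + 1\<close> columns after all even letters
  are gone. Symmetrizing over such positions keeps the vector nonzero, yet two of them carry the
  same odd letter. Highest weight vectors come from a minimum: among the colourings of the positions
  for which a submodule has a nonzero symmetric vector, one takes a colouring with the least sum of
  colours. All vectors built from it stay in the submodule, so a complement of the part already
  reached can be tested for 0 by a single vector.\<close>

text \<open>The laws are demanded on \<open>T\<close> only, because \<open>signed_action\<close> is
  0 outside the tensor power. Besides tensor powers, the instances are the group algebra acting on
  itself and the sign twist of any instance. By \<open>act_comp\<close> this is a right action: in
  \<open>act (\<sigma> \<circ> \<tau>)\<close> the factor \<sigma> acts first.\<close>

locale sym_action =
  fixes n :: nat and T :: "('x \<Rightarrow> 'f::field_char_0) set"
    and act :: "(nat \<Rightarrow> nat) \<Rightarrow> ('x \<Rightarrow> 'f) \<Rightarrow> 'x \<Rightarrow> 'f"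
  assumes subspace_T: "fun_vs.subspace T"
    and act_closed: "\<sigma> permutes {..<n} \<Longrightarrow> t \<in> T \<Longrightarrow> act \<sigma> t \<in> T"
    and act_add: "\<sigma> permutes {..<n} \<Longrightarrow> s \<in> T \<Longrightarrow> t \<in> T \<Longrightarrow> act \<sigma> (s + t) = act \<sigma> s + act \<sigma> t"
    and act_scale: "\<sigma> permutes {..<n} \<Longrightarrow> t \<in> T \<Longrightarrow> act \<sigma> (fscale c t) = fscale c (act \<sigma> t)"
    and act_id: "t \<in> T \<Longrightarrow> act id t = t"
    and act_comp: "\<sigma> permutes {..<n} \<Longrightarrow> \<tau> permutes {..<n} \<Longrightarrow> t \<in> T \<Longrightarrow>
      act (\<sigma> \<circ> \<tau>) t = act \<tau> (act \<sigma> t)"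

context sym_action
begin

lemma zero_T: "0 \<in> T" and add_T: "s \<in> T \<Longrightarrow> t \<in> T \<Longrightarrow> s + t \<in> T"
  and scale_T: "t \<in> T \<Longrightarrow> fscale c t \<in> T" and diff_T: "s \<in> T \<Longrightarrow> t \<in> T \<Longrightarrow> s - t \<in> T"
  and neg_T: "t \<in> T \<Longrightarrow> - t \<in> T" and sum_T: "(\<And>i. i \<in> A \<Longrightarrow> f i \<in> T) \<Longrightarrow> sum f A \<in> T"
  using subspace_T
  by (auto intro: fun_vs.subspace_0 fun_vs.subspace_add fun_vs.subspace_scale
      fun_vs.subspace_diff fun_vs.subspace_neg fun_vs.subspace_sum)

lemma act_zero: "\<sigma> permutes {..<n} \<Longrightarrow> act \<sigma> 0 = 0"
  using act_scale[OF _ zero_T, of \<sigma> 0] by (simp only: fun_vs.scale_zero_left)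

lemma act_neg: "\<sigma> permutes {..<n} \<Longrightarrow> t \<in> T \<Longrightarrow> act \<sigma> (- t) = - act \<sigma> t"
  using act_scale[of \<sigma> t "-1"] by (simp only: fun_vs.scale_minus_left fun_vs.scale_one)

lemma act_sum:
  "\<sigma> permutes {..<n} \<Longrightarrow> (\<And>i. i \<in> A \<Longrightarrow> f i \<in> T) \<Longrightarrow> act \<sigma> (sum f A) = (\<Sum>i\<in>A. act \<sigma> (f i))"
  by (induction A rule: infinite_finite_induct) (simp_all add: act_zero act_add sum_T)

lemma act_inv: "\<sigma> permutes {..<n} \<Longrightarrow> t \<in> T \<Longrightarrow> act (inv \<sigma>) (act \<sigma> t) = t"
  by (metis act_comp act_id permutes_inv permutes_inv_o(1))

lemma act_inv': "\<sigma> permutes {..<n} \<Longrightarrow> t \<in> T \<Longrightarrow> act \<sigma> (act (inv \<sigma>) t) = t"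
  by (metis act_comp act_id permutes_inv permutes_inv_o(2))

lemma act_eq_zero: "\<sigma> permutes {..<n} \<Longrightarrow> t \<in> T \<Longrightarrow> act \<sigma> t = 0 \<Longrightarrow> t = 0"
  by (metis act_inv act_zero permutes_inv)

section \<open>Submodules and their complements\<close>

definition submod :: "('x \<Rightarrow> 'f) set \<Rightarrow> bool" where
  "submod N \<longleftrightarrow> fun_vs.subspace N \<and> N \<subseteq> T \<and> (\<forall>\<sigma>. \<sigma> permutes {..<n} \<longrightarrow> (\<forall>t\<in>N. act \<sigma> t \<in> N))"

text \<open>A linear projection onto \<open>N\<close>, averaged over its conjugates, becomes an
  equivariant projection \<open>Q\<close>; the complement is the kernel of \<open>Q\<close> in
  \<open>T\<close>.\<close>

theorem maschke:
  assumes N: "submod N"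
  obtains M where "submod M" "N \<inter> M = {0}" "\<And>t. t \<in> T \<Longrightarrow> \<exists>x\<in>N. \<exists>y\<in>M. t = x + y"
proof -
  interpret pr: vector_space_pair "fscale :: 'f \<Rightarrow> ('x \<Rightarrow> 'f) \<Rightarrow> _" "fscale :: 'f \<Rightarrow> ('x \<Rightarrow> 'f) \<Rightarrow> _" ..
  have subN: "fun_vs.subspace N" and NT: "N \<subseteq> T"
    and clN: "\<And>\<sigma> t. \<sigma> permutes {..<n} \<Longrightarrow> t \<in> N \<Longrightarrow> act \<sigma> t \<in> N"
    using N by (auto simp: submod_def)
  have "Vector_Spaces.linear fscale fscale (id :: ('x \<Rightarrow> 'f) \<Rightarrow> 'x \<Rightarrow> 'f)"
    by (rule fun_vs.linear_id)
  \<comment> \<open>A left inverse of the identity restricted to \<open>N\<close> is a linear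
    projection onto \<open>N\<close>.\<close>
  from pr.linear_exists_left_inverse_on[OF this subN] obtain P where
    P: "range P \<subseteq> N" "Vector_Spaces.linear fscale fscale P" "\<And>v. v \<in> N \<Longrightarrow> P v = v" by auto
  let ?S = "{\<sigma>. \<sigma> permutes {..<n}}"
  have fin: "finite ?S" by (simp add: finite_permutations)
  define Q where "Q t = fscale (1 / of_nat (card ?S)) (\<Sum>\<sigma>\<in>?S. act \<sigma> (P (act (inv \<sigma>) t)))" for t
  have card: "of_nat (card ?S) \<noteq> (0::'f)"
    using fin permutes_id by (auto simp: card_eq_0_iff intro: exI[of _ id])
  have PN: "P t \<in> N" for t using P(1) by blast
  have PT: "P t \<in> T" for t using PN NT by blast
  have QN: "Q t \<in> N" for t
    unfolding Q_def using PN by (intro fun_vs.subspace_scale fun_vs.subspace_sum subN clN) auto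
  have QT: "Q t \<in> T" for t using QN NT by blast
  have QI: "Q t = t" if "t \<in> N" for t
  proof -
    have "act \<sigma> (P (act (inv \<sigma>) t)) = t" if "\<sigma> \<in> ?S" for \<sigma>
      using that \<open>t \<in> N\<close> NT by (auto simp: P(3) clN permutes_inv act_inv')
    then have "Q t = fscale (1 / of_nat (card ?S)) (\<Sum>\<sigma>\<in>?S. t)" by (simp add: Q_def)
    also have "\<dots> = t" using card by (simp only: fun_vs.sum_constant_scale fun_vs.scale_scale) simp
    finally show ?thesis .
  qed
  have Q_add: "Q (s + t) = Q s + Q t" if "s \<in> T" "t \<in> T" for s t
    using that by (simp add: Q_def act_add permutes_inv pr.linear_add[OF P(2)] PT sum.distrib
        fun_vs.scale_right_distrib)
  have Q_scale: "Q (fscale c t) = fscale c (Q t)" if "t \<in> T" for c t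
  proof -
    have "Q (fscale c t) = fscale (1 / of_nat (card ?S)) (\<Sum>\<sigma>\<in>?S. fscale c (act \<sigma> (P (act (inv \<sigma>) t))))"
      using that by (simp add: Q_def act_scale permutes_inv pr.linear_scale[OF P(2)] PT)
    then show ?thesis
      by (simp add: Q_def fun_vs.scale_sum_right[symmetric] mult.commute)
  qed
  have Q_act: "Q (act \<tau> t) = act \<tau> (Q t)" if "\<tau> permutes {..<n}" "t \<in> T" for \<tau> t
  proof -
    \<comment> \<open>Replacing the summation variable by \<sigma> \<circ> \<tau> pulls \<tau> out
      of the average.\<close>
    have "(\<Sum>\<sigma>\<in>?S. act \<sigma> (P (act (inv \<sigma>) (act \<tau> t)))) =
        (\<Sum>\<sigma>\<in>?S. act (\<sigma> \<circ> \<tau>) (P (act (inv (\<sigma> \<circ> \<tau>)) (act \<tau> t))))"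
      by (rule sum_permutations_compose_right[OF that(1)])
    also have "\<dots> = (\<Sum>\<sigma>\<in>?S. act \<tau> (act \<sigma> (P (act (inv \<sigma>) t))))"
    proof (rule sum.cong[OF refl])
      fix \<sigma> assume \<sigma>: "\<sigma> \<in> ?S"
      have "inv (\<sigma> \<circ> \<tau>) = inv \<tau> \<circ> inv \<sigma>"
        using \<sigma> that(1) by (simp add: o_inv_distrib permutes_bij)
      then have "act (inv (\<sigma> \<circ> \<tau>)) (act \<tau> t) = act (inv \<sigma>) t"
        using \<sigma> that by (simp add: act_comp permutes_inv act_closed act_inv)
      then show "act (\<sigma> \<circ> \<tau>) (P (act (inv (\<sigma> \<circ> \<tau>)) (act \<tau> t))) = act \<tau> (act \<sigma> (P (act (inv \<sigma>) t)))"
        using \<sigma> that(1) by (simp add: act_comp PT)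
    qed
    also have "\<dots> = act \<tau> (\<Sum>\<sigma>\<in>?S. act \<sigma> (P (act (inv \<sigma>) t)))"
      using that by (subst act_sum) (auto simp: act_closed PT)
    finally show ?thesis
      using that unfolding Q_def
      by (subst act_scale) (auto intro!: sum_T act_closed PT)
  qed
  define M where "M = {t \<in> T. Q t = 0}"
  have "Q 0 = 0" using Q_scale[OF zero_T, of 0] by (simp only: fun_vs.scale_zero_left)
  then have "submod M"
    unfolding submod_def M_def fun_vs.subspace_def
    using Q_act act_zero by (auto simp: zero_T add_T scale_T Q_add Q_scale act_closed)
  moreover have "N \<inter> M = {0}"
    using QI NT \<open>submod M\<close> subN
    by (auto simp: M_def submod_def fun_vs.subspace_0)
  moreover have "\<exists>x\<in>N. \<exists>y\<in>M. t = x + y" if "t \<in> T" for t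
  proof (intro bexI)
    show "t = Q t + (t - Q t)" by simp
    have "Q t = Q (t - Q t) + Q (Q t)"
      using Q_add[of "t - Q t" "Q t"] that by (simp add: diff_T QT)
    then have "Q (t - Q t) = 0" using QI[OF QN] by simp
    then show "t - Q t \<in> M" using that by (simp add: M_def diff_T QT)
  qed (rule QN)
  ultimately show thesis by (rule that)
qed

section \<open>Antisymmetrizers over a set of positions\<close>

definition alt :: "nat set \<Rightarrow> ('x \<Rightarrow> 'f) \<Rightarrow> 'x \<Rightarrow> 'f" where
  "alt S v = (\<Sum>q | q permutes S. fscale (of_int (sign q)) (act q v))"

lemma permutes_n: "q permutes S \<Longrightarrow> S \<subseteq> {..<n} \<Longrightarrow> q permutes {..<n}"
  by (rule permutes_subset)

lemma transpose_n: "s < n \<Longrightarrow> t < n \<Longrightarrow> transpose s t permutes {..<n}"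
  by (simp add: permutes_swap_id)

lemma alt_T: "v \<in> T \<Longrightarrow> S \<subseteq> {..<n} \<Longrightarrow> alt S v \<in> T"
  unfolding alt_def by (intro sum_T scale_T act_closed) (auto intro: permutes_n)

lemma alt_add: "v \<in> T \<Longrightarrow> w \<in> T \<Longrightarrow> S \<subseteq> {..<n} \<Longrightarrow> alt S (v + w) = alt S v + alt S w"
  unfolding alt_def sum.distrib[symmetric]
  by (intro sum.cong) (auto simp: act_add permutes_n fun_vs.scale_right_distrib)

lemma alt_zero: "S \<subseteq> {..<n} \<Longrightarrow> alt S 0 = 0"
  unfolding alt_def by (intro sum.neutral) (auto simp: act_zero permutes_n)

lemma alt_neg: "v \<in> T \<Longrightarrow> S \<subseteq> {..<n} \<Longrightarrow> alt S (- v) = - alt S v"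
  using alt_add[of v "-v" S] alt_zero[of S]
  by (simp add: neg_T add_eq_0_iff)

lemma alt_sum: "(\<And>i. i \<in> A \<Longrightarrow> f i \<in> T) \<Longrightarrow> S \<subseteq> {..<n} \<Longrightarrow> alt S (sum f A) = (\<Sum>i\<in>A. alt S (f i))"
  by (induction A rule: infinite_finite_induct) (simp_all add: alt_zero alt_add sum_T)

text \<open>Permutations with disjoint supports commute.\<close>

lemma act_alt_commute:
  assumes "\<sigma> permutes {..<n}" "v \<in> T" "S \<subseteq> {..<n}" "\<And>s. s \<in> S \<Longrightarrow> \<sigma> s = s"
  shows "act \<sigma> (alt S v) = alt S (act \<sigma> v)"
proof -
  have "q \<circ> \<sigma> = \<sigma> \<circ> q" if "q permutes S" for q
  proof
    fix x
    show "(q \<circ> \<sigma>) x = (\<sigma> \<circ> q) x"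
    proof (cases "x \<in> S")
      case True
      then show ?thesis using that assms(4) by (simp add: permutes_in_image)
    next
      case False
      then have "\<sigma> x \<notin> S" using assms(1,4) by (metis permutes_inverses(2))
      then show ?thesis using that False by (simp add: permutes_not_in)
    qed
  qed
  then have "act \<sigma> (act q v) = act q (act \<sigma> v)" if "q permutes S" for q
    using that assms act_comp permutes_n by metis
  then show ?thesis
    unfolding alt_def using assms
    by (subst act_sum) (auto simp: act_scale permutes_n act_closed scale_T intro!: sum.cong)
qed

text \<open>Conjugation by a permutation of \<open>S\<close> only permutes the transpositions (t s)
  among themselves, so it is their sum that commutes with the antisymmetrizer.\<close>

lemma alt_transpose_sum:
  assumes v: "v \<in> T" and S: "S \<subseteq> {..<n}" and t: "t \<notin> S" "t < n"
  shows "(\<Sum>s\<in>S. alt S (act (transpose t s) v)) = (\<Sum>s\<in>S. act (transpose t s) (alt S v))"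
proof -
  have 1: "act (transpose t s) (alt S v) =
      (\<Sum>q | q permutes S. fscale (of_int (sign q)) (act (q \<circ> transpose t s) v))" if "s \<in> S" for s
    unfolding alt_def using v S t that
    by (subst act_sum) (auto simp: act_scale permutes_n act_closed scale_T transpose_n act_comp
        subset_iff intro!: sum.cong)
  have 2: "alt S (act (transpose t s) v) =
      (\<Sum>q | q permutes S. fscale (of_int (sign q)) (act (transpose t s \<circ> q) v))" if "s \<in> S" for s
    unfolding alt_def using v S t that
    by (auto simp: permutes_n transpose_n act_comp subset_iff intro!: sum.cong)
  have "(\<Sum>s\<in>S. alt S (act (transpose t s) v)) =
      (\<Sum>q | q permutes S. \<Sum>s\<in>S. fscale (of_int (sign q)) (act (transpose t s \<circ> q) v))"
    by (subst sum.swap) (simp add: 2)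
  also have "\<dots> = (\<Sum>q | q permutes S. \<Sum>s\<in>S. fscale (of_int (sign q)) (act (q \<circ> transpose t s) v))"
  proof (rule sum.cong[OF refl])
    fix q assume q: "q \<in> {q. q permutes S}"
    have "(\<Sum>s\<in>S. fscale (of_int (sign q)) (act (transpose t s \<circ> q) v)) =
        (\<Sum>s\<in>S. fscale (of_int (sign q)) (act (transpose t (q s) \<circ> q) v))"
      using q sum.permute[of q S "\<lambda>s. fscale (of_int (sign q)) (act (transpose t s \<circ> q) v)"]
      by (simp add: o_def)
    also have "transpose t (q s) \<circ> q = q \<circ> transpose t s" if "s \<in> S" for s
      using q t(1) transpose_comp_eq[of q t "q s"]
      by (simp add: permutes_bij permutes_not_in[OF permutes_inv] permutes_inverses)
    then have "(\<Sum>s\<in>S. fscale (of_int (sign q)) (act (transpose t (q s) \<circ> q) v)) =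
        (\<Sum>s\<in>S. fscale (of_int (sign q)) (act (q \<circ> transpose t s) v))" by simp
    finally show "(\<Sum>s\<in>S. fscale (of_int (sign q)) (act (transpose t s \<circ> q) v)) =
        (\<Sum>s\<in>S. fscale (of_int (sign q)) (act (q \<circ> transpose t s) v))" .
  qed
  also have "\<dots> = (\<Sum>s\<in>S. act (transpose t s) (alt S v))"
    by (subst sum.swap) (simp add: 1)
  finally show ?thesis .
qed

text \<open>The transpositions (c b) represent the cosets of the permutations of \<open>S\<close> in
  those of \<open>insert c S\<close>; \<open>alt_transpose_sum\<close> brings them to the other side
  of the antisymmetrizer, where they act on \<open>alt S v\<close>.\<close>

lemma alt_insert:
  assumes v: "v \<in> T" and S: "S \<subseteq> {..<n}" and c: "c \<notin> S" "c < n"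
  shows "alt (insert c S) v = alt S v - (\<Sum>s\<in>S. act (transpose c s) (alt S v))"
proof -
  have fin: "finite S" using S finite_subset by blast
  have "alt (insert c S) v = (\<Sum>b\<in>insert c S. \<Sum>q | q permutes S.
      fscale (of_int (sign (transpose c b \<circ> q))) (act (transpose c b \<circ> q) v))"
    unfolding alt_def by (rule sum_over_permutations_insert[OF fin c(1)])
  also have "\<dots> = alt S v + (\<Sum>s\<in>S. - alt S (act (transpose c s) v))"
  proof (subst sum.insert[OF fin c(1)], rule arg_cong2[where f = "(+)"])
    show "(\<Sum>q | q permutes S. fscale (of_int (sign (transpose c c \<circ> q))) (act (transpose c c \<circ> q) v))
        = alt S v" by (simp add: alt_def)
    show "(\<Sum>b\<in>S. \<Sum>q | q permutes S.
        fscale (of_int (sign (transpose c b \<circ> q))) (act (transpose c b \<circ> q) v)) =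
        (\<Sum>s\<in>S. - alt S (act (transpose c s) v))"
    proof (rule sum.cong[OF refl])
      fix s assume s: "s \<in> S"
      have "fscale (of_int (sign (transpose c s \<circ> q))) (act (transpose c s \<circ> q) v) =
          - fscale (of_int (sign q)) (act q (act (transpose c s) v))" if "q permutes S" for q
      proof -
        have "permutation q" using that fin permutation_permutes by blast
        then have "sign (transpose c s \<circ> q) = - sign q"
          using c(1) s by (auto simp: sign_compose permutation_swap_id sign_swap_id)
        then show ?thesis
          using that s c v S by (simp add: act_comp transpose_n permutes_n subset_iff)
      qed
      then show "(\<Sum>q | q permutes S.
          fscale (of_int (sign (transpose c s \<circ> q))) (act (transpose c s \<circ> q) v)) =
          - alt S (act (transpose c s) v)"
        by (simp add: alt_def sum_negf)
    qed
  qed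
  also have "\<dots> = alt S v - (\<Sum>s\<in>S. act (transpose c s) (alt S v))"
    using alt_transpose_sum[OF v S c] by (simp add: sum_negf)
  finally show ?thesis .
qed

text \<open>Multiplying the summation variable by (s t) on the right gives the first claim, on the
  left the second.\<close>

lemma act_transpose_alt:
  assumes v: "v \<in> T" and S: "S \<subseteq> {..<n}" and st: "s \<in> S" "t \<in> S" "s \<noteq> t"
  shows "act (transpose s t) (alt S v) = - alt S v" (is ?thesis1)
    and "alt S (act (transpose s t) v) = - alt S v" (is ?thesis2)
proof -
  have fin: "finite S" using S finite_subset by blast
  have st_S: "transpose s t permutes S" using st by (simp add: permutes_swap_id)
  have sg: "sign (transpose s t) = -1" using st by (simp add: sign_swap_id)
  have perm: "permutation q" if "q permutes S" for q using that fin permutation_permutes by blast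
  have "- alt S v = (\<Sum>q | q permutes S. - fscale (of_int (sign q)) (act q v))"
    by (simp add: alt_def sum_negf)
  also have "\<dots> = (\<Sum>q | q permutes S. - fscale (of_int (sign (q \<circ> transpose s t))) (act (q \<circ> transpose s t) v))"
    by (rule sum_permutations_compose_right[OF st_S])
  also have "\<dots> = (\<Sum>q | q permutes S. fscale (of_int (sign q)) (act (transpose s t) (act q v)))"
    using v S st_S sg perm by (intro sum.cong)
      (auto simp: sign_compose permutation_swap_id act_comp permutes_n)
  also have "\<dots> = act (transpose s t) (alt S v)"
    unfolding alt_def using v S st_S
    by (subst act_sum) (auto simp: act_scale permutes_n act_closed scale_T intro!: sum.cong)
  finally show ?thesis1 by simp
  have "- alt S v = (\<Sum>q | q permutes S. - fscale (of_int (sign q)) (act q v))"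
    by (simp add: alt_def sum_negf)
  also have "\<dots> = (\<Sum>q | q permutes S. - fscale (of_int (sign (transpose s t \<circ> q))) (act (transpose s t \<circ> q) v))"
    by (rule setum_permutations_compose_left[OF st_S])
  also have "\<dots> = (\<Sum>q | q permutes S. fscale (of_int (sign q)) (act q (act (transpose s t) v)))"
    using v S st_S sg perm by (intro sum.cong)
      (auto simp: sign_compose permutation_swap_id act_comp permutes_n)
  also have "\<dots> = alt S (act (transpose s t) v)"
    by (simp add: alt_def)
  finally show ?thesis2 by simp
qed

end

text \<open>With these rules the simplifier turns the \<open>0\<close> of an eta-expanded induction goal into
  \<open>\<lambda>_. 0\<close>, which no longer matches the facts about \<open>0\<close>.\<close>

declare plus_fun_apply [simp del] zero_fun_apply [simp del]

lemma fun_double_zero: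
  assumes "x = - x" shows "x = (0 :: 'x \<Rightarrow> 'f::field_char_0)"
proof
  fix i
  have "x i = - x i" using fun_cong[OF assms, of i] by simp
  then have "x i + x i = 0" by (metis add.right_inverse)
  then have "2 * x i = 0" by (simp only: mult_2)
  then show "x i = 0 i" by (simp add: zero_fun_apply)
qed

section \<open>Highest weight vectors and their column antisymmetrizations\<close>

context sym_action
begin

text \<open>These are the highest weight vectors: symmetric along the rows, and annihilated when the
  entry \<open>s\<close> is symmetrized into an earlier row.\<close>

definition garnir :: "(nat \<Rightarrow> nat) \<Rightarrow> nat set \<Rightarrow> ('x \<Rightarrow> 'f) \<Rightarrow> bool" where
  "garnir row P v \<longleftrightarrow> v \<in> T \<and>
     (\<forall>s\<in>P. \<forall>t\<in>P. row s = row t \<longrightarrow> act (transpose s t) v = v) \<and>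
     (\<forall>s\<in>P. \<forall>i<row s. v + (\<Sum>t | t \<in> P \<and> row t = i. act (transpose t s) v) = 0)"

text \<open>Let \<open>z\<close> be the result for \<open>S\<close> and let \<open>c\<close> lie in a row \<open>R\<close> before those of \<open>S\<close>. If the result for
  \<open>S \<union> {c}\<close> were 0, then \<open>z\<close> would be the sum of the \<open>z (c s)\<close>, hence of the \<open>z (t s)\<close> for each \<open>t\<close> in
  \<open>R\<close>. Summed over \<open>t\<close> and compared with the relations, this gives \<open>(card R + card S) z = 0\<close>.\<close>

lemma alt_nonzero:
  assumes g: "garnir row P v" and "v \<noteq> 0" and P: "P \<subseteq> {..<n}" and "S \<subseteq> P" "inj_on row S"
  shows "alt S v \<noteq> 0"
proof -
  have v: "v \<in> T" and sym: "\<And>s t. s \<in> P \<Longrightarrow> t \<in> P \<Longrightarrow> row s = row t \<Longrightarrow> act (transpose s t) v = v"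
    and rel: "\<And>s i. s \<in> P \<Longrightarrow> i < row s \<Longrightarrow> v + (\<Sum>t | t \<in> P \<and> row t = i. act (transpose t s) v) = 0"
    using g by (auto simp: garnir_def)
  have fin: "finite P" using P finite_subset by blast
  then have "finite S" using assms finite_subset by blast
  then show ?thesis using assms(4,5)
  \<comment> \<open>Ranking by the negated row inserts later rows first, so the new \<open>c\<close>
    lies in an earlier row than all of \<open>S\<close>.\<close>
  proof (induction S rule: finite_ranking_induct[where f = "\<lambda>m. - int (row m)"])
    case empty
    have "alt {} v = v" using v by (simp add: alt_def act_id)
    then show ?case using \<open>v \<noteq> 0\<close> by simp
  next
    case (insert c S)
    show ?case
    proof (cases "c \<in> S")
      case True
      then show ?thesis using insert by (simp add: insert_absorb)
    next
      case False
      have S: "S \<subseteq> {..<n}" and c: "c < n" and cP: "c \<in> P" using insert.prems P by auto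
      have above: "row c < row s" if "s \<in> S" for s
      proof -
        have "row c \<le> row s" using insert.hyps(2)[OF that] by simp
        moreover have "row c \<noteq> row s"
          using insert.prems(2) that False by (auto simp: inj_on_def)
        ultimately show ?thesis by simp
      qed
      define z where "z = alt S v"
      have z: "z \<in> T" "z \<noteq> 0" using insert v S by (auto simp: z_def alt_T)
      let ?R = "{t \<in> P. row t = row c}"
      have finR: "finite ?R" "c \<in> ?R" using fin cP by auto
      show ?thesis
      proof
        assume "alt (insert c S) v = 0"
        then have z_eq: "z = (\<Sum>s\<in>S. act (transpose c s) z)"
          using alt_insert[OF v S False c] by (simp add: z_def)
        \<comment> \<open>For t in the row of c, the transposition (c t) fixes v and avoids
          \<open>S\<close>, hence fixes z; this transfers the equation from c to t.\<close>
        have zt: "z = (\<Sum>s\<in>S. act (transpose t s) z)" if t: "t \<in> ?R" for t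
        proof -
          have tn: "t < n" and tS: "t \<notin> S" using t P above[of t] by auto
          have p: "transpose c t permutes {..<n}" using c tn by (rule transpose_n)
          have "act (transpose c t) v = v" using cP t by (intro sym) auto
          then have zz: "act (transpose c t) z = z"
            unfolding z_def using p v S False tS
            by (subst act_alt_commute) (auto simp: transpose_def)
          have "act (transpose c t) (act (transpose c s) z) = act (transpose t s) z" if s: "s \<in> S" for s
          proof -
            have sn: "s < n" "s \<noteq> t" "s \<noteq> c" using s S tS False by auto
            have "transpose c s \<circ> transpose c t = transpose c t \<circ> transpose t s"
              using sn by (auto simp: fun_eq_iff transpose_def)
            then have "act (transpose c t) (act (transpose c s) z) = act (transpose t s) (act (transpose c t) z)"
              using z c sn tn by (metis act_comp transpose_n)
            then show ?thesis by (simp add: zz)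
          qed
          then have eq: "act (transpose c t) (\<Sum>s\<in>S. act (transpose c s) z) = (\<Sum>s\<in>S. act (transpose t s) z)"
            using z c S p by (subst act_sum) (auto intro!: act_closed transpose_n)
          have "act (transpose c t) z = act (transpose c t) (\<Sum>s\<in>S. act (transpose c s) z)"
            using z_eq by (rule arg_cong)
          then show ?thesis using eq zz by (simp only:)
        qed
        have "(\<Sum>s\<in>S. alt S (v + (\<Sum>t\<in>?R. act (transpose t s) v))) = 0"
        proof (rule sum.neutral, rule ballI)
          fix s assume "s \<in> S"
          then have "v + (\<Sum>t\<in>?R. act (transpose t s) v) = 0"
            using insert.prems(1) above by (intro rel) auto
          then show "alt S (v + (\<Sum>t\<in>?R. act (transpose t s) v)) = 0"
            using alt_zero[OF S] by simp
        qed
        moreover have "alt S (v + (\<Sum>t\<in>?R. act (transpose t s) v)) =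
            z + (\<Sum>t\<in>?R. alt S (act (transpose t s) v))" if "s \<in> S" for s
          using v S P that
          by (subst alt_add alt_sum, auto simp: z_def intro!: sum_T act_closed transpose_n)+
        ultimately have "(\<Sum>s\<in>S. z) + (\<Sum>t\<in>?R. \<Sum>s\<in>S. alt S (act (transpose t s) v)) = 0"
          by (subst sum.swap) (simp add: sum.distrib)
        moreover have "(\<Sum>s\<in>S. alt S (act (transpose t s) v)) = z" if "t \<in> ?R" for t
        proof -
          have "t \<notin> S" "t < n" using that above[of t] P by auto
          note 1 = alt_transpose_sum[OF v S this]
          show ?thesis
            unfolding z_def by (rule trans[OF 1 zt[OF that, unfolded z_def, symmetric]])
        qed
        ultimately have "(\<Sum>s\<in>S. z) + (\<Sum>t\<in>?R. z) = 0" by simp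
        then have "fscale (of_nat (card S + card ?R)) z = 0"
          by (simp only: fun_vs.sum_constant_scale fun_vs.scale_left_distrib of_nat_add)
        moreover have "card ?R \<noteq> 0" using finR by auto
        ultimately show False using z(2) by (simp del: of_nat_add add: fun_vs.scale_eq_0_iff)
      qed
    qed
  qed
qed

text \<open>Antisymmetrize the relation for s. If t is outside \<open>C\<close>, the transposition
  passes through \<open>alt C\<close>. If t = c is in \<open>C\<close>, let d be the element of
  \<open>C\<close> in the row of s: as v is symmetric in s and d, its image under (c s) is symmetric
  in c and d, and \<open>alt C\<close> kills it. So the terms that are dropped together with
  \<open>C\<close> contribute nothing.\<close>

lemma garnir_alt:
  assumes g: "garnir row P v" and P: "P \<subseteq> {..<n}" and C: "C \<subseteq> P" "inj_on row C" "row ` P \<subseteq> row ` C"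
  shows "garnir row (P - C) (alt C v)"
proof -
  have v: "v \<in> T" and sym: "\<And>s t. s \<in> P \<Longrightarrow> t \<in> P \<Longrightarrow> row s = row t \<Longrightarrow> act (transpose s t) v = v"
    and rel: "\<And>s i. s \<in> P \<Longrightarrow> i < row s \<Longrightarrow> v + (\<Sum>t | t \<in> P \<and> row t = i. act (transpose t s) v) = 0"
    using g by (auto simp: garnir_def)
  have fin: "finite P" using P finite_subset by blast
  have Cn: "C \<subseteq> {..<n}" using C P by auto
  have comm: "act (transpose s t) (alt C v) = alt C (act (transpose s t) v)"
    if "s \<in> P - C" "t \<in> P - C" for s t
    using that P v Cn by (intro act_alt_commute) (auto intro!: transpose_n simp: transpose_def)
  have "alt C v + (\<Sum>t | t \<in> P - C \<and> row t = i. act (transpose t s) (alt C v)) = 0"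
    if s: "s \<in> P - C" and i: "i < row s" for s i
  proof -
    let ?R = "{t \<in> P. row t = i}"
    have tT: "act (transpose t s) v \<in> T" if "t \<in> P" for t
      using that s P v by (intro act_closed transpose_n) auto
    have extra: "alt C (act (transpose c s) v) = 0" if c: "c \<in> C" "c \<in> ?R" for c
    proof -
      from C(3) s obtain d where d: "d \<in> C" "row d = row s" by fastforce
      have ne: "c \<noteq> d" "c \<noteq> s" "d \<noteq> s" using c d s i by auto
      have n: "c < n" "d < n" "s < n" using c d s P C by auto
      have "transpose s d \<circ> transpose c s = transpose c s \<circ> transpose c d"
        using ne by (auto simp: fun_eq_iff transpose_def)
      then have "act (transpose c s) (act (transpose s d) v) = act (transpose c d) (act (transpose c s) v)"
        using n v by (metis act_comp transpose_n)
      moreover have "act (transpose s d) v = v" using s d C by (intro sym) auto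
      ultimately have eq: "act (transpose c d) (act (transpose c s) v) = act (transpose c s) v" by metis
      have "c \<in> P" using c by auto
      note 1 = act_transpose_alt(2)[OF tT[OF this] Cn c(1) d(1) ne(1)]
      show ?thesis by (rule fun_double_zero) (rule 1[unfolded eq])
    qed
    have "0 = alt C (v + (\<Sum>t\<in>?R. act (transpose t s) v))"
      using rel[of s i] s i Cn by (simp add: alt_zero)
    also have "\<dots> = alt C v + (\<Sum>t\<in>?R. alt C (act (transpose t s) v))"
      using v Cn tT by (subst alt_add alt_sum, auto intro!: sum_T)+
    also have "(\<Sum>t\<in>?R. alt C (act (transpose t s) v)) =
        (\<Sum>t | t \<in> P - C \<and> row t = i. alt C (act (transpose t s) v))"
      using fin extra by (intro sum.mono_neutral_right) auto
    also have "\<dots> = (\<Sum>t | t \<in> P - C \<and> row t = i. act (transpose t s) (alt C v))"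
      using s by (intro sum.cong) (auto simp: comm)
    finally show ?thesis by simp
  qed
  then show ?thesis
    unfolding garnir_def using v Cn by (auto simp: alt_T comm sym)
qed

text \<open>The columns are antisymmetrized from left to right. By \<open>left\<close>, column k
  meets every row of what remains, so \<open>garnir_alt\<close> applies and the next column again
  finds a highest weight vector. The span is recorded because w must inherit properties of v that
  survive permutations inside the columns.\<close>

lemma garnir_columns:
  fixes col :: "nat \<Rightarrow> nat"
  assumes g: "garnir row P v" and "v \<noteq> 0" and P: "P \<subseteq> {..<n}"
    and box: "inj_on (\<lambda>m. (row m, col m)) P"
    and left: "\<And>m k. m \<in> P \<Longrightarrow> k < col m \<Longrightarrow> \<exists>m'\<in>P. row m' = row m \<and> col m' = k"
  obtains w where "w \<noteq> 0"
    "w \<in> fun_vs.span {act q v | q. q permutes P \<and> (\<forall>m\<in>P. col (q m) = col m)}"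
    "\<And>s t. s \<in> P \<Longrightarrow> t \<in> P \<Longrightarrow> s \<noteq> t \<Longrightarrow> col s = col t \<Longrightarrow> col s < K \<Longrightarrow> act (transpose s t) w = - w"
proof -
  have v: "v \<in> T" using g by (simp add: garnir_def)
  let ?G = "{q. q permutes P \<and> (\<forall>m\<in>P. col (q m) = col m)}"
  let ?S = "fun_vs.span {act q v | q. q \<in> ?G}"
  have "\<exists>w. w \<noteq> 0 \<and> garnir row {m \<in> P. k \<le> col m} w \<and> w \<in> ?S \<and>
     (\<forall>s\<in>P. \<forall>t\<in>P. s \<noteq> t \<and> col s = col t \<and> col s < k \<longrightarrow> act (transpose s t) w = - w)" for k
  proof (induction k)
    case 0
    have "v \<in> ?S"
      using act_id[OF v] by (intro fun_vs.span_base) (auto intro!: exI[of _ id] permutes_id)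
    then show ?case using \<open>v \<noteq> 0\<close> g by (intro exI[of _ v]) auto
  next
    case (Suc k)
    then obtain w where w: "w \<noteq> 0" "garnir row {m \<in> P. k \<le> col m} w" "w \<in> ?S"
      "\<And>s t. s \<in> P \<Longrightarrow> t \<in> P \<Longrightarrow> s \<noteq> t \<Longrightarrow> col s = col t \<Longrightarrow> col s < k \<Longrightarrow> act (transpose s t) w = - w"
      by blast
    have wT: "w \<in> T" using w(2) by (simp add: garnir_def)
    let ?C = "{m \<in> P. col m = k}" and ?P = "{m \<in> P. k \<le> col m}"
    have inj: "inj_on row ?C" using box by (auto simp: inj_on_def)
    have Cn: "?C \<subseteq> {..<n}" and Pn: "?P \<subseteq> {..<n}" using P by auto
    have "alt ?C w \<noteq> 0"
      using inj by (intro alt_nonzero[OF w(2,1) Pn]) auto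
    moreover have "garnir row (?P - ?C) (alt ?C w)"
    proof (rule garnir_alt[OF w(2) Pn _ inj])
      show "row ` ?P \<subseteq> row ` ?C"
      proof
        fix r assume "r \<in> row ` ?P"
        then obtain m where m: "m \<in> P" "k \<le> col m" "r = row m" by auto
        then show "r \<in> row ` ?C"
          using left[of m k] by (cases "k = col m") (auto simp: image_iff)
      qed
    qed auto
    moreover have "?P - ?C = {m \<in> P. Suc k \<le> col m}" by auto
    moreover have "alt ?C w \<in> ?S"
    proof -
      have "act q x \<in> ?S" if q: "q permutes ?C" and x: "x \<in> ?S" for q x
      proof -
        have qP: "q permutes P" using q by (rule permutes_subset) auto
        have qn: "q permutes {..<n}" using qP P by (rule permutes_subset)
        have qcol: "col (q m) = col m" for m
          using permutes_in_image[OF q, of m] permutes_not_in[OF q, of m] by (cases "m \<in> ?C") auto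
        have "x \<in> T \<and> act q x \<in> ?S" using x
        proof (induction rule: fun_vs.span_induct_alt)
          case base
          then show ?case using act_zero[OF qn] zero_T by (simp add: fun_vs.span_zero)
        next
          case (step c y z)
          then obtain r where r: "r \<in> ?G" "y = act r v" by blast
          have rn: "r permutes {..<n}" using r P by (auto intro: permutes_subset)
          have "act q y = act (r \<circ> q) v" using r rn qn v by (simp add: act_comp)
          moreover have "r \<circ> q \<in> ?G"
            using r qP qcol permutes_in_image[OF qP] by (auto intro: permutes_compose)
          ultimately have "act q y \<in> ?S" by (intro fun_vs.span_base) blast
          moreover have "y \<in> T" using r rn v by (simp add: act_closed)
          ultimately show ?case
            using step.IH qn by (simp add: act_add act_scale scale_T add_T fun_vs.span_add fun_vs.span_scale)
        qed
        then show ?thesis by simp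
      qed
      then show ?thesis
        unfolding alt_def using w(3) by (intro fun_vs.span_sum fun_vs.span_scale) auto
    qed
    moreover have "act (transpose s t) (alt ?C w) = - alt ?C w"
      if st: "s \<in> P" "t \<in> P" "s \<noteq> t" "col s = col t" "col s < Suc k" for s t
    proof (cases "col s = k")
      case True
      then show ?thesis using act_transpose_alt(1)[OF wT Cn, of s t] st by auto
    next
      case False
      have "act (transpose s t) (alt ?C w) = alt ?C (act (transpose s t) w)"
        using st False P wT by (intro act_alt_commute) (auto intro!: transpose_n simp: transpose_def)
      also have "\<dots> = - alt ?C w" using w(4)[of s t] st False wT Cn by (simp add: alt_neg)
      finally show ?thesis .
    qed
    ultimately show ?case by (intro exI[of _ "alt ?C w"]) auto
  qed
  then obtain w where w: "w \<noteq> 0" "w \<in> ?S"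
    "\<forall>s\<in>P. \<forall>t\<in>P. s \<noteq> t \<and> col s = col t \<and> col s < K \<longrightarrow> act (transpose s t) w = - w"
    by meson
  show thesis
    by (rule that[of w]) (use w in \<open>simp_all\<close>)
qed

end

text \<open>Permutations preserving the colouring g are products of transpositions inside colour
  classes: composing q with the transposition of m and q m fixes m, so fewer points are
  moved.\<close>

lemma color_perm_induct [consumes 3, case_names id swap]:
  assumes "finite P" "q permutes P" "\<forall>m\<in>P. g (q m) = g m"
    and "Q id"
    and swap: "\<And>q s t. s \<in> P \<Longrightarrow> t \<in> P \<Longrightarrow> s \<noteq> t \<Longrightarrow> g s = g t \<Longrightarrow> q permutes P \<Longrightarrow>
      \<forall>m\<in>P. g (q m) = g m \<Longrightarrow> Q q \<Longrightarrow> Q (transpose s t \<circ> q)"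
  shows "Q q"
  using assms(2,3)
proof (induction "card {m \<in> P. q m \<noteq> m}" arbitrary: q rule: less_induct)
  case less
  show ?case
  proof (cases "\<forall>m\<in>P. q m = m")
    case True
    then have "q = id" using less.prems(1) by (auto simp: fun_eq_iff permutes_def)
    then show ?thesis using \<open>Q id\<close> by simp
  next
    case False
    then obtain m where m: "m \<in> P" "q m \<noteq> m" by blast
    have qm: "q m \<in> P" using m less.prems(1) by (simp add: permutes_in_image)
    let ?r = "transpose m (q m) \<circ> q"
    have r: "?r permutes P" using m qm less.prems(1) by (intro permutes_compose permutes_swap_id)
    have "g (?r x) = g x" if "x \<in> P" for x
      using bspec[OF less.prems(2) that] bspec[OF less.prems(2) m(1)] by (auto simp: transpose_def)
    then have rg: "\<forall>x\<in>P. g (?r x) = g x" by blast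
    have "?r x = x" if "x \<in> P" "q x = x" for x
      using that m less.prems(1) by (auto simp: transpose_def dest: permutes_inj[THEN injD])
    then have "{x \<in> P. ?r x \<noteq> x} \<subseteq> {x \<in> P. q x \<noteq> x}" by auto
    moreover have "m \<notin> {x \<in> P. ?r x \<noteq> x}" "m \<in> {x \<in> P. q x \<noteq> x}" using m by auto
    ultimately have "{x \<in> P. ?r x \<noteq> x} \<subset> {x \<in> P. q x \<noteq> x}" by blast
    then have "card {x \<in> P. ?r x \<noteq> x} < card {x \<in> P. q x \<noteq> x}"
      using \<open>finite P\<close> by (intro psubset_card_mono) auto
    then have "Q ?r" using less.hyps[OF _ r rg] by blast
    have "Q (transpose m (q m) \<circ> ?r)"
      using r rg \<open>Q ?r\<close> by (rule swap[OF m(1) qm m(2)[symmetric] bspec[OF less.prems(2) m(1), symmetric]])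
    moreover have "transpose m (q m) \<circ> ?r = q" by (simp add: o_assoc)
    ultimately show ?thesis by simp
  qed
qed

section \<open>Young symmetrizers\<close>

lemma partition_bounded:
  assumes "\<nu> \<in> partitions"
  obtains L where "\<And>r. L \<le> r \<Longrightarrow> \<nu> r = 0"
proof -
  have "finite {i. \<nu> i \<noteq> 0}" using assms by (simp add: partitions_def)
  then obtain L where "\<forall>i\<in>{i. \<nu> i \<noteq> 0}. i < L" using finite_nat_set_iff_bounded by blast
  then show thesis using that[of L] by (metis (mono_tags) leD mem_Collect_eq)
qed

lemma psize_eq_sum:
  assumes "\<And>r. L \<le> r \<Longrightarrow> \<nu> r = 0"
  shows "psize \<nu> = (\<Sum>r<L. \<nu> r)"
proof -
  have "{i. \<nu> i \<noteq> 0} \<subseteq> {..<L}" using assms by (metis (mono_tags) lessThan_iff linorder_not_less mem_Collect_eq subsetI)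
  then show ?thesis unfolding psize_def by (intro sum.mono_neutral_left) auto
qed

lemma row_ofI:
  assumes "c < \<nu> r"
  shows "row_of \<nu> ((\<Sum>i<r. \<nu> i) + c) = r" "col_of \<nu> ((\<Sum>i<r. \<nu> i) + c) = c"
proof -
  show "row_of \<nu> ((\<Sum>i<r. \<nu> i) + c) = r"
    unfolding row_of_def
  proof (rule Least_equality)
    show "(\<Sum>i<r. \<nu> i) + c < (\<Sum>i\<le>r. \<nu> i)"
      using assms by (simp add: lessThan_Suc_atMost[symmetric])
    fix y assume y: "(\<Sum>i<r. \<nu> i) + c < (\<Sum>i\<le>y. \<nu> i)"
    show "r \<le> y"
    proof (rule ccontr)
      assume "\<not> r \<le> y"
      then have "(\<Sum>i\<le>y. \<nu> i) \<le> (\<Sum>i<r. \<nu> i)" by (intro sum_mono2) auto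
      then show False using y by simp
    qed
  qed
  then show "col_of \<nu> ((\<Sum>i<r. \<nu> i) + c) = c" by (simp add: col_of_def)
qed

lemma box_exists:
  assumes "\<nu> \<in> partitions" "c < \<nu> r"
  shows "\<exists>m<psize \<nu>. row_of \<nu> m = r \<and> col_of \<nu> m = c"
proof -
  obtain L where L: "\<And>r. L \<le> r \<Longrightarrow> \<nu> r = 0" using partition_bounded[OF assms(1)] by blast
  have "r < L" using assms(2) L by (metis less_nat_zero_code linorder_not_less)
  then have "(\<Sum>i<Suc r. \<nu> i) \<le> (\<Sum>i<L. \<nu> i)" by (intro sum_mono2) auto
  then have "(\<Sum>i<r. \<nu> i) + c < psize \<nu>" using assms(2) psize_eq_sum[OF L] by simp
  then show ?thesis using row_ofI[of c \<nu> r, OF assms(2)] by blast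
qed

lemma box_position:
  assumes "\<nu> \<in> partitions" "m < psize \<nu>"
  shows "m = (\<Sum>i<row_of \<nu> m. \<nu> i) + col_of \<nu> m" "col_of \<nu> m < \<nu> (row_of \<nu> m)"
proof -
  obtain L where L: "\<And>r. L \<le> r \<Longrightarrow> \<nu> r = 0" using partition_bounded[OF assms(1)] by blast
  have "(\<Sum>i<L. \<nu> i) \<le> (\<Sum>i\<le>L. \<nu> i)" by (intro sum_mono2) auto
  then have ex: "m < (\<Sum>i\<le>L. \<nu> i)" using assms(2) psize_eq_sum[OF L] by simp
  have up: "m < (\<Sum>i\<le>row_of \<nu> m. \<nu> i)" unfolding row_of_def using ex by (rule LeastI)
  have low: "(\<Sum>i<row_of \<nu> m. \<nu> i) \<le> m"
  proof (cases "row_of \<nu> m")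
    case (Suc r)
    then have "\<not> m < (\<Sum>i\<le>r. \<nu> i)" using not_less_Least[of r "\<lambda>i. m < (\<Sum>r\<le>i. \<nu> r)"] unfolding row_of_def by simp
    then show ?thesis using Suc by (simp add: lessThan_Suc_atMost)
  qed simp
  show "m = (\<Sum>i<row_of \<nu> m. \<nu> i) + col_of \<nu> m" using low by (simp add: col_of_def)
  then show "col_of \<nu> m < \<nu> (row_of \<nu> m)"
    using up by (simp add: lessThan_Suc_atMost[symmetric])
qed

lemma box_inj: "\<nu> \<in> partitions \<Longrightarrow> inj_on (\<lambda>m. (row_of \<nu> m, col_of \<nu> m)) {..<psize \<nu>}"
  by (rule inj_onI) (metis Pair_inject box_position(1) lessThan_iff)

lemma box_image:
  "\<nu> \<in> partitions \<Longrightarrow> (\<lambda>m. (row_of \<nu> m, col_of \<nu> m)) ` {..<psize \<nu>} = {(r, c). c < \<nu> r}"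
  using box_exists[of \<nu>] box_position[of \<nu>] by (fastforce simp: image_iff)

lemma card_row_part:
  assumes "\<nu> \<in> partitions"
  shows "card {m \<in> {..<psize \<nu>}. row_of \<nu> m = r \<and> col_of \<nu> m < k} = min k (\<nu> r)"
proof -
  let ?A = "{m \<in> {..<psize \<nu>}. row_of \<nu> m = r \<and> col_of \<nu> m < k}"
  have "inj_on (col_of \<nu>) ?A"
    using box_inj[OF assms] by (auto simp: inj_on_def)
  moreover have "col_of \<nu> ` ?A = {..<min k (\<nu> r)}"
    using box_exists[OF assms] box_position[OF assms] by (fastforce simp: image_iff)
  ultimately have "card ?A = card {..<min k (\<nu> r)}" by (metis card_image)
  then show ?thesis by simp
qed

lemma card_row:
  assumes "\<nu> \<in> partitions"
  shows "card {m \<in> {..<psize \<nu>}. row_of \<nu> m = r} = \<nu> r"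
proof -
  have "{m \<in> {..<psize \<nu>}. row_of \<nu> m = r} =
      {m \<in> {..<psize \<nu>}. row_of \<nu> m = r \<and> col_of \<nu> m < \<nu> r}"
  proof -
    have "col_of \<nu> m < \<nu> r" if "m < psize \<nu>" "row_of \<nu> m = r" for m
      using box_position(2)[OF assms that(1)] that(2) by simp
    then show ?thesis by blast
  qed
  then show ?thesis using card_row_part[OF assms, of r "\<nu> r"] by simp
qed

lemma stabilizer_permutes:
  "p \<in> row_stabilizer \<nu> \<Longrightarrow> p permutes {..<psize \<nu>}"
  "q \<in> col_stabilizer \<nu> \<Longrightarrow> q permutes {..<psize \<nu>}"
  by (auto simp: row_stabilizer_def col_stabilizer_def)

lemma finite_stabilizer: "finite (row_stabilizer \<nu>)" "finite (col_stabilizer \<nu>)"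
  by (rule finite_subset[of _ "{p. p permutes {..<psize \<nu>}}"];
      auto simp: row_stabilizer_def col_stabilizer_def finite_permutations)+

lemma stabilizer_id: "id \<in> row_stabilizer \<nu>" "id \<in> col_stabilizer \<nu>"
  by (auto simp: row_stabilizer_def col_stabilizer_def permutes_id)

lemma stabilizer_comp:
  "p \<in> row_stabilizer \<nu> \<Longrightarrow> p' \<in> row_stabilizer \<nu> \<Longrightarrow> p \<circ> p' \<in> row_stabilizer \<nu>"
  "q \<in> col_stabilizer \<nu> \<Longrightarrow> q' \<in> col_stabilizer \<nu> \<Longrightarrow> q \<circ> q' \<in> col_stabilizer \<nu>"
proof -
  have *: "f (p (p' m)) = f m" if "p' permutes {..<N}" "\<forall>m<N. f (p m) = f m" "\<forall>m<N. f (p' m) = f m" "m < N"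
    for p p' and f :: "nat \<Rightarrow> nat" and N m
    using that by (metis lessThan_iff permutes_in_image)
  show "p \<in> row_stabilizer \<nu> \<Longrightarrow> p' \<in> row_stabilizer \<nu> \<Longrightarrow> p \<circ> p' \<in> row_stabilizer \<nu>"
    "q \<in> col_stabilizer \<nu> \<Longrightarrow> q' \<in> col_stabilizer \<nu> \<Longrightarrow> q \<circ> q' \<in> col_stabilizer \<nu>"
    using * by (auto simp: row_stabilizer_def col_stabilizer_def intro: permutes_compose)
qed

lemma stabilizer_inv:
  "p \<in> row_stabilizer \<nu> \<Longrightarrow> inv p \<in> row_stabilizer \<nu>"
  "q \<in> col_stabilizer \<nu> \<Longrightarrow> inv q \<in> col_stabilizer \<nu>"
proof -
  have *: "f (inv p m) = f m" if "p permutes {..<N}" "\<forall>m<N. f (p m) = f m" "m < N"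
    for p and f :: "nat \<Rightarrow> nat" and N m
    using that by (metis lessThan_iff permutes_in_image permutes_inv permutes_inverses(1))
  show "p \<in> row_stabilizer \<nu> \<Longrightarrow> inv p \<in> row_stabilizer \<nu>"
    "q \<in> col_stabilizer \<nu> \<Longrightarrow> inv q \<in> col_stabilizer \<nu>"
    using * by (auto simp: row_stabilizer_def col_stabilizer_def permutes_inv)
qed

lemma stabilizer_transpose:
  "s < psize \<nu> \<Longrightarrow> t < psize \<nu> \<Longrightarrow> row_of \<nu> s = row_of \<nu> t \<Longrightarrow> transpose s t \<in> row_stabilizer \<nu>"
  "s < psize \<nu> \<Longrightarrow> t < psize \<nu> \<Longrightarrow> col_of \<nu> s = col_of \<nu> t \<Longrightarrow> transpose s t \<in> col_stabilizer \<nu>"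
  by (auto simp: row_stabilizer_def col_stabilizer_def permutes_swap_id transpose_def)

lemma stabilizer_inter:
  assumes "\<nu> \<in> partitions" "p \<in> row_stabilizer \<nu>" "p \<in> col_stabilizer \<nu>"
  shows "p = id"
proof
  fix m
  have p: "p permutes {..<psize \<nu>}" using assms(2) by (rule stabilizer_permutes)
  show "p m = id m"
  proof (cases "m < psize \<nu>")
    case True
    then have "p m < psize \<nu>" using p by (metis lessThan_iff permutes_in_image)
    moreover have "row_of \<nu> (p m) = row_of \<nu> m" "col_of \<nu> (p m) = col_of \<nu> m"
      using True assms by (auto simp: row_stabilizer_def col_stabilizer_def)
    ultimately show ?thesis using True box_inj[OF assms(1)] by (auto simp: inj_on_def)
  next
    case False
    then show ?thesis using p by (simp add: permutes_not_in)
  qed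
qed

text \<open>Counting the entries that \<open>\<sigma>\<close> moves out of the first \<open>k\<close> columns shows that
  each row is mapped onto a transversal of the same columns.\<close>

lemma permutation_factorization:
  assumes \<nu>: "\<nu> \<in> partitions" and \<sigma>: "\<sigma> permutes {..<psize \<nu>}"
    and sep: "\<And>s t. s < psize \<nu> \<Longrightarrow> t < psize \<nu> \<Longrightarrow> s \<noteq> t \<Longrightarrow> row_of \<nu> s = row_of \<nu> t \<Longrightarrow>
      col_of \<nu> (inv \<sigma> s) \<noteq> col_of \<nu> (inv \<sigma> t)"
  obtains p q where "p \<in> row_stabilizer \<nu>" "q \<in> col_stabilizer \<nu>" "\<sigma> = p \<circ> q"
proof -
  let ?N = "{..<psize \<nu>}" and ?row = "row_of \<nu>" and ?col = "col_of \<nu>"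
  \<comment> \<open>This is the column of the entry m in the tableau permuted by \<sigma>; by
    \<open>sep\<close> it separates the entries of each row.\<close>
  define g where "g m = ?col (inv \<sigma> m)" for m
  have g\<sigma>: "g (\<sigma> m) = ?col m" for m using \<sigma> by (simp add: g_def permutes_inverses)
  have inj: "inj_on (\<lambda>m. (?row m, g m)) ?N"
    using sep by (force simp: inj_on_def g_def)
  have g_less: "g m < \<nu> (?row m)" if m: "m < psize \<nu>" for m
  proof -
    \<comment> \<open>Every row r has at most \<open>min k (\<nu> r)\<close> entries with g below k,
      and exactly that many with column below k. In total both kinds are equally many, so the bound
      is attained in each row. For the row of m itself, of length k, all entries then have g below
      k.\<close>
    define k where "k = \<nu> (?row m)"
    let ?A = "\<lambda>r. {x \<in> {x \<in> ?N. g x < k}. ?row x = r}"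
    let ?B = "\<lambda>r. {x \<in> {x \<in> ?N. ?col x < k}. ?row x = r}"
    have B: "card (?B r) = min k (\<nu> r)" for r
    proof -
      have "?B r = {m \<in> ?N. ?row m = r \<and> ?col m < k}" by auto
      then show ?thesis using card_row_part[OF \<nu>, of r k] by simp
    qed
    have le: "card (?A r) \<le> card (?B r)" for r
    proof -
      have "inj_on g (?A r)" using inj by (auto simp: inj_on_def)
      then have "card (?A r) \<le> card {..<k}" by (intro card_inj_on_le[of g]) auto
      moreover have "card (?A r) \<le> card {m \<in> ?N. ?row m = r}" by (intro card_mono) auto
      ultimately show ?thesis using B card_row[OF \<nu>] by simp
    qed
    have "{x \<in> ?N. g x < k} = \<sigma> ` {x \<in> ?N. ?col x < k}"
    proof (intro set_eqI iffI)
      fix x assume "x \<in> {x \<in> ?N. g x < k}"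
      then show "x \<in> \<sigma> ` {x \<in> ?N. ?col x < k}"
        using \<sigma> permutes_in_image[OF permutes_inv[OF \<sigma>], of x]
        by (intro image_eqI[of _ _ "inv \<sigma> x"]) (auto simp: g_def permutes_inverses)
    next
      fix x assume "x \<in> \<sigma> ` {x \<in> ?N. ?col x < k}"
      then obtain y where y: "x = \<sigma> y" "y \<in> ?N" "?col y < k" by blast
      then have "x \<in> ?N" using permutes_in_image[OF \<sigma>] by blast
      then show "x \<in> {x \<in> ?N. g x < k}" using g\<sigma>[of y] y by simp
    qed
    then have eq: "card {x \<in> ?N. g x < k} = card {x \<in> ?N. ?col x < k}"
      using \<sigma> by (simp add: card_image inj_on_subset[OF permutes_inj])
    have grp: "(\<Sum>r\<in>?row ` ?N. card {x \<in> S. ?row x = r}) = card S" if "S \<subseteq> ?N" for S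
      using sum.group[of S "?row ` ?N" ?row "\<lambda>_. 1::nat"] that finite_subset[OF that] by auto
    have "(\<Sum>r\<in>?row ` ?N. card (?A r)) = (\<Sum>r\<in>?row ` ?N. card (?B r))"
      using eq grp[of "{x \<in> ?N. g x < k}", OF Collect_subset]
        grp[of "{x \<in> ?N. ?col x < k}", OF Collect_subset] by (simp only:)
    then have "card (?A (?row m)) = card (?B (?row m))"
      using le m by (intro sum_mono_inv[of "\<lambda>r. card (?A r)" _ "\<lambda>r. card (?B r)"]) auto
    then have "card (?A (?row m)) = card {x \<in> ?N. ?row x = ?row m}"
      using B card_row[OF \<nu>] by (simp add: k_def)
    then have "?A (?row m) = {x \<in> ?N. ?row x = ?row m}"
      by (intro card_subset_eq) auto
    then show ?thesis using m by (auto simp: k_def)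
  qed
  have "(\<lambda>m. (?row m, g m)) ` ?N \<subseteq> (\<lambda>m. (?row m, ?col m)) ` ?N"
    using g_less box_image[OF \<nu>] by auto
  then have im: "(\<lambda>m. (?row m, g m)) ` ?N = (\<lambda>m. (?row m, ?col m)) ` ?N"
    by (rule card_subset_eq[rotated]) (auto simp: card_image[OF inj] card_image[OF box_inj[OF \<nu>]])
  \<comment> \<open>In each row g takes the same values as the column, so a permutation inside the
    rows matches the two; it is the factor p.\<close>
  have "image_mset (\<lambda>m. (?row m, ?col m)) (mset_set ?N) = image_mset (\<lambda>m. (?row m, g m)) (mset_set ?N)"
    using im by (simp add: image_mset_mset_set[OF inj] image_mset_mset_set[OF box_inj[OF \<nu>]])
  then obtain p where p: "p permutes ?N" "\<forall>m\<in>?N. (?row m, ?col m) = (?row (p m), g (p m))"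
    by (rule image_mset_eq_implies_permutes[OF finite_lessThan])
  have pR: "p \<in> row_stabilizer \<nu>" using p by (simp add: row_stabilizer_def)
  have "?col ((inv p \<circ> \<sigma>) m) = ?col m" if "m < psize \<nu>" for m
  proof -
    have "\<sigma> m \<in> ?N" using \<sigma> that by (simp add: permutes_in_image del: lessThan_iff) simp
    then have "inv p (\<sigma> m) \<in> ?N" using permutes_in_image[OF permutes_inv[OF p(1)]] by blast
    then have "?col (inv p (\<sigma> m)) = g (p (inv p (\<sigma> m)))" using p(2) by blast
    then show ?thesis using p(1) g\<sigma> by (simp add: permutes_inverses)
  qed
  then have "inv p \<circ> \<sigma> \<in> col_stabilizer \<nu>"
    using \<sigma> p(1) by (auto simp: col_stabilizer_def intro: permutes_compose permutes_inv)
  moreover have "\<sigma> = p \<circ> (inv p \<circ> \<sigma>)"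
    using p(1) by (simp add: o_assoc permutes_inv_o)
  ultimately show thesis using that pR by blast
qed

lemma permutation_psize: "p permutes {..<m::nat} \<Longrightarrow> permutation p"
  using finite_lessThan permutation_permutes by blast

section \<open>Right multiplication by elements of the group algebra\<close>

context sym_action
begin

definition mult :: "('x \<Rightarrow> 'f) \<Rightarrow> ((nat \<Rightarrow> nat) \<Rightarrow> 'f) \<Rightarrow> 'x \<Rightarrow> 'f" where
  "mult v x = (\<Sum>\<sigma> | \<sigma> permutes {..<n}. fscale (x \<sigma>) (act \<sigma> v))"

lemma mult_T: "v \<in> T \<Longrightarrow> mult v x \<in> T"
  unfolding mult_def by (intro sum_T scale_T act_closed) auto

lemma mult_submod: "submod N \<Longrightarrow> v \<in> N \<Longrightarrow> mult v x \<in> N"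
  unfolding mult_def submod_def by (auto intro!: fun_vs.subspace_sum fun_vs.subspace_scale)

lemma mult_add: "mult v (x + y) = mult v x + mult v y"
  by (simp add: mult_def plus_fun_apply fun_vs.scale_left_distrib sum.distrib)

lemma mult_scale: "mult v (fscale c x) = fscale c (mult v x)"
  by (simp add: mult_def fun_vs.scale_sum_right) (simp add: fscale_def)

lemma mult_zero: "mult v 0 = 0"
  by (simp add: mult_def zero_fun_apply)

lemma mult_sum: "mult v (sum f A) = (\<Sum>i\<in>A. mult v (f i))"
  by (induction A rule: infinite_finite_induct) (simp_all add: mult_zero mult_add)

lemma mult_add_left: "v \<in> T \<Longrightarrow> w \<in> T \<Longrightarrow> mult (v + w) x = mult v x + mult w x"
  by (simp add: mult_def act_add fun_vs.scale_right_distrib sum.distrib)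

lemma mult_zero_left: "mult 0 x = 0"
  by (simp add: mult_def act_zero)

lemma mult_right_mult:
  assumes "v \<in> T" "\<sigma> permutes {..<n}"
  shows "mult v (right_mult \<sigma> x) = act \<sigma> (mult v x)"
proof -
  have "mult v (right_mult \<sigma> x) =
      (\<Sum>\<rho> | \<rho> permutes {..<n}. fscale (x ((\<rho> \<circ> \<sigma>) \<circ> inv \<sigma>)) (act (\<rho> \<circ> \<sigma>) v))"
    unfolding mult_def right_mult_def by (rule sum_permutations_compose_right[OF assms(2)])
  also have "\<dots> = (\<Sum>\<rho> | \<rho> permutes {..<n}. fscale (x \<rho>) (act \<sigma> (act \<rho> v)))"
    using assms by (intro sum.cong) (auto simp: act_comp comp_assoc permutes_inv_o)
  also have "\<dots> = act \<sigma> (mult v x)"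
    unfolding mult_def using assms
    by (subst act_sum) (auto simp: act_scale act_closed scale_T intro!: sum.cong)
  finally show ?thesis .
qed

text \<open>Right multiplication by \<open>a \<tau> b\<close>, where \<open>a\<close> is the row sum and \<open>b\<close> the signed column sum.\<close>

definition young :: "(nat \<Rightarrow> nat) \<Rightarrow> (nat \<Rightarrow> nat) \<Rightarrow> ('x \<Rightarrow> 'f) \<Rightarrow> 'x \<Rightarrow> 'f" where
  "young \<nu> \<tau> v = (\<Sum>p\<in>row_stabilizer \<nu>. \<Sum>q\<in>col_stabilizer \<nu>.
      fscale (of_int (sign q)) (act (p \<circ> \<tau> \<circ> q) v))"

lemma mult_young_symmetrizer:
  assumes "v \<in> T" "psize \<nu> = n"
  shows "mult v (young_symmetrizer \<nu>) = young \<nu> id v"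
proof -
  have "mult v (young_symmetrizer \<nu>) = (\<Sum>\<rho> | \<rho> permutes {..<n}. \<Sum>p\<in>row_stabilizer \<nu>. \<Sum>q\<in>col_stabilizer \<nu>.
      if \<rho> = p \<circ> q then fscale (of_int (sign q)) (act \<rho> v) else 0)"
    unfolding mult_def young_symmetrizer_def fun_vs.scale_sum_left
    by (intro sum.cong refl) (auto simp: eq_commute)
  also have "\<dots> = (\<Sum>p\<in>row_stabilizer \<nu>. \<Sum>q\<in>col_stabilizer \<nu>. \<Sum>\<rho> | \<rho> permutes {..<n}.
      if \<rho> = p \<circ> q then fscale (of_int (sign q)) (act \<rho> v) else 0)"
    by (rule trans[OF sum.swap]) (intro sum.cong refl sum.swap)
  also have "\<dots> = young \<nu> id v"
    unfolding young_def
  proof (intro sum.cong refl)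
    fix p q assume "p \<in> row_stabilizer \<nu>" "q \<in> col_stabilizer \<nu>"
    then have "p \<circ> q permutes {..<n}"
      using stabilizer_permutes assms(2) by (metis permutes_compose)
    then show "(\<Sum>\<rho> | \<rho> permutes {..<n}. if \<rho> = p \<circ> q then fscale (of_int (sign q)) (act \<rho> v) else 0) =
        fscale (of_int (sign q)) (act (p \<circ> id \<circ> q) v)"
      by (simp add: sum.delta finite_permutations)
  qed
  finally show ?thesis .
qed

lemma young_row: assumes "p \<in> row_stabilizer \<nu>" shows "young \<nu> (p \<circ> \<tau>) v = young \<nu> \<tau> v"
proof -
  have p: "p permutes {..<psize \<nu>}" using assms by (rule stabilizer_permutes)
  show ?thesis unfolding young_def
    by (rule sum.reindex_bij_witness[of _ "\<lambda>r. r \<circ> inv p" "\<lambda>r. r \<circ> p"])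
      (use p assms in \<open>auto simp: comp_assoc permutes_inv_o stabilizer_comp stabilizer_inv\<close>)
qed

lemma young_col: assumes "q \<in> col_stabilizer \<nu>"
  shows "young \<nu> (\<tau> \<circ> q) v = fscale (of_int (sign q)) (young \<nu> \<tau> v)"
proof -
  have q: "q permutes {..<psize \<nu>}" using assms by (rule stabilizer_permutes)
  have sg: "of_int (sign q) * of_int (sign (q \<circ> r)) = (of_int (sign r) :: 'f)" if "r \<in> col_stabilizer \<nu>" for r
  proof -
    have "sign (q \<circ> r) = sign q * sign r"
      using that q by (intro sign_compose) (auto intro: permutation_psize stabilizer_permutes)
    then show ?thesis by (simp only: of_int_mult[symmetric] sign_left_idempotent)
  qed
  have "(\<Sum>r\<in>col_stabilizer \<nu>. fscale (of_int (sign r)) (act (p \<circ> (\<tau> \<circ> q) \<circ> r) v)) =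
      (\<Sum>r\<in>col_stabilizer \<nu>. fscale (of_int (sign q)) (fscale (of_int (sign r)) (act (p \<circ> \<tau> \<circ> r) v)))" for p
  proof (rule sum.reindex_bij_witness[of _ "\<lambda>r. inv q \<circ> r" "\<lambda>r. q \<circ> r"])
    fix r assume r: "r \<in> col_stabilizer \<nu>"
    show "inv q \<circ> (q \<circ> r) = r" "q \<circ> (inv q \<circ> r) = r"
      using q by (simp_all only: o_assoc permutes_inv_o id_o)
    show "q \<circ> r \<in> col_stabilizer \<nu>" "inv q \<circ> r \<in> col_stabilizer \<nu>"
      using r assms by (simp_all add: stabilizer_comp stabilizer_inv)
    show "fscale (of_int (sign q)) (fscale (of_int (sign (q \<circ> r))) (act (p \<circ> \<tau> \<circ> (q \<circ> r)) v)) =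
        fscale (of_int (sign r)) (act (p \<circ> (\<tau> \<circ> q) \<circ> r) v)"
      by (simp only: fun_vs.scale_scale sg[OF r] o_assoc)
  qed
  then show ?thesis by (simp add: young_def fun_vs.scale_sum_right)
qed

lemma young_transpose_row:
  "s < psize \<nu> \<Longrightarrow> t < psize \<nu> \<Longrightarrow> row_of \<nu> s = row_of \<nu> t \<Longrightarrow>
    young \<nu> (transpose s t \<circ> \<tau>) v = young \<nu> \<tau> v"
  by (intro young_row stabilizer_transpose)

lemma young_transpose_col:
  assumes "s < psize \<nu>" "t < psize \<nu>" "s \<noteq> t" "col_of \<nu> s = col_of \<nu> t"
  shows "young \<nu> (\<tau> \<circ> transpose s t) v = - young \<nu> \<tau> v"
  using young_col[OF stabilizer_transpose(2)[OF assms(1,2,4)], of \<tau> v] assms(3)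
  by (simp add: sign_swap_id)

text \<open>Either \<tau> carries a column transposition to a row transposition (s t), and then a
  \<tau> b equals its own negative; or \<tau> factors as p q, and a \<tau> b is a b up to the sign
  of q. One scalar serves all v, which the choice of \<open>c\<close> in
  \<open>young_mult_young\<close> relies on.\<close>

lemma young_scalar:
  assumes \<nu>: "\<nu> \<in> partitions" and \<tau>: "\<tau> permutes {..<psize \<nu>}"
  shows "\<exists>c. \<forall>v. young \<nu> \<tau> v = fscale c (young \<nu> id v)"
proof (cases "\<exists>s t. s < psize \<nu> \<and> t < psize \<nu> \<and> s \<noteq> t \<and> row_of \<nu> s = row_of \<nu> t \<and>
    col_of \<nu> (inv \<tau> s) = col_of \<nu> (inv \<tau> t)")
  case True
  then obtain s t where st: "s < psize \<nu>" "t < psize \<nu>" "s \<noteq> t" "row_of \<nu> s = row_of \<nu> t"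
    "col_of \<nu> (inv \<tau> s) = col_of \<nu> (inv \<tau> t)" by blast
  have "young \<nu> \<tau> v = 0" for v
  proof (rule fun_double_zero)
    have i: "inv \<tau> permutes {..<psize \<nu>}" using \<tau> by (rule permutes_inv)
    have "transpose s t \<circ> \<tau> = \<tau> \<circ> transpose (inv \<tau> s) (inv \<tau> t)"
      using \<tau> by (intro transpose_comp_eq permutes_bij)
    then have "young \<nu> \<tau> v = young \<nu> (\<tau> \<circ> transpose (inv \<tau> s) (inv \<tau> t)) v"
      using young_transpose_row[OF st(1,2,4), of \<tau> v] by simp
    also have "\<dots> = - young \<nu> \<tau> v"
      using st i permutes_in_image[OF i, of s] permutes_in_image[OF i, of t]
        permutes_inj[OF i, THEN injD, of s t]
      by (intro young_transpose_col) auto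
    finally show "young \<nu> \<tau> v = - young \<nu> \<tau> v" .
  qed
  then show ?thesis by (intro exI[of _ 0]) simp
next
  case False
  then obtain p q where pq: "p \<in> row_stabilizer \<nu>" "q \<in> col_stabilizer \<nu>" "\<tau> = p \<circ> q"
    using permutation_factorization[OF \<nu> \<tau>] by metis
  have "young \<nu> \<tau> v = fscale (of_int (sign q)) (young \<nu> id v)" for v
    using young_row[OF pq(1), of q v] young_col[OF pq(2), of id v] pq(3) by simp
  then show ?thesis by blast
qed

text \<open>In v (a b) z (a b) the middle part b z a is a combination of permutations q \<sigma> p,
  and each a (q \<sigma> p) b is a multiple of a b by \<open>young_scalar\<close>. The exchanges of
  sums only move the first row sum and the last column sum inside.\<close>

lemma young_mult_young:
  assumes \<nu>: "\<nu> \<in> partitions" "psize \<nu> = n"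
  shows "\<exists>c. \<forall>v\<in>T. young \<nu> id (mult (young \<nu> id v) z) = fscale c (young \<nu> id v)"
proof -
  let ?R = "row_stabilizer \<nu>" and ?C = "col_stabilizer \<nu>" and ?S = "{\<sigma>. \<sigma> permutes {..<n}}"
  have perm: "p permutes {..<n}" "q permutes {..<n}" if "p \<in> ?R" "q \<in> ?C" for p q
    using that stabilizer_permutes \<nu>(2) by metis+
  obtain c where c: "\<And>\<tau> v. \<tau> permutes {..<n} \<Longrightarrow> young \<nu> \<tau> v = fscale (c \<tau>) (young \<nu> id v)"
    using young_scalar[OF \<nu>(1)] \<nu>(2) by metis
  define C where "C = (\<Sum>\<sigma>\<in>?S. \<Sum>p\<in>?R. \<Sum>q\<in>?C. z \<sigma> * (of_int (sign q) * c (q \<circ> \<sigma> \<circ> p)))"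
  have "young \<nu> id (mult (young \<nu> id v) z) = fscale C (young \<nu> id v)" if v: "v \<in> T" for v
  proof -
    have yT: "young \<nu> id v \<in> T"
      unfolding young_def using v perm by (auto intro!: sum_T scale_T act_closed permutes_compose)
    have 1: "act \<pi> (young \<nu> id v) = (\<Sum>p\<in>?R. \<Sum>q\<in>?C. fscale (of_int (sign q)) (act (p \<circ> q \<circ> \<pi>) v))"
      if "\<pi> permutes {..<n}" for \<pi>
    proof -
      have "act \<pi> (act (p \<circ> q) v) = act (p \<circ> q \<circ> \<pi>) v" if "p \<in> ?R" "q \<in> ?C" for p q
        using that v perm \<open>\<pi> permutes {..<n}\<close> by (intro act_comp[symmetric] permutes_compose) auto
      moreover have "act (p \<circ> q) v \<in> T" if "p \<in> ?R" "q \<in> ?C" for p q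
        using that v perm by (intro act_closed permutes_compose) auto
      ultimately show ?thesis
        unfolding young_def using that \<open>\<pi> permutes {..<n}\<close>
        by (subst act_sum sum_T act_sum, auto simp: act_scale intro!: sum.cong sum_T scale_T)+
    qed
    have "young \<nu> id (mult (young \<nu> id v) z) =
        (\<Sum>p'\<in>?R. \<Sum>q'\<in>?C. \<Sum>\<sigma>\<in>?S. \<Sum>p\<in>?R. \<Sum>q\<in>?C.
          fscale (of_int (sign q') * (z \<sigma> * of_int (sign q))) (act (p \<circ> (q \<circ> \<sigma> \<circ> p') \<circ> q') v))"
      unfolding young_def[of \<nu> id "mult _ _"]
    proof (intro sum.cong refl)
      fix p' q' assume pq': "p' \<in> ?R" "q' \<in> ?C"
      have pp: "p' \<circ> q' permutes {..<n}" using perm pq' by (intro permutes_compose) auto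
      have "act (p' \<circ> q') (mult (young \<nu> id v) z) =
          (\<Sum>\<sigma>\<in>?S. fscale (z \<sigma>) (act (\<sigma> \<circ> (p' \<circ> q')) (young \<nu> id v)))"
        unfolding mult_def using pp yT
        by (subst act_sum) (auto simp: act_scale act_closed scale_T act_comp intro!: sum.cong)
      also have "\<dots> = (\<Sum>\<sigma>\<in>?S. \<Sum>p\<in>?R. \<Sum>q\<in>?C.
          fscale (z \<sigma> * of_int (sign q)) (act (p \<circ> (q \<circ> \<sigma> \<circ> p') \<circ> q') v))"
        using pp by (intro sum.cong refl, subst 1)
          (auto intro: permutes_compose simp: fun_vs.scale_sum_right comp_assoc)
      finally show "fscale (of_int (sign q')) (act (p' \<circ> id \<circ> q') (mult (young \<nu> id v) z)) =
          (\<Sum>\<sigma>\<in>?S. \<Sum>p\<in>?R. \<Sum>q\<in>?C.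
          fscale (of_int (sign q') * (z \<sigma> * of_int (sign q))) (act (p \<circ> (q \<circ> \<sigma> \<circ> p') \<circ> q') v))"
        by (simp add: fun_vs.scale_sum_right)
    qed
    also have "\<dots> = (\<Sum>p'\<in>?R. \<Sum>\<sigma>\<in>?S. \<Sum>q'\<in>?C. \<Sum>p\<in>?R. \<Sum>q\<in>?C.
          fscale (of_int (sign q') * (z \<sigma> * of_int (sign q))) (act (p \<circ> (q \<circ> \<sigma> \<circ> p') \<circ> q') v))"
      by (intro sum.cong refl sum.swap)
    also have "\<dots> = (\<Sum>\<sigma>\<in>?S. \<Sum>p'\<in>?R. \<Sum>q\<in>?C. \<Sum>p\<in>?R. \<Sum>q'\<in>?C.
          fscale (of_int (sign q') * (z \<sigma> * of_int (sign q))) (act (p \<circ> (q \<circ> \<sigma> \<circ> p') \<circ> q') v))"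
    proof (subst sum.swap, rule sum.cong[OF refl], rule sum.cong[OF refl])
      fix \<sigma> p'
      let ?f = "\<lambda>q' p q. fscale (of_int (sign q') * (z \<sigma> * of_int (sign q))) (act (p \<circ> (q \<circ> \<sigma> \<circ> p') \<circ> q') v)"
      have "(\<Sum>q'\<in>?C. \<Sum>p\<in>?R. \<Sum>q\<in>?C. ?f q' p q) = (\<Sum>q'\<in>?C. \<Sum>q\<in>?C. \<Sum>p\<in>?R. ?f q' p q)"
        by (intro sum.cong refl sum.swap)
      also have "\<dots> = (\<Sum>q\<in>?C. \<Sum>q'\<in>?C. \<Sum>p\<in>?R. ?f q' p q)" by (rule sum.swap)
      also have "\<dots> = (\<Sum>q\<in>?C. \<Sum>p\<in>?R. \<Sum>q'\<in>?C. ?f q' p q)"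
        by (intro sum.cong refl sum.swap)
      finally show "(\<Sum>q'\<in>?C. \<Sum>p\<in>?R. \<Sum>q\<in>?C. ?f q' p q) = (\<Sum>q\<in>?C. \<Sum>p\<in>?R. \<Sum>q'\<in>?C. ?f q' p q)" .
    qed
    also have "\<dots> = (\<Sum>\<sigma>\<in>?S. \<Sum>p'\<in>?R. \<Sum>q\<in>?C. fscale (z \<sigma> * of_int (sign q)) (young \<nu> (q \<circ> \<sigma> \<circ> p') v))"
      by (simp add: young_def fun_vs.scale_sum_right ac_simps)
    also have "\<dots> = (\<Sum>\<sigma>\<in>?S. \<Sum>p'\<in>?R. \<Sum>q\<in>?C. fscale (z \<sigma> * (of_int (sign q) * c (q \<circ> \<sigma> \<circ> p'))) (young \<nu> id v))"
    proof (intro sum.cong refl)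
      fix \<sigma> p q assume "\<sigma> \<in> ?S" "p \<in> ?R" "q \<in> ?C"
      then have "q \<circ> \<sigma> \<circ> p permutes {..<n}" using perm by (auto intro!: permutes_compose)
      then show "fscale (z \<sigma> * of_int (sign q)) (young \<nu> (q \<circ> \<sigma> \<circ> p) v) =
          fscale (z \<sigma> * (of_int (sign q) * c (q \<circ> \<sigma> \<circ> p))) (young \<nu> id v)"
        by (subst c) (auto simp: mult.assoc)
    qed
    also have "\<dots> = fscale C (young \<nu> id v)"
      by (simp only: C_def fun_vs.scale_sum_left)
    finally show ?thesis .
  qed
  then show ?thesis by blast
qed

section \<open>Existence of highest weight vectors\<close>

text \<open>A renumbering of the positions, which will carry a colouring of least sum to
  \<open>row_of\<close>.\<close>

lemma garnir_conj:
  assumes g: "garnir row {..<n} v" and p: "p permutes {..<n}"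
  shows "garnir (row \<circ> p) {..<n} (act p v)"
proof -
  have v: "v \<in> T" and sym: "\<And>s t. s < n \<Longrightarrow> t < n \<Longrightarrow> row s = row t \<Longrightarrow> act (transpose s t) v = v"
    and rel: "\<And>s i. s < n \<Longrightarrow> i < row s \<Longrightarrow> v + (\<Sum>t | t \<in> {..<n} \<and> row t = i. act (transpose t s) v) = 0"
    using g by (auto simp: garnir_def)
  have pn: "p m < n" if "m < n" for m using p that by (metis lessThan_iff permutes_in_image)
  have conj: "act (transpose s t) (act p v) = act p (act (transpose (p s) (p t)) v)"
    if "s < n" "t < n" for s t
  proof -
    have "p \<circ> transpose s t = transpose (p s) (p t) \<circ> p"
      using p by (simp add: transpose_comp_eq permutes_bij permutes_inverses)
    then show ?thesis using that p v pn by (metis act_comp transpose_n)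
  qed
  have "act p v + (\<Sum>t | t \<in> {..<n} \<and> (row \<circ> p) t = i. act (transpose t s) (act p v)) = 0"
    if s: "s < n" "i < (row \<circ> p) s" for s i
  proof -
    have "(\<Sum>t | t \<in> {..<n} \<and> (row \<circ> p) t = i. act (transpose t s) (act p v)) =
        (\<Sum>t | t \<in> {..<n} \<and> row t = i. act p (act (transpose t (p s)) v))"
    proof (rule sum.reindex_bij_witness[of _ "inv p" p])
      fix t assume t: "t \<in> {t. t \<in> {..<n} \<and> (row \<circ> p) t = i}"
      show "inv p (p t) = t" using p by (simp add: permutes_inverses)
      show "p t \<in> {t. t \<in> {..<n} \<and> row t = i}" using t pn by simp
      show "act p (act (transpose (p t) (p s)) v) = act (transpose t s) (act p v)"
        using t s conj by simp
    next
      fix t assume t: "t \<in> {t. t \<in> {..<n} \<and> row t = i}"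
      show "p (inv p t) = t" using p by (simp add: permutes_inverses)
      then show "inv p t \<in> {t. t \<in> {..<n} \<and> (row \<circ> p) t = i}"
        using t permutes_in_image[OF permutes_inv[OF p], of t] by simp
    qed
    then have "act p v + (\<Sum>t | t \<in> {..<n} \<and> (row \<circ> p) t = i. act (transpose t s) (act p v)) =
        act p v + (\<Sum>t | t \<in> {..<n} \<and> row t = i. act p (act (transpose t (p s)) v))" by (rule arg_cong)
    also have "\<dots> = act p (v + (\<Sum>t | t \<in> {..<n} \<and> row t = i. act (transpose t (p s)) v))"
      using p v s pn
      by (subst act_add act_sum, auto intro!: sum_T act_closed transpose_n)+
    also have "\<dots> = act p 0"
      using s pn by (intro arg_cong[of _ _ "act p"] rel) auto
    finally show ?thesis using act_zero[OF p] by (rule trans)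
  qed
  moreover have "act (transpose s t) (act p v) = act p v"
    if "s < n" "t < n" "(row \<circ> p) s = (row \<circ> p) t" for s t
    using that conj sym pn by simp
  ultimately show ?thesis
    unfolding garnir_def using v p by (auto intro: act_closed)
qed

text \<open>Moving an entry into an earlier row lowers the sum of the colours, so a nonzero vector that is
  symmetric for a colouring of least sum satisfies the relations; and since exchanging two colours
  does not lower the sum, the colour classes of such a colouring form a partition.\<close>

definition symmetric_colouring :: "('x \<Rightarrow> 'f) set \<Rightarrow> (nat \<Rightarrow> nat) \<Rightarrow> bool" where
  "symmetric_colouring M g \<longleftrightarrow>
     (\<exists>v\<in>M. v \<noteq> 0 \<and> (\<forall>s<n. \<forall>t<n. g s = g t \<longrightarrow> act (transpose s t) v = v))"

lemma garnir_if_minimal: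
  assumes M: "submod M" and v: "v \<in> M"
    and sym: "\<And>s t. s < n \<Longrightarrow> t < n \<Longrightarrow> g s = g t \<Longrightarrow> act (transpose s t) v = v"
    and min: "\<And>h. symmetric_colouring M h \<Longrightarrow> (\<Sum>m<n. g m) \<le> (\<Sum>m<n. h m)"
  shows "garnir g {..<n} v"
proof -
  have vT: "v \<in> T" and MT: "\<And>x. x \<in> M \<Longrightarrow> x \<in> T" using M v by (auto simp: submod_def)
  have "v + (\<Sum>t | t \<in> {..<n} \<and> g t = i. act (transpose t s) v) = 0"
    if s: "s < n" and i: "i < g s" for s i
  proof (rule ccontr)
    let ?R = "{t. t \<in> {..<n} \<and> g t = i}"
    \<comment> \<open>The term t = s is v itself, so u is the left side of the relation. It is
      symmetric for the colouring h, in which s has moved to class i; if nonzero, it contradicts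
      minimality.\<close>
    define u where "u = (\<Sum>t\<in>insert s ?R. act (transpose t s) v)"
    assume "v + (\<Sum>t\<in>?R. act (transpose t s) v) \<noteq> 0"
    moreover have "u = v + (\<Sum>t\<in>?R. act (transpose t s) v)"
      unfolding u_def using i vT act_id[OF vT] by (subst sum.insert) (auto simp: id_def)
    ultimately have u0: "u \<noteq> 0" by simp
    have uM: "u \<in> M"
      unfolding u_def using M v s
      by (auto simp: submod_def intro!: fun_vs.subspace_sum transpose_n)
    define h where "h = g(s := i)"
    have "act (transpose x y) u = u" if xy: "x < n" "y < n" "h x = h y" for x y
    proof (cases "x = y")
      case True
      then show ?thesis using act_id MT uM by (simp add: id_def)
    next
      case False
      let ?f = "transpose x y"
      have R: "?f t \<in> insert s ?R" if "t \<in> insert s ?R" for t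
        using that xy s False unfolding h_def transpose_def by (auto split: if_splits)
      have step: "act ?f (act (transpose t s) v) = act (transpose (?f t) s) v" if t: "t \<in> insert s ?R" for t
      proof -
        have tn: "t < n" "?f t < n" using t s R[OF t] by auto
        \<comment> \<open>In each case (x y) maps a summand of u to a summand. In (a), v is
          symmetric in x and y. In (b) and (c), the product of the two transpositions is again some
          (t' s) or the identity. In (d), t and the partner of s both have colour i, and v is
          symmetric in them.\<close>
        consider (a) "x \<noteq> s" "y \<noteq> s" | (b) "x = s" "t = s \<or> t = y" | (c) "y = s" "t = s \<or> t = x"
          | (d) "x = s \<or> y = s" "t \<noteq> x" "t \<noteq> y"
          by blast
        then show ?thesis
        proof cases
          case a
          have "transpose t s \<circ> ?f = ?f \<circ> transpose (?f t) s"
            using a by (auto simp: fun_eq_iff transpose_def)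
          then have "act ?f (act (transpose t s) v) = act (transpose (?f t) s) (act ?f v)"
            using vT tn s xy by (metis act_comp transpose_n)
          moreover have "act ?f v = v" using a xy by (intro sym) (auto simp: h_def)
          ultimately show ?thesis by simp
        next
          case b
          have "transpose t s \<circ> ?f = transpose (?f t) s"
            using b by (auto simp: fun_eq_iff transpose_def)
          then show ?thesis using vT tn s xy by (metis act_comp transpose_n)
        next
          case c
          have "transpose t s \<circ> ?f = transpose (?f t) s"
            using c by (auto simp: fun_eq_iff transpose_def)
          then show ?thesis using vT tn s xy by (metis act_comp transpose_n)
        next
          case d
          define z where "z = (if x = s then y else x)"
          have z: "z \<noteq> s" "z < n" "t \<noteq> s" "t \<noteq> z" "?f = transpose s z" "g z = i" "g t = i"
            using d False xy t by (auto simp: z_def h_def transpose_commute split: if_splits)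
          have "transpose t s \<circ> ?f = transpose t z \<circ> transpose t s"
            using z by (auto simp: fun_eq_iff transpose_def)
          then have "act ?f (act (transpose t s) v) = act (transpose t s) (act (transpose t z) v)"
            using vT tn s xy z by (metis act_comp transpose_n)
          moreover have "act (transpose t z) v = v" using z tn by (intro sym) auto
          moreover have "?f t = t" using d by (simp add: transpose_def)
          ultimately show ?thesis by simp
        qed
      qed
      have "act ?f u = (\<Sum>t\<in>insert s ?R. act (transpose (?f t) s) v)"
        unfolding u_def using xy s vT step
        by (subst act_sum) (auto intro!: transpose_n act_closed sum.cong)
      also have "\<dots> = u"
        unfolding u_def by (rule sum.reindex_bij_witness[of _ ?f ?f]) (simp_all only: transpose_involutory R)
      finally show ?thesis .
    qed
    then have "symmetric_colouring M h"
      unfolding symmetric_colouring_def using uM u0 by blast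
    then have "(\<Sum>m<n. g m) \<le> (\<Sum>m<n. h m)" by (rule min)
    moreover have "(\<Sum>m<n. h m) < (\<Sum>m<n. g m)"
      using s i by (intro sum_strict_mono_ex1) (auto simp: h_def)
    ultimately show False by simp
  qed
  then show ?thesis unfolding garnir_def using vT sym by auto
qed

theorem garnir_exists:
  assumes M: "submod M" and "M \<noteq> {0}"
  obtains \<nu> v where "\<nu> \<in> partitions" "psize \<nu> = n" "v \<in> M" "v \<noteq> 0" "garnir (row_of \<nu>) {..<n} v"
proof -
  have MT: "\<And>x. x \<in> M \<Longrightarrow> x \<in> T" and clM: "\<And>\<sigma> x. \<sigma> permutes {..<n} \<Longrightarrow> x \<in> M \<Longrightarrow> act \<sigma> x \<in> M"
    using M by (auto simp: submod_def)
  have "0 \<in> M" using M by (simp add: submod_def fun_vs.subspace_0)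
  then obtain w where w: "w \<in> M" "w \<noteq> 0" using assms(2) by blast
  \<comment> \<open>In the colouring \<open>id\<close> all colours differ, so every nonzero vector
    qualifies.\<close>
  have "act (transpose s t) w = w" if "id s = id t" for s t :: nat
    using that act_id[OF MT[OF w(1)]] by (simp add: id_def)
  then have "symmetric_colouring M id"
    unfolding symmetric_colouring_def using w by blast
  then obtain g where g: "symmetric_colouring M g"
    and min: "\<And>h. symmetric_colouring M h \<Longrightarrow> (\<Sum>m<n. g m) \<le> (\<Sum>m<n. h m)"
    using ex_has_least_nat[of "symmetric_colouring M" id "\<lambda>g. \<Sum>m<n. g m"] by blast
  obtain v where v: "v \<in> M" "v \<noteq> 0"
    and sym: "\<And>s t. s < n \<Longrightarrow> t < n \<Longrightarrow> g s = g t \<Longrightarrow> act (transpose s t) v = v"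
    using g unfolding symmetric_colouring_def by blast
  define \<nu> where "\<nu> i = card {m \<in> {..<n}. g m = i}" for i
  have "\<nu> j \<le> \<nu> i" if ij: "i < j" for i j
  proof (rule ccontr)
    assume "\<not> \<nu> j \<le> \<nu> i"
    then have less: "\<nu> i < \<nu> j" by simp
    \<comment> \<open>Exchanging the colours i < j changes their sum by (\<nu> i - \<nu> j)(j - i),
      which is negative if class j is the larger one.\<close>
    define h where "h = transpose i j \<circ> g"
    have "h s = h t \<longleftrightarrow> g s = g t" for s t
      unfolding h_def by (metis comp_apply transpose_involutory)
    then have "symmetric_colouring M h"
      using g by (simp add: symmetric_colouring_def)
    then have "(\<Sum>m<n. g m) \<le> (\<Sum>m<n. h m)" by (rule min)
    then have "0 \<le> (\<Sum>m<n. int (h m)) - (\<Sum>m<n. int (g m))" by (simp flip: of_nat_sum)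
    also have "\<dots> = (\<Sum>m<n. int (h m) - int (g m))" by (simp add: sum_subtractf)
    also have "\<dots> = (\<Sum>m<n. (if g m = i then int j - int i else 0) + (if g m = j then int i - int j else 0))"
      using ij by (intro sum.cong) (auto simp: h_def transpose_def)
    also have "\<dots> = int (\<nu> i) * (int j - int i) + int (\<nu> j) * (int i - int j)"
      by (simp add: sum.distrib \<nu>_def sum.inter_filter[symmetric])
    also have "\<dots> = (int (\<nu> i) - int (\<nu> j)) * (int j - int i)" by (simp add: algebra_simps)
    also have "\<dots> < 0" using less ij by (intro mult_neg_pos) auto
    finally show False by simp
  qed
  then have anti: "antimono \<nu>" by (metis antimonoI le_eq_less_or_eq order_refl)
  have nz: "{i. \<nu> i \<noteq> 0} = g ` {..<n}" by (auto simp: \<nu>_def card_eq_0_iff)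
  then have part: "\<nu> \<in> partitions" using anti by (simp add: partitions_def)
  have size: "psize \<nu> = n"
    using sum.group[of "{..<n}" "g ` {..<n}" g "\<lambda>_. 1::nat"] nz by (simp add: psize_def \<nu>_def)
  \<comment> \<open>The classes of g and of \<open>row_of \<nu>\<close> have equal sizes, so the two
    colourings differ by a permutation of the positions.\<close>
  have "image_mset (row_of \<nu>) (mset_set {..<n}) = image_mset g (mset_set {..<n})"
  proof (rule multiset_eqI)
    fix i
    show "count (image_mset (row_of \<nu>) (mset_set {..<n})) i = count (image_mset g (mset_set {..<n})) i"
      using card_row[OF part, of i] size
      by (simp add: count_image_mset_eq_card_vimage \<nu>_def)
  qed
  then obtain p where p: "p permutes {..<n}" "\<forall>m\<in>{..<n}. row_of \<nu> m = g (p m)"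
    by (rule image_mset_eq_implies_permutes[OF finite_lessThan])
  have "garnir g {..<n} v" using M v(1) sym min by (rule garnir_if_minimal)
  then have "garnir (g \<circ> p) {..<n} (act p v)" using p(1) by (rule garnir_conj)
  moreover have "{t. t \<in> {..<n} \<and> (g \<circ> p) t = i} = {t. t \<in> {..<n} \<and> row_of \<nu> t = i}" for i
    using p(2) by auto
  ultimately have "garnir (row_of \<nu>) {..<n} (act p v)"
    unfolding garnir_def using p(2) by simp
  moreover have "act p v \<noteq> 0" using act_eq_zero[OF p(1)] v MT by blast
  ultimately show thesis using that part size clM[OF p(1) v(1)] by blast
qed

end

section \<open>The group algebra as a module over itself\<close>

definition perm_functions :: "nat \<Rightarrow> ((nat \<Rightarrow> nat) \<Rightarrow> 'f::field_char_0) set" where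
  "perm_functions n = {x. \<forall>\<rho>. \<not> \<rho> permutes {..<n} \<longrightarrow> x \<rho> = 0}"

definition perm_unit :: "(nat \<Rightarrow> nat) \<Rightarrow> 'f::field_char_0" where
  "perm_unit \<rho> = (if \<rho> = id then 1 else 0)"

text \<open>With this instance \<open>regular.mult n x y\<close> is the product x y in the group
  algebra, so what holds for modules can be applied to right ideals.\<close>

interpretation regular: sym_action n "perm_functions n" right_mult
proof
  show "fun_vs.subspace (perm_functions n)"
    by (auto simp: fun_vs.subspace_def perm_functions_def fscale_def plus_fun_apply zero_fun_apply)
  show "right_mult \<sigma> t \<in> perm_functions n" if "\<sigma> permutes {..<n}" "t \<in> perm_functions n"
    for \<sigma> and t :: "_ \<Rightarrow> 'f::field_char_0"
  proof -
    have "\<rho> permutes {..<n}" if "\<rho> \<circ> inv \<sigma> permutes {..<n}" for \<rho>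
    proof -
      have "(\<rho> \<circ> inv \<sigma>) \<circ> \<sigma> permutes {..<n}" using \<open>\<sigma> permutes {..<n}\<close> that by (rule permutes_compose)
      then show ?thesis using \<open>\<sigma> permutes {..<n}\<close> by (simp add: comp_assoc permutes_inv_o)
    qed
    then show ?thesis using that by (auto simp: perm_functions_def right_mult_def)
  qed
  show "right_mult (\<sigma> \<circ> \<tau>) t = right_mult \<tau> (right_mult \<sigma> t)"
    if "\<sigma> permutes {..<n}" "\<tau> permutes {..<n}" for \<sigma> \<tau> and t :: "_ \<Rightarrow> 'f::field_char_0"
    using that by (simp add: right_mult_def fun_eq_iff o_inv_distrib permutes_bij comp_assoc)
qed (auto simp: right_mult_def plus_fun_apply fscale_def fun_eq_iff)

lemma perm_unit_in: "perm_unit \<in> perm_functions n"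
  by (auto simp: perm_unit_def perm_functions_def permutes_id)

lemma perm_unit_mult:
  assumes "y \<in> perm_functions n"
  shows "regular.mult n perm_unit y = (y :: _ \<Rightarrow> 'f::field_char_0)"
proof
  have sum_apply: "sum f A \<rho> = (\<Sum>i\<in>A. f i \<rho>)" for \<rho> and f :: "_ \<Rightarrow> _ \<Rightarrow> 'f" and A
    by (induction A rule: infinite_finite_induct) (simp_all add: plus_fun_apply zero_fun_apply)
  fix \<rho> :: "nat \<Rightarrow> nat"
  have eq: "\<rho> \<circ> inv \<sigma> = id \<longleftrightarrow> \<sigma> = \<rho>" if "\<sigma> permutes {..<n}" for \<sigma>
    using that by (metis comp_assoc comp_id id_comp permutes_inv_o)
  have "regular.mult n perm_unit y \<rho> = (\<Sum>\<sigma> | \<sigma> permutes {..<n}. if \<sigma> = \<rho> then y \<sigma> else 0)"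
    unfolding regular.mult_def sum_apply fscale_def right_mult_def perm_unit_def
    using eq by (intro sum.cong) auto
  also have "\<dots> = y \<rho>" using assms by (auto simp: finite_permutations perm_functions_def)
  finally show "regular.mult n perm_unit y \<rho> = y \<rho>" .
qed

lemma (in sym_action) mult_perm_unit: "v \<in> T \<Longrightarrow> mult v perm_unit = v"
proof -
  assume v: "v \<in> T"
  have "mult v perm_unit = (\<Sum>\<sigma> | \<sigma> permutes {..<n}. if \<sigma> = id then v else 0)"
    unfolding mult_def perm_unit_def using v by (intro sum.cong) (auto simp: act_id)
  then show ?thesis by (simp add: finite_permutations permutes_id)
qed

lemma (in sym_action) mult_assoc:
  assumes "v \<in> T"
  shows "mult v (regular.mult n x y) = mult (mult v x) y"
  unfolding regular.mult_def mult_sum mult_scale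
  by (simp add: mult_right_mult[OF assms] mult_def[of "mult v x"])

lemma young_symmetrizer_in: "psize \<nu> = n \<Longrightarrow> young_symmetrizer \<nu> \<in> perm_functions n"
  unfolding perm_functions_def young_symmetrizer_def
  using permutes_compose[OF stabilizer_permutes(2) stabilizer_permutes(1)]
  by (auto intro!: sum.neutral)

lemma young_symmetrizer_eq:
  "psize \<nu> = n \<Longrightarrow> regular.young \<nu> id perm_unit = (young_symmetrizer \<nu> :: _ \<Rightarrow> 'f::field_char_0)"
  by (rule trans[OF regular.mult_young_symmetrizer[OF perm_unit_in, symmetric]
      perm_unit_mult[OF young_symmetrizer_in]])

text \<open>Row and column stabilizer meet only in the identity, so p q = id forces p = q = id. This
  is how the Young symmetrizer is seen to be nonzero.\<close>

lemma young_symmetrizer_id: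
  assumes "\<nu> \<in> partitions"
  shows "young_symmetrizer \<nu> id = (1 :: 'f::field_char_0)"
proof -
  let ?R = "row_stabilizer \<nu>" and ?C = "col_stabilizer \<nu>"
  have "p = id" "q = id" if "p \<in> ?R" "q \<in> ?C" "p \<circ> q = id" for p q
  proof -
    have q: "q permutes {..<psize \<nu>}" using that stabilizer_permutes by blast
    then have "p = inv q" using that(3) by (metis comp_assoc comp_id id_comp permutes_inv_o(1))
    then have "p \<in> ?C" using that stabilizer_inv by blast
    then show "p = id" using stabilizer_inter[OF assms that(1)] by blast
    then show "q = id" using that(3) by simp
  qed
  then have "(if p \<circ> q = id then of_int (sign q) else 0) = (if q = id then if p = id then 1 else 0 else (0::'f))"
    if "p \<in> ?R" "q \<in> ?C" for p q using that by fastforce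
  then have "young_symmetrizer \<nu> id = (\<Sum>p\<in>?R. \<Sum>q\<in>?C. if q = id then if p = id then 1 else 0 else (0::'f))"
    unfolding young_symmetrizer_def by (intro sum.cong) auto
  then show ?thesis by (simp add: finite_stabilizer stabilizer_id)
qed

lemma irreducible_module_eq:
  assumes "psize \<nu> = n"
  shows "irreducible_module \<nu> = range (regular.mult n (young_symmetrizer \<nu> :: _ \<Rightarrow> 'f::field_char_0))"
    (is "_ = range ?m")
proof
  have e: "(young_symmetrizer \<nu> :: _ \<Rightarrow> 'f) \<in> perm_functions n" using assms by (rule young_symmetrizer_in)
  have "fun_vs.subspace (range ?m)"
    unfolding fun_vs.subspace_def
    by (auto simp: regular.mult_add[symmetric] regular.mult_scale[symmetric] regular.mult_zero
        intro: range_eqI[of _ _ 0])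
  moreover have "right_mult \<sigma> (young_symmetrizer \<nu>) = ?m (right_mult \<sigma> perm_unit)" if "\<sigma> permutes {..<n}" for \<sigma>
    using regular.mult_right_mult[OF e that] regular.mult_perm_unit[OF e] by metis
  ultimately show "irreducible_module \<nu> \<subseteq> range ?m"
    unfolding irreducible_module_def using assms by (intro fun_vs.span_minimal) auto
  show "range ?m \<subseteq> irreducible_module \<nu>"
    unfolding irreducible_module_def regular.mult_def assms
    by (rule image_subsetI, rule fun_vs.span_sum, rule fun_vs.span_scale, rule fun_vs.span_base) blast
qed

lemma irreducible_submod:
  assumes "psize \<nu> = n"
  shows "regular.submod n (irreducible_module \<nu> :: (_ \<Rightarrow> 'f::field_char_0) set)"
proof -
  have e: "(young_symmetrizer \<nu> :: _ \<Rightarrow> 'f) \<in> perm_functions n" using assms by (rule young_symmetrizer_in)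
  have "right_mult \<sigma> t \<in> irreducible_module \<nu>" if "\<sigma> permutes {..<n}" "t \<in> irreducible_module \<nu>"
    for \<sigma> and t :: "_ \<Rightarrow> 'f"
    using that regular.mult_right_mult[OF e that(1), symmetric] unfolding irreducible_module_eq[OF assms] by auto
  moreover have "fun_vs.subspace (irreducible_module \<nu> :: (_ \<Rightarrow> 'f) set)"
    unfolding irreducible_module_def by (rule fun_vs.subspace_span)
  ultimately show ?thesis
    unfolding regular.submod_def using regular.mult_T[OF e] by (auto simp: irreducible_module_eq[OF assms])
qed

text \<open>By Maschke's theorem a right ideal is generated by an idempotent, so its square is nonzero;
  but the square of a right ideal inside \<open>e F S\<^sub>n\<close> annihilated by \<open>e\<close> vanishes.\<close>

lemma right_ideal_times_symmetrizer:
  assumes \<nu>: "\<nu> \<in> partitions" "psize \<nu> = n"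
    and K: "regular.submod n K" "K \<subseteq> irreducible_module \<nu>" "K \<noteq> {0}"
  obtains y c where "y \<in> K" "c \<noteq> (0::'f::field_char_0)"
    "regular.mult n y (young_symmetrizer \<nu>) = fscale c (young_symmetrizer \<nu>)"
proof -
  let ?e = "young_symmetrizer \<nu> :: _ \<Rightarrow> 'f" and ?m = "regular.mult n :: (_ \<Rightarrow> 'f) \<Rightarrow> _"
  have e: "?e \<in> perm_functions n" using \<nu>(2) by (rule young_symmetrizer_in)
  have KP: "K \<subseteq> perm_functions n" using K(1) by (simp add: regular.submod_def)
  have scal: "\<exists>c. ?m (?m ?e z) ?e = fscale c ?e" for z
  proof -
    have "?m (?m ?e z) ?e = regular.young \<nu> id (?m ?e z)"
      using e \<nu>(2) by (intro regular.mult_young_symmetrizer regular.mult_T)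
    then show ?thesis
      using regular.young_mult_young[OF \<nu>, where z = z] perm_unit_in young_symmetrizer_eq[OF \<nu>(2)] by metis
  qed
  show thesis
  proof (cases "\<exists>y\<in>K. ?m y ?e \<noteq> 0")
    case True
    then obtain y where y: "y \<in> K" "?m y ?e \<noteq> 0" by blast
    then obtain z where "y = ?m ?e z" using K(2) irreducible_module_eq[OF \<nu>(2)] by blast
    then obtain c where c: "?m y ?e = fscale c ?e" using scal by blast
    then have "c \<noteq> 0" using y(2) by auto
    then show ?thesis using that y(1) c by blast
  next
    case False
    have zero: "?m y y' = 0" if y: "y \<in> K" "y' \<in> K" for y y'
    proof -
      obtain z where "y' = ?m ?e z" using y(2) K(2) irreducible_module_eq[OF \<nu>(2)] by blast
      then have "?m y y' = ?m (?m y ?e) z" using y(1) KP regular.mult_assoc by blast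
      then show ?thesis using False y(1) regular.mult_zero_left by metis
    qed
    obtain M where M: "regular.submod n M" "K \<inter> M = {0}"
      "\<And>t. t \<in> perm_functions n \<Longrightarrow> \<exists>x\<in>K. \<exists>y\<in>M. t = x + y"
      using regular.maschke[OF K(1)] by metis
    obtain x w where xw: "x \<in> K" "w \<in> M" "perm_unit = x + w" using M(3)[OF perm_unit_in] by blast
    have "y = 0" if y: "y \<in> K" for y
    proof -
      have T: "x \<in> perm_functions n" "w \<in> perm_functions n" "y \<in> perm_functions n"
        using xw M(1) KP y by (auto simp: regular.submod_def)
      have "y = ?m x y + ?m w y"
        using perm_unit_mult[OF T(3)] regular.mult_add_left[OF T(1,2)] xw(3) by metis
      then have "y = ?m w y" using zero[OF xw(1) y] by simp
      then have "y \<in> M" using regular.mult_submod[OF M(1) xw(2)] by metis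
      then show ?thesis using y M(2) by blast
    qed
    then show ?thesis
      using K(1,3) fun_vs.subspace_0 by (auto simp: regular.submod_def)
  qed
qed

text \<open>Irreducibility in the form in which it is used; dividing by the scalar c of
  \<open>right_ideal_times_symmetrizer\<close> recovers the generator.\<close>

lemma irreducible_module_minimal:
  assumes \<nu>: "\<nu> \<in> partitions" "psize \<nu> = n"
    and K: "regular.submod n K" "K \<subseteq> irreducible_module \<nu>" "K \<noteq> {0}"
  shows "(young_symmetrizer \<nu> :: _ \<Rightarrow> 'f::field_char_0) \<in> K"
proof -
  obtain y c where y: "y \<in> K" "c \<noteq> (0::'f)"
    "regular.mult n y (young_symmetrizer \<nu>) = fscale c (young_symmetrizer \<nu>)"
    using right_ideal_times_symmetrizer[OF \<nu> K] .
  have "fscale c (young_symmetrizer \<nu>) \<in> K"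
    using regular.mult_submod[OF K(1) y(1)] y(3) by metis
  then have "fscale (inverse c) (fscale c (young_symmetrizer \<nu>)) \<in> K"
    using K(1) unfolding regular.submod_def by (blast intro: fun_vs.subspace_scale)
  then show ?thesis using y(2) by simp
qed

text \<open>Stands in for the formula that the square of the Young symmetrizer e is a nonzero
  multiple of e. In any copy of the irreducible module it shows that the element corresponding to e
  lies in the image of e.\<close>

lemma young_symmetrizer_sandwich:
  assumes \<nu>: "\<nu> \<in> partitions" "psize \<nu> = n"
  obtains z c where "c \<noteq> (0::'f::field_char_0)"
    "regular.mult n (regular.mult n (young_symmetrizer \<nu>) z) (young_symmetrizer \<nu>) = fscale c (young_symmetrizer \<nu>)"
proof -
  let ?I = "irreducible_module \<nu> :: (_ \<Rightarrow> 'f) set"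
  have "young_symmetrizer \<nu> \<in> ?I"
    using regular.mult_perm_unit[OF young_symmetrizer_in[OF \<nu>(2)]] irreducible_module_eq[OF \<nu>(2)]
    by (metis rangeI)
  moreover have "young_symmetrizer \<nu> \<noteq> (0 :: _ \<Rightarrow> 'f)"
    using young_symmetrizer_id[OF \<nu>(1)] by (metis zero_fun_apply zero_neq_one)
  ultimately have "?I \<noteq> {0}" by blast
  then obtain y c where y: "y \<in> ?I" "c \<noteq> 0"
    "regular.mult n y (young_symmetrizer \<nu>) = fscale c (young_symmetrizer \<nu>)"
    using right_ideal_times_symmetrizer[OF \<nu> irreducible_submod[OF \<nu>(2)] subset_refl] by metis
  then obtain z where "y = regular.mult n (young_symmetrizer \<nu>) z"
    using irreducible_module_eq[OF \<nu>(2)] by blast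
  then show thesis using that[OF y(2), of z] y(3) by simp
qed

context sym_action
begin

text \<open>The kernel is a right ideal that misses the Young symmetrizer, so it is 0 by
  minimality.\<close>

lemma mult_inj_irreducible:
  assumes \<nu>: "\<nu> \<in> partitions" "psize \<nu> = n" and v: "v \<in> T" "mult v (young_symmetrizer \<nu>) \<noteq> 0"
  shows "inj_on (mult v) (irreducible_module \<nu>)"
proof -
  define K where "K = {y \<in> irreducible_module \<nu>. mult v y = 0}"
  have I: "regular.submod n (irreducible_module \<nu> :: (_ \<Rightarrow> 'f) set)" using \<nu>(2) by (rule irreducible_submod)
  have "regular.submod n K"
    using I unfolding regular.submod_def K_def fun_vs.subspace_def
    by (auto simp: mult_zero mult_add mult_scale mult_right_mult[OF v(1)] act_zero)
  moreover have "young_symmetrizer \<nu> \<notin> K" using v(2) by (simp add: K_def)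
  ultimately have K0: "K = {0}"
    using irreducible_module_minimal[OF \<nu>, of K] by (auto simp: K_def)
  show ?thesis
  proof (rule inj_onI)
    fix x y assume xy: "x \<in> irreducible_module \<nu>" "y \<in> irreducible_module \<nu>" "mult v x = mult v y"
    have "mult v (x - y) = 0"
      using mult_add[of v "x - y" y] xy(3) by simp
    moreover have "x - y \<in> irreducible_module \<nu>"
      using xy I by (auto simp: regular.submod_def intro: fun_vs.subspace_diff)
    ultimately have "x - y \<in> K" by (simp add: K_def)
    then show "x = y" using K0 by simp
  qed
qed

end

section \<open>Tensor powers in coordinates\<close>

text \<open>If i and j are odd, the reversed odd pairs are (i, j) itself and, for each odd m
  between, the two pairs that m forms with i and j: an odd number. If both are even, no odd pair is
  reversed.\<close>

lemma odd_inversions_transpose: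
  assumes "i < j" "j < n" "p i \<longleftrightarrow> p j"
  shows "(-1) ^ odd_inversions n p (transpose i j) = (if p i then -1 else 1 :: 'f::comm_ring_1)"
proof (cases "p i")
  case False
  have "{(x, y). x < y \<and> y < n \<and> p (transpose i j x) \<and> p (transpose i j y) \<and>
      transpose i j y < transpose i j x} = {}"
    using assms False by (auto simp: transpose_def split: if_splits)
  then show ?thesis using False by (simp only: odd_inversions_def) simp
next
  case True
  let ?M = "{m. i < m \<and> m < j \<and> p m}"
  have fin: "finite ?M" by (rule finite_subset[of _ "{..<j}"]) auto
  have "{(x, y). x < y \<and> y < n \<and> p (transpose i j x) \<and> p (transpose i j y) \<and>
      transpose i j y < transpose i j x} = insert (i, j) (Pair i ` ?M \<union> (\<lambda>m. (m, j)) ` ?M)"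
    using assms True by (auto simp: transpose_def split: if_splits)
  moreover have "card (insert (i, j) (Pair i ` ?M \<union> (\<lambda>m. (m, j)) ` ?M)) = Suc (card ?M + card ?M)"
  proof -
    have "card (Pair i ` ?M \<union> (\<lambda>m. (m, j)) ` ?M) = card (Pair i ` ?M) + card ((\<lambda>m. (m, j)) ` ?M)"
      using fin by (intro card_Un_disjoint) auto
    also have "\<dots> = card ?M + card ?M" by (simp add: card_image inj_on_def)
    finally show ?thesis using fin by (subst card_insert_disjoint) auto
  qed
  ultimately show ?thesis using True by (simp only: odd_inversions_def) (simp add: power_add[symmetric])
qed

text \<open>The condition is symmetric in i and j so that the product can be reindexed over
  unordered pairs; for i < j it means \<sigma> j < \<sigma> i.\<close>

lemma odd_inversions_sign:
  "(-1) ^ odd_inversions n p \<sigma> = (\<Prod>(i, j) | i < j \<and> j < n.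
     if p (\<sigma> i) \<and> p (\<sigma> j) \<and> (\<sigma> i < \<sigma> j) \<noteq> (i < j) then -1 else 1 :: 'f::comm_ring_1)"
  if "\<sigma> permutes {..<n}"
proof -
  let ?P = "{(i, j). i < j \<and> j < n}"
  have fin: "finite ?P" by (rule finite_subset[of _ "{..<n} \<times> {..<n}"]) auto
  have "(\<Prod>(i, j)\<in>?P. if p (\<sigma> i) \<and> p (\<sigma> j) \<and> (\<sigma> i < \<sigma> j) \<noteq> (i < j) then -1 else 1 :: 'f) =
      (\<Prod>x\<in>?P. if p (\<sigma> (fst x)) \<and> p (\<sigma> (snd x)) \<and> \<sigma> (snd x) < \<sigma> (fst x) then -1 else 1)"
  proof (intro prod.cong refl)
    fix x assume "x \<in> ?P"
    then obtain i j where x: "x = (i, j)" "i < j" by auto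
    have "\<sigma> i \<noteq> \<sigma> j" using x(2) permutes_inj[OF that] by (auto dest: injD)
    then show "(case x of (i, j) \<Rightarrow> (if p (\<sigma> i) \<and> p (\<sigma> j) \<and> (\<sigma> i < \<sigma> j) \<noteq> (i < j) then -1 else 1 :: 'f)) =
        (if p (\<sigma> (fst x)) \<and> p (\<sigma> (snd x)) \<and> \<sigma> (snd x) < \<sigma> (fst x) then -1 else 1)"
      using x by (auto simp: not_less_iff_gr_or_eq)
  qed
  also have "\<dots> = (\<Prod>x | x \<in> ?P \<and> p (\<sigma> (fst x)) \<and> p (\<sigma> (snd x)) \<and> \<sigma> (snd x) < \<sigma> (fst x). -1)"
    using fin by (simp only: prod.inter_filter)
  also have "{x. x \<in> ?P \<and> p (\<sigma> (fst x)) \<and> p (\<sigma> (snd x)) \<and> \<sigma> (snd x) < \<sigma> (fst x)} =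
      {(i, j). i < j \<and> j < n \<and> p (\<sigma> i) \<and> p (\<sigma> j) \<and> \<sigma> j < \<sigma> i}" by auto
  finally show ?thesis by (simp add: odd_inversions_def)
qed

text \<open>The factor of \<sigma> \<circ> \<tau> at a pair {i, j} is that of \<tau> at {i, j}, with
  parities read after \<sigma>, times that of \<sigma> at {\<tau> i, \<tau> j}. Over all unordered
  pairs, \<tau> only permutes the factors of \<sigma>.\<close>

lemma odd_inversions_comp:
  assumes \<sigma>: "\<sigma> permutes {..<n}" and \<tau>: "\<tau> permutes {..<n}"
  shows "(-1) ^ odd_inversions n p (\<sigma> \<circ> \<tau>) =
    (-1) ^ odd_inversions n p \<sigma> * ((-1) ^ odd_inversions n (p \<circ> \<sigma>) \<tau> :: 'f::comm_ring_1)"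
proof -
  let ?P = "{(i, j). i < j \<and> j < n}"
  define f where "f i j = (if p (\<sigma> i) \<and> p (\<sigma> j) \<and> (\<sigma> i < \<sigma> j) \<noteq> (i < j) then -1 else 1 :: 'f)" for i j
  define g where "g i j = (if p (\<sigma> (\<tau> i)) \<and> p (\<sigma> (\<tau> j)) \<and> (\<tau> i < \<tau> j) \<noteq> (i < j) then -1 else 1 :: 'f)" for i j
  \<comment> \<open>The action of a permutation on unordered pairs, each listed in increasing
    order.\<close>
  define r where "r \<pi> = (\<lambda>(i, j). if \<pi> i < \<pi> j then (\<pi> i, \<pi> j) else (\<pi> j, \<pi> i :: nat))" for \<pi> :: "nat \<Rightarrow> nat"
  have inj: "\<pi> i \<noteq> \<pi> j" if "\<pi> permutes {..<n}" "i \<noteq> j" for \<pi> i j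
    using that by (metis permutes_inverses(2))
  have rP: "r \<pi> x \<in> ?P" if \<pi>: "\<pi> permutes {..<n}" "x \<in> ?P" for \<pi> x
  proof -
    obtain i j where x: "x = (i, j)" "i < j" "j < n" using \<pi>(2) by auto
    then have "\<pi> i < n" "\<pi> j < n" using permutes_in_image[OF \<pi>(1), of i] permutes_in_image[OF \<pi>(1), of j] by auto
    then show ?thesis using inj[OF \<pi>(1), of i j] x by (auto simp: r_def)
  qed
  have rr: "r \<pi>' (r \<pi> x) = x" if "\<And>m. \<pi>' (\<pi> m) = m" "x \<in> ?P" for \<pi> \<pi>' x
    using that by (auto simp: r_def)
  have sym: "f i j = f j i" if "i \<noteq> j" for i j
    using inj[OF \<sigma> that] that by (auto simp: f_def)
  have "(\<Prod>(i, j)\<in>?P. f (\<tau> i) (\<tau> j)) = (\<Prod>(i, j)\<in>?P. f i j)"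
  proof (rule prod.reindex_bij_witness[of _ "r (inv \<tau>)" "r \<tau>"])
    fix x assume x: "x \<in> ?P"
    show "r (inv \<tau>) (r \<tau> x) = x" "r \<tau> (r (inv \<tau>) x) = x"
      using x \<tau> by (auto intro!: rr simp: permutes_inverses)
    show "r \<tau> x \<in> ?P" "r (inv \<tau>) x \<in> ?P"
      by (rule rP[OF \<tau> x], rule rP[OF permutes_inv[OF \<tau>] x])
    show "(case r \<tau> x of (i, j) \<Rightarrow> f i j) = (case x of (i, j) \<Rightarrow> f (\<tau> i) (\<tau> j))"
      using x inj[OF \<tau>] sym by (auto simp: r_def)
  qed
  moreover have "((-1) ^ odd_inversions n p (\<sigma> \<circ> \<tau>) :: 'f) = (\<Prod>(i, j)\<in>?P. f (\<tau> i) (\<tau> j) * g i j)"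
    unfolding odd_inversions_sign[OF permutes_compose[OF \<tau> \<sigma>]]
    by (intro prod.cong refl) (auto simp: f_def g_def)
  moreover have "\<dots> = (\<Prod>(i, j)\<in>?P. f (\<tau> i) (\<tau> j)) * (\<Prod>(i, j)\<in>?P. g i j)"
    by (simp add: prod.distrib[symmetric] case_prod_beta)
  moreover have "((-1) ^ odd_inversions n p \<sigma> :: 'f) = (\<Prod>(i, j)\<in>?P. f i j)"
    unfolding odd_inversions_sign[OF \<sigma>] f_def ..
  moreover have "((-1) ^ odd_inversions n (p \<circ> \<sigma>) \<tau> :: 'f) = (\<Prod>(i, j)\<in>?P. g i j)"
    unfolding odd_inversions_sign[OF \<tau>] g_def by simp
  ultimately show ?thesis by (simp only:)
qed

lemma odd_inversions_id: "odd_inversions n p id = 0"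
proof -
  have "{(i, j). i < j \<and> j < n \<and> p i \<and> p j \<and> j < i} = {}" by auto
  then show ?thesis by (simp only: odd_inversions_def id_apply card.empty)
qed

section \<open>Words in a homogeneous basis\<close>

locale super_tensor = vector_space scale
  for scale :: "'f::field_char_0 \<Rightarrow> 'v::ab_group_add \<Rightarrow> 'v" +
  fixes V0 V1 B0 B1 :: "'v set"
  assumes superspace: "superspace scale V0 V1"
    and B0: "finite B0" "independent B0" "span B0 = V0"
    and B1: "finite B1" "independent B1" "span B1 = V1"
begin

abbreviation "TP n \<equiv> tensor_power scale n"
abbreviation "act n \<equiv> signed_action scale V0 V1 n"

definition "letters = B0 \<union> B1"

lemma disjoint: "B0 \<inter> B1 = {}"
proof -
  have "B0 \<inter> B1 \<subseteq> V0 \<inter> V1" using B0(3) B1(3) span_superset by blast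
  moreover have "V0 \<inter> V1 = {0}" using superspace by (simp add: superspace_def)
  ultimately have "B0 \<inter> B1 \<subseteq> {0}" by (simp only:)
  then show ?thesis using B0(2) dependent_zero by auto
qed

lemma finite_letters: "finite letters" by (simp add: letters_def B0 B1)

lemma span_letters: "span letters = UNIV"
proof -
  have "v \<in> span letters" for v
  proof -
    obtain x y where "x \<in> V0" "y \<in> V1" "v = x + y" using superspace unfolding superspace_def by meson
    then show ?thesis
      using span_mono[of B0 letters] span_mono[of B1 letters] B0(3) B1(3)
      by (auto simp: letters_def intro!: span_add)
  qed
  then show ?thesis by auto
qed

lemma independent_letters: "independent letters"
proof (rule independent_if_scalars_zero[OF finite_letters])
  fix f x assume f: "(\<Sum>x\<in>letters. scale (f x) x) = 0" and x: "x \<in> letters"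
  let ?s = "\<lambda>B. \<Sum>x\<in>B. scale (f x) x"
  have "?s B0 + ?s B1 = 0"
    using f disjoint B0(1) B1(1) by (simp add: letters_def sum.union_disjoint)
  moreover have s: "?s B0 \<in> V0" "?s B1 \<in> V1"
    unfolding B0(3)[symmetric] B1(3)[symmetric]
    by (rule span_sum, rule span_scale, rule span_base, assumption)+
  ultimately have "?s B0 \<in> V1"
    using superspace subspace_neg by (metis add_eq_0_iff2 superspace_def)
  then have "?s B0 = 0" using s superspace by (auto simp: superspace_def)
  moreover from this have "?s B1 = 0" using \<open>?s B0 + ?s B1 = 0\<close> by simp
  ultimately show "f x = 0"
    using x B0 B1 independentD[of B0 B0 f x] independentD[of B1 B1 f x] by (auto simp: letters_def)
qed

definition dual :: "'v \<Rightarrow> 'v \<Rightarrow> 'f" where "dual b = (\<lambda>v. representation letters v b)"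

lemma linear_dual: "Vector_Spaces.linear scale (*) (dual b)"
  unfolding dual_def using independent_letters span_letters
  by (intro linear_representation) auto

lemma dual_letter: "b \<in> letters \<Longrightarrow> c \<in> letters \<Longrightarrow> dual b c = (if b = c then 1 else 0)"
  using independent_letters by (simp add: dual_def representation_basis)

definition "words n = {w. length w = n \<and> set w \<subseteq> letters}"

lemma finite_words: "finite (words n)"
  using finite_lists_length_eq[OF finite_letters, of n] by (simp add: words_def conj_commute)

lemma words_nth: "w \<in> words n \<Longrightarrow> i < n \<Longrightarrow> w ! i \<in> letters"
  by (auto simp: words_def)

text \<open>Tensors are functions on lists of functionals; the value at the dual basis functionals
  of the letters of w is the coefficient of w.\<close>

definition cf :: "(('v \<Rightarrow> 'f) list \<Rightarrow> 'f) \<Rightarrow> 'v list \<Rightarrow> 'f" where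
  "cf t w = t (map dual w)"

lemma cf_add: "cf (s + t) w = cf s w + cf t w" and cf_scale: "cf (fscale c t) w = c * cf t w"
  and cf_zero: "cf 0 w = 0" and cf_neg: "cf (- t) w = - cf t w"
  by (simp_all add: cf_def plus_fun_apply zero_fun_apply fscale_def)

lemma cf_sum: "cf (sum f A) w = (\<Sum>i\<in>A. cf (f i) w)"
  by (induction A rule: infinite_finite_induct) (simp_all add: cf_zero cf_add)

lemma cf_tensor:
  assumes "w \<in> words n" "w' \<in> words m"
  shows "cf (tensor scale w) w' = (if w = w' then 1 else 0)"
proof (cases "length w = length w'")
  case False
  then show ?thesis by (auto simp: cf_def tensor_def)
next
  case True
  then have nm: "n = m" using assms by (simp add: words_def)
  have "cf (tensor scale w) w' = (\<Prod>i<n. dual (w' ! i) (w ! i))"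
    using True assms linear_dual by (auto simp: cf_def tensor_def words_def)
  also have "\<dots> = (\<Prod>i<n. if w' ! i = w ! i then 1 else 0)"
    using assms nm by (intro prod.cong refl) (simp add: dual_letter words_nth)
  also have "\<dots> = (if w = w' then 1 else 0)"
  proof (cases "w = w'")
    case False
    then obtain i where "i < n" "w' ! i \<noteq> w ! i"
      using True assms(1) by (metis (mono_tags, lifting) mem_Collect_eq nth_equalityI words_def)
    then show ?thesis using False by (auto intro!: prod_zero)
  qed simp
  finally show ?thesis .
qed

lemma tensor_in_words:
  assumes "length vs = n"
  shows "tensor scale vs \<in> fun_vs.span (tensor scale ` words n)" (is "_ \<in> ?S")
proof -
  \<comment> \<open>Positions from j on already hold letters. Each step expands the vector at one
    further position by multilinearity; j = n imposes nothing.\<close>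
  have "tensor scale vs \<in> ?S"
    if "length vs = n" "\<And>i. j \<le> i \<Longrightarrow> i < n \<Longrightarrow> vs ! i \<in> letters" for j vs
    using that
  proof (induction j arbitrary: vs)
    case 0
    then have "set vs \<subseteq> letters" by (metis le0 in_set_conv_nth subsetI)
    then show ?case using 0 by (intro fun_vs.span_base) (auto simp: words_def)
  next
    case (Suc j)
    show ?case
    proof (cases "j < n")
      case False
      then show ?thesis using Suc by (intro Suc.IH) auto
    next
      case True
      have "tensor scale (vs[j := z]) \<in> ?S" if "z \<in> span letters" for z
        using that
      proof (induction rule: span_induct_alt)
        case base
        have "tensor scale (vs[j := 0]) = fscale 0 (tensor scale (vs[j := 0]))"
          using tensor_scale[of j vs scale 0 0] True Suc.prems(1) by simp
        then show ?case by (metis fun_vs.scale_zero_left fun_vs.span_zero)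
      next
        case (step c x y)
        have "tensor scale (vs[j := x]) \<in> ?S"
          using Suc.prems True step(1) by (intro Suc.IH) (auto simp: nth_list_update)
        then show ?case
          using True Suc.prems(1) step
          by (simp add: tensor_add tensor_scale fun_vs.span_add fun_vs.span_scale)
      qed
      from this[of "vs ! j"] show ?thesis using span_letters by simp
    qed
  qed
  from this[of vs n] assms show ?thesis by simp
qed

lemma tensor_power_words: "TP n = fun_vs.span (tensor scale ` words n)"
proof
  show "TP n \<subseteq> fun_vs.span (tensor scale ` words n)"
    unfolding tensor_power_def by (intro fun_vs.span_minimal) (auto intro: tensor_in_words)
  show "fun_vs.span (tensor scale ` words n) \<subseteq> TP n"
    unfolding tensor_power_def by (intro fun_vs.span_mono) (auto simp: words_def)
qed

lemma tensor_in: "w \<in> words n \<Longrightarrow> tensor scale w \<in> TP n"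
  unfolding tensor_power_words by (intro fun_vs.span_base) auto

lemma subspace_TP: "fun_vs.subspace (TP n)"
  unfolding tensor_power_def by (rule fun_vs.subspace_span)

lemma word_expansion:
  assumes "t \<in> TP n"
  shows "t = (\<Sum>w\<in>words n. fscale (cf t w) (tensor scale w))"
  using assms unfolding tensor_power_words
proof (induction rule: fun_vs.span_induct_alt)
  case base
  then show ?case by (simp add: cf_zero)
next
  case (step c x y)
  then obtain w where w: "w \<in> words n" "x = tensor scale w" by blast
  have "(\<Sum>w'\<in>words n. fscale (cf (fscale c x + y) w') (tensor scale w')) =
     (\<Sum>w'\<in>words n. fscale (c * cf x w') (tensor scale w')) + (\<Sum>w'\<in>words n. fscale (cf y w') (tensor scale w'))"
    by (simp add: cf_add cf_scale fun_vs.scale_left_distrib sum.distrib)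
  also have "(\<Sum>w'\<in>words n. fscale (c * cf x w') (tensor scale w')) =
      (\<Sum>w'\<in>words n. if w' = w then fscale c (tensor scale w) else 0)"
    using w by (intro sum.cong) (auto simp: cf_tensor)
  also have "\<dots> = fscale c x" using w finite_words by simp
  finally show ?case using step.IH by simp
qed

lemma cf_eq_zero: "t \<in> TP n \<Longrightarrow> (\<And>w. w \<in> words n \<Longrightarrow> cf t w = 0) \<Longrightarrow> t = 0"
  using word_expansion[of t n] by simp

definition sgn :: "'v list \<Rightarrow> (nat \<Rightarrow> nat) \<Rightarrow> 'f" where
  "sgn w \<sigma> = (-1) ^ odd_inversions (length w) (\<lambda>i. w ! i \<in> B1) \<sigma>"

lemma sgn_nonzero: "sgn w \<sigma> \<noteq> 0"
  by (simp add: sgn_def)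

lemma signed_action: "\<sigma> permutes {..<n} \<Longrightarrow> is_signed_action scale V0 V1 n \<sigma> (act n \<sigma>)"
  unfolding signed_action_def using theI'[OF signed_action_ex1[OF superspace]] .

lemma act_tensor:
  assumes \<sigma>: "\<sigma> permutes {..<n}" and w: "w \<in> words n"
  shows "act n \<sigma> (tensor scale w) = fscale (sgn w \<sigma>) (tensor scale (permute_list \<sigma> w))"
proof -
  have len: "length w = n" using w by (simp add: words_def)
  have "\<forall>i<n. w ! i \<in> (if w ! i \<in> B1 then V1 else V0)"
    using words_nth[OF w] B0(3) B1(3) span_base by (fastforce simp: letters_def)
  then have "act n \<sigma> (tensor scale w) = fscale ((-1) ^ odd_inversions n (\<lambda>i. w ! i \<in> B1) \<sigma>)
      (tensor scale (map (\<lambda>i. w ! \<sigma> i) [0..<n]))"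
    using signed_action[OF \<sigma>, unfolded is_signed_action_def, THEN conjunct2, THEN conjunct2, rule_format,
        of w "\<lambda>i. w ! i \<in> B1"] len by blast
  then show ?thesis by (simp add: sgn_def permute_list_def len)
qed

lemma permute_words: "\<sigma> permutes {..<n} \<Longrightarrow> w \<in> words n \<Longrightarrow> permute_list \<sigma> w \<in> words n"
  by (auto simp: words_def set_permute_list)

lemma act_linear:
  assumes "\<sigma> permutes {..<n}"
  shows "s \<in> TP n \<Longrightarrow> t \<in> TP n \<Longrightarrow> act n \<sigma> (s + t) = act n \<sigma> s + act n \<sigma> t"
    and "t \<in> TP n \<Longrightarrow> act n \<sigma> (fscale c t) = fscale c (act n \<sigma> t)"
  using signed_action[OF assms] by (auto simp: is_signed_action_def linear_between_def)

lemma act_sum: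
  assumes "\<sigma> permutes {..<n}" "\<And>i. i \<in> A \<Longrightarrow> f i \<in> TP n"
  shows "act n \<sigma> (sum f A) = (\<Sum>i\<in>A. act n \<sigma> (f i))"
  using assms(2)
proof (induction A rule: infinite_finite_induct)
  case (insert x A)
  then show ?case
    using assms(1) by (simp add: act_linear(1) fun_vs.subspace_sum[OF subspace_TP])
qed (use act_linear(2)[OF assms(1) fun_vs.subspace_0[OF subspace_TP], of 0] in simp_all)

lemma act_expansion:
  assumes \<sigma>: "\<sigma> permutes {..<n}" and t: "t \<in> TP n"
  shows "act n \<sigma> t = (\<Sum>w\<in>words n. fscale (cf t w * sgn w \<sigma>) (tensor scale (permute_list \<sigma> w)))"
proof -
  have "act n \<sigma> t = act n \<sigma> (\<Sum>w\<in>words n. fscale (cf t w) (tensor scale w))"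
    using word_expansion[OF t] by (rule arg_cong)
  also have "\<dots> = (\<Sum>w\<in>words n. act n \<sigma> (fscale (cf t w) (tensor scale w)))"
    using \<sigma> by (intro act_sum) (auto intro!: fun_vs.subspace_scale[OF subspace_TP] tensor_in)
  also have "\<dots> = (\<Sum>w\<in>words n. fscale (cf t w * sgn w \<sigma>) (tensor scale (permute_list \<sigma> w)))"
    using \<sigma> by (intro sum.cong refl) (simp add: act_linear(2) tensor_in act_tensor)
  finally show ?thesis .
qed

lemma act_in: "\<sigma> permutes {..<n} \<Longrightarrow> t \<in> TP n \<Longrightarrow> act n \<sigma> t \<in> TP n"
  unfolding act_expansion by (auto intro!: fun_vs.subspace_sum[OF subspace_TP]
    fun_vs.subspace_scale[OF subspace_TP] tensor_in permute_words)

text \<open>The cocycle property that makes the signed place permutations a right action.\<close>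

lemma sgn_comp:
  assumes "\<sigma> permutes {..<n}" "\<tau> permutes {..<n}" "length w = n"
  shows "sgn w (\<sigma> \<circ> \<tau>) = sgn w \<sigma> * sgn (permute_list \<sigma> w) \<tau>"
proof -
  have "odd_inversions n ((\<lambda>i. w ! i \<in> B1) \<circ> \<sigma>) \<tau> = odd_inversions n (\<lambda>i. permute_list \<sigma> w ! i \<in> B1) \<tau>"
  proof -
    have "\<tau> i < n" if "i < n" for i using assms(2) that by (metis lessThan_iff permutes_in_image)
    then show ?thesis
      unfolding odd_inversions_def using assms
      by (intro arg_cong[of _ _ card]) (auto simp: permute_list_nth)
  qed
  then show ?thesis
    using odd_inversions_comp[OF assms(1,2), of "\<lambda>i. w ! i \<in> B1"] assms(3) by (simp add: sgn_def)
qed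

lemma sgn_id: "sgn w id = 1"
  by (simp add: sgn_def odd_inversions_id)

lemma permute_list_inv:
  assumes "\<sigma> permutes {..<n}" "length w = n"
  shows "permute_list (inv \<sigma>) (permute_list \<sigma> w) = w" "permute_list \<sigma> (permute_list (inv \<sigma>) w) = w"
  using assms by (simp_all add: permute_list_compose[symmetric] permutes_inv permutes_inv_o)

sublocale tp: sym_action n "TP n" "act n" for n
proof
  show "fun_vs.subspace (TP n)" by (rule subspace_TP)
  show "act n \<sigma> t \<in> TP n" if "\<sigma> permutes {..<n}" "t \<in> TP n" for \<sigma> t using that by (rule act_in)
  show "act n \<sigma> (s + t) = act n \<sigma> s + act n \<sigma> t" if "\<sigma> permutes {..<n}" "s \<in> TP n" "t \<in> TP n" for \<sigma> s t
    using that by (rule act_linear)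
  show "act n \<sigma> (fscale c t) = fscale c (act n \<sigma> t)" if "\<sigma> permutes {..<n}" "t \<in> TP n" for \<sigma> c t
    using that by (rule act_linear)
  show "act n id t = t" if "t \<in> TP n" for t
    using act_expansion[OF permutes_id that] word_expansion[OF that] by (simp add: sgn_id)
  show "act n (\<sigma> \<circ> \<tau>) t = act n \<tau> (act n \<sigma> t)"
    if \<sigma>: "\<sigma> permutes {..<n}" and \<tau>: "\<tau> permutes {..<n}" and t: "t \<in> TP n" for \<sigma> \<tau> t
  proof -
    have "act n \<tau> (act n \<sigma> t) =
        (\<Sum>w\<in>words n. act n \<tau> (fscale (cf t w * sgn w \<sigma>) (tensor scale (permute_list \<sigma> w))))"
      unfolding act_expansion[OF \<sigma> t] using \<sigma> \<tau>
      by (intro act_sum) (auto intro!: fun_vs.subspace_scale[OF subspace_TP] tensor_in permute_words)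
    also have "\<dots> = (\<Sum>w\<in>words n. fscale (cf t w * sgn w (\<sigma> \<circ> \<tau>)) (tensor scale (permute_list (\<sigma> \<circ> \<tau>) w)))"
    proof (intro sum.cong refl)
      fix w assume w: "w \<in> words n"
      then have len: "length w = n" by (simp add: words_def)
      have pw: "permute_list \<sigma> w \<in> words n" using \<sigma> w by (rule permute_words)
      show "act n \<tau> (fscale (cf t w * sgn w \<sigma>) (tensor scale (permute_list \<sigma> w))) =
          fscale (cf t w * sgn w (\<sigma> \<circ> \<tau>)) (tensor scale (permute_list (\<sigma> \<circ> \<tau>) w))"
        using \<sigma> \<tau> pw len
        by (simp add: act_linear(2)[OF \<tau> tensor_in[OF pw]] act_tensor[OF \<tau> pw] permute_list_compose sgn_comp mult.assoc)
    qed
    also have "\<dots> = act n (\<sigma> \<circ> \<tau>) t" using act_expansion[OF permutes_compose[OF \<tau> \<sigma>] t] by simp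
    finally show ?thesis by simp
  qed
qed

lemma cf_act:
  assumes \<sigma>: "\<sigma> permutes {..<n}" and t: "t \<in> TP n" and w: "w \<in> words n"
  shows "cf (act n \<sigma> t) (permute_list \<sigma> w) = sgn w \<sigma> * cf t w"
proof -
  have eq: "permute_list \<sigma> w' = permute_list \<sigma> w \<longleftrightarrow> w' = w" if "w' \<in> words n" for w'
    using permute_list_inv(1)[OF \<sigma>] that w by (metis (mono_tags, lifting) mem_Collect_eq words_def)
  have "cf (act n \<sigma> t) (permute_list \<sigma> w) =
      (\<Sum>w'\<in>words n. cf t w' * sgn w' \<sigma> * cf (tensor scale (permute_list \<sigma> w')) (permute_list \<sigma> w))"
    unfolding act_expansion[OF \<sigma> t] by (simp add: cf_sum cf_scale)
  also have "\<dots> = (\<Sum>w'\<in>words n. if w' = w then cf t w * sgn w \<sigma> else 0)"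
    using \<sigma> w by (intro sum.cong refl) (simp add: cf_tensor[OF permute_words permute_words] eq)
  also have "\<dots> = sgn w \<sigma> * cf t w" using w finite_words by (simp add: mult.commute)
  finally show ?thesis .
qed

text \<open>Used to transfer the vanishing of a coefficient, for which it suffices that the factor
  is nonzero.\<close>

lemma cf_act_transpose:
  assumes "i < n" "j < n" "t \<in> TP n" "w \<in> words n"
  obtains e where "e \<noteq> 0" "cf (act n (transpose i j) t) w = e * cf t (permute_list (transpose i j) w)"
proof -
  have p: "transpose i j permutes {..<n}" using assms by (simp add: permutes_swap_id)
  have len: "length w = n" using assms by (simp add: words_def)
  have "permute_list (transpose i j) (permute_list (transpose i j) w) = w"
    using p len permute_list_inv(1)[OF p len] by simp
  then have "cf (act n (transpose i j) t) w =
      sgn (permute_list (transpose i j) w) (transpose i j) * cf t (permute_list (transpose i j) w)"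
    using cf_act[OF p assms(3) permute_words[OF p assms(4)]] by simp
  then show thesis using that sgn_nonzero by blast
qed

text \<open>Exchanging two equal letters fixes the word, with sign -1 if the letter is odd. So in
  positions where a tensor is symmetric an odd letter cannot repeat, and where it is antisymmetric
  an even letter cannot: the coefficient is its own negative.\<close>

lemma cf_equal_letters:
  assumes ij: "i < n" "j < n" "i \<noteq> j" and t: "t \<in> TP n" and w: "w \<in> words n" and eq: "w ! i = w ! j"
    and act: "act n (transpose i j) t = (if w ! i \<in> B1 then t else - t)"
  shows "cf t w = 0"
proof -
  have p: "transpose i j permutes {..<n}" using ij by (simp add: permutes_swap_id)
  have len: "length w = n" using w by (simp add: words_def)
  have "permute_list (transpose i j) w = w"
    using p len eq by (intro nth_equalityI) (auto simp: permute_list_nth transpose_def)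
  moreover have "sgn w (transpose i j) = (if w ! i \<in> B1 then -1 else 1)"
  proof (cases "i < j")
    case True
    then show ?thesis
      using odd_inversions_transpose[of i j n "\<lambda>i. w ! i \<in> B1"] ij eq len by (simp add: sgn_def)
  next
    case False
    then have "j < i" using ij by simp
    then show ?thesis
      using odd_inversions_transpose[of j i n "\<lambda>i. w ! i \<in> B1"] ij eq len
      by (simp add: sgn_def transpose_commute)
  qed
  ultimately have "cf (if w ! i \<in> B1 then t else - t) w = (if w ! i \<in> B1 then -1 else 1) * cf t w"
    using cf_act[OF p t w] act by simp
  then have "cf t w = - cf t w" by (auto simp: cf_neg split: if_splits)
  then have "cf t w + cf t w = 0" by (metis add.right_inverse)
  then have "2 * cf t w = 0" by (simp only: mult_2)
  then show ?thesis by simp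
qed

end

section \<open>Relations along columns in the image of a Young symmetrizer\<close>

context sym_action
begin

text \<open>The twist exchanges symmetric and antisymmetric vectors, so \<open>alt\<close> becomes
  plain symmetrization and \<open>alt_nonzero\<close> can be used with columns in the role of
  rows.\<close>

lemma twist: "sym_action n T (\<lambda>\<sigma> t. fscale (of_int (sign \<sigma>)) (act \<sigma> t))"
proof
  show "fscale (of_int (sign (\<sigma> \<circ> \<tau>))) (act (\<sigma> \<circ> \<tau>) t) =
      fscale (of_int (sign \<tau>)) (act \<tau> (fscale (of_int (sign \<sigma>)) (act \<sigma> t)))"
    if "\<sigma> permutes {..<n}" "\<tau> permutes {..<n}" "t \<in> T" for \<sigma> \<tau> t
  proof -
    have "sign (\<sigma> \<circ> \<tau>) = sign \<sigma> * sign \<tau>"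
      using that by (intro sign_compose) (auto intro: permutation_psize)
    then show ?thesis using that by (simp add: act_scale act_closed act_comp mult.commute)
  qed
qed (auto simp: subspace_T act_closed scale_T act_add act_scale act_id fun_vs.scale_right_distrib
    mult.commute)

text \<open>The relations of \<open>garnir\<close> for the action twisted by the sign.\<close>

definition column_relations :: "(nat \<Rightarrow> nat) \<Rightarrow> nat set \<Rightarrow> ('x \<Rightarrow> 'f) \<Rightarrow> bool" where
  "column_relations col P v \<longleftrightarrow> v \<in> T \<and>
     (\<forall>s\<in>P. \<forall>t\<in>P. s \<noteq> t \<and> col s = col t \<longrightarrow> act (transpose s t) v = - v) \<and>
     (\<forall>s\<in>P. \<forall>c<col s. (\<Sum>t | t \<in> P \<and> col t = c. act (transpose t s) v) = v)"

text \<open>These are \<open>alt_nonzero\<close> and \<open>act_transpose_alt\<close> for the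
  twisted action.\<close>

lemma column_relations_symmetrize:
  assumes r: "column_relations col P v" and "v \<noteq> 0" and P: "P \<subseteq> {..<n}" and S: "S \<subseteq> P" "inj_on col S"
  shows "(\<Sum>q | q permutes S. act q v) \<noteq> 0"
    and "\<And>s t. s \<in> S \<Longrightarrow> t \<in> S \<Longrightarrow>
      act (transpose s t) (\<Sum>q | q permutes S. act q v) = (\<Sum>q | q permutes S. act q v)"
proof -
  let ?a = "\<lambda>\<sigma> t. fscale (of_int (sign \<sigma>)) (act \<sigma> t)"
  interpret tw: sym_action n T ?a by (rule twist)
  have vT: "v \<in> T" using r by (simp add: column_relations_def)
  have Sn: "S \<subseteq> {..<n}" using S P by auto
  have alt: "tw.alt S v = (\<Sum>q | q permutes S. act q v)"
    by (simp add: tw.alt_def of_int_mult[symmetric] del: of_int_mult)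
  have "tw.garnir col P v"
    unfolding tw.garnir_def
  proof (intro conjI ballI impI allI)
    fix s t assume "s \<in> P" "t \<in> P" "col s = col t"
    then show "?a (transpose s t) v = v"
      using r act_id[OF vT] by (cases "s = t") (auto simp: column_relations_def sign_swap_id id_def)
  next
    fix s c assume sc: "s \<in> P" "c < col s"
    then have "(\<Sum>t | t \<in> P \<and> col t = c. ?a (transpose t s) v) =
        (\<Sum>t | t \<in> P \<and> col t = c. - act (transpose t s) v)"
      by (intro sum.cong) (auto simp: sign_swap_id)
    also have "\<dots> = - v"
      using r sc unfolding sum_negf column_relations_def by auto
    finally show "v + (\<Sum>t | t \<in> P \<and> col t = c. ?a (transpose t s) v) = 0" by simp
  qed (rule vT)
  then show "(\<Sum>q | q permutes S. act q v) \<noteq> 0"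
    using tw.alt_nonzero[of col P v S] assms by (simp add: alt)
  fix s t assume st: "s \<in> S" "t \<in> S"
  have z: "(\<Sum>q | q permutes S. act q v) \<in> T" using tw.alt_T[OF vT Sn] by (simp add: alt)
  show "act (transpose s t) (\<Sum>q | q permutes S. act q v) = (\<Sum>q | q permutes S. act q v)"
    using tw.act_transpose_alt(1)[OF vT Sn st] act_id[OF z]
    by (cases "s = t") (auto simp: alt sign_swap_id id_def)
qed

lemma young_T: "v \<in> T \<Longrightarrow> psize \<nu> = n \<Longrightarrow> young \<nu> id v \<in> T"
  using mult_young_symmetrizer[of v \<nu>] mult_T[of v "young_symmetrizer \<nu>"] by simp

lemma alt_antisymmetric:
  assumes y: "y \<in> T" and K: "K \<subseteq> {..<n}"
    and anti: "\<And>s t. s \<in> K \<Longrightarrow> t \<in> K \<Longrightarrow> s \<noteq> t \<Longrightarrow> act (transpose s t) y = - y"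
  shows "alt K y = fscale (of_nat (fact (card K))) y"
proof -
  have fin: "finite K" using K finite_subset by blast
  have "fscale (of_int (sign q)) (act q y) = y" if "q permutes K" for q
    using that fin
  proof (induction q rule: permutes_induct)
    case id
    show ?case by (simp only: sign_id of_int_1 fun_vs.scale_one act_id[OF y])
  next
    case (swap a b p)
    have pn: "p permutes {..<n}" using swap K by (auto intro: permutes_subset)
    have "act (transpose a b \<circ> p) y = act p (- y)"
      using swap pn y K by (subst act_comp) (auto intro: transpose_n simp: anti)
    moreover have "sign (transpose a b \<circ> p) = - sign p"
      using swap pn by (simp add: sign_compose permutation_psize permutation_swap_id sign_swap_id)
    ultimately have "fscale (of_int (sign (transpose a b \<circ> p))) (act (transpose a b \<circ> p) y) =
        fscale (of_int (sign p)) (act p y)"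
      using pn y by (simp only: act_neg) simp
    then show ?case using swap.IH by (simp only:)
  qed
  then have "alt K y = (\<Sum>q | q permutes K. y)"
    unfolding alt_def by (intro sum.cong) auto
  then show ?thesis using fin by (simp only: fun_vs.sum_constant_scale card_permutations[OF refl fin])
qed

text \<open>By \<open>alt_insert\<close> the relation says that antisymmetrizing column c together
  with an entry s of a later column gives 0. Write v a b as a signed sum of u q, where u = v a is
  symmetric along rows. The row of q s has a box m in column c, and u q is symmetric in s and the
  preimage t of m; both lie in the antisymmetrized set.\<close>

lemma young_column_relations:
  assumes \<nu>: "\<nu> \<in> partitions" "psize \<nu> = n" and v: "v \<in> T"
  shows "column_relations (col_of \<nu>) {..<n} (young \<nu> id v)"
proof -
  let ?R = "row_stabilizer \<nu>" and ?C = "col_stabilizer \<nu>"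
  have R: "p permutes {..<n}" if "p \<in> ?R" for p using that stabilizer_permutes \<nu>(2) by metis
  have C: "q permutes {..<n}" if "q \<in> ?C" for q using that stabilizer_permutes \<nu>(2) by metis
  define u where "u = (\<Sum>p\<in>?R. act p v)"
  have u: "u \<in> T" unfolding u_def using v R by (auto intro!: sum_T act_closed)
  have yT: "young \<nu> id v \<in> T" using v \<nu>(2) by (rule young_T)
  have y: "young \<nu> id v = (\<Sum>q\<in>?C. fscale (of_int (sign q)) (act q u))"
  proof -
    have "young \<nu> id v = (\<Sum>q\<in>?C. \<Sum>p\<in>?R. fscale (of_int (sign q)) (act (p \<circ> id \<circ> q) v))"
      unfolding young_def by (rule sum.swap)
    also have "\<dots> = (\<Sum>q\<in>?C. fscale (of_int (sign q)) (act q u))"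
      unfolding u_def using R C v
      by (intro sum.cong refl) (subst act_sum, auto simp: act_comp act_closed fun_vs.scale_sum_right)
    finally show ?thesis .
  qed
  have u_sym: "act (transpose s t) u = u" if st: "s < n" "t < n" "row_of \<nu> s = row_of \<nu> t" for s t
  proof -
    have tr: "transpose s t \<in> ?R" using st \<nu>(2) by (intro stabilizer_transpose) auto
    have "act (transpose s t) u = (\<Sum>p\<in>?R. act (p \<circ> transpose s t) v)"
      unfolding u_def using R[OF tr] R v
      by (subst act_sum) (auto simp: act_comp act_closed)
    also have "\<dots> = u"
      unfolding u_def
      by (rule sum.reindex_bij_witness[of _ "\<lambda>p. p \<circ> transpose s t" "\<lambda>p. p \<circ> transpose s t"])
        (auto simp: comp_assoc stabilizer_comp tr)
    finally show ?thesis .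
  qed
  have anti: "act (transpose s t) (young \<nu> id v) = - young \<nu> id v"
    if st: "s < n" "t < n" "s \<noteq> t" "col_of \<nu> s = col_of \<nu> t" for s t
  proof -
    have tr: "transpose s t \<in> ?C" using st \<nu>(2) by (intro stabilizer_transpose) auto
    have sg: "sign (q \<circ> transpose s t) = - sign q" if "q \<in> ?C" for q
      using C[OF that] st(3) by (simp add: sign_compose permutation_psize permutation_swap_id sign_swap_id)
    have "act (transpose s t) (young \<nu> id v) = (\<Sum>q\<in>?C. fscale (of_int (sign q)) (act (q \<circ> transpose s t) u))"
      unfolding y using C[OF tr] C u
      by (subst act_sum) (auto simp: act_comp act_closed act_scale scale_T)
    also have "\<dots> = (\<Sum>q\<in>?C. - fscale (of_int (sign q)) (act q u))"
      by (rule sum.reindex_bij_witness[of _ "\<lambda>p. p \<circ> transpose s t" "\<lambda>p. p \<circ> transpose s t"])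
        (auto simp: comp_assoc stabilizer_comp tr sg)
    also have "\<dots> = - young \<nu> id v" by (simp add: y sum_negf)
    finally show ?thesis .
  qed
  have "(\<Sum>t | t \<in> {..<n} \<and> col_of \<nu> t = c. act (transpose t s) (young \<nu> id v)) = young \<nu> id v"
    if s: "s < n" and c: "c < col_of \<nu> s" for s c
  proof -
    let ?K = "{t. t \<in> {..<n} \<and> col_of \<nu> t = c}"
    have K: "?K \<subseteq> {..<n}" "finite ?K" "s \<notin> ?K" using c by auto
    have altK: "alt ?K (young \<nu> id v) = fscale (of_nat (fact (card ?K))) (young \<nu> id v)"
      using anti yT K by (intro alt_antisymmetric) auto
    have "alt (insert s ?K) (young \<nu> id v) = 0"
    proof -
      have A: "insert s ?K \<subseteq> {..<n}" using s by auto
      have zero: "alt (insert s ?K) (act q u) = 0" if q: "q \<in> ?C" for q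
      proof -
        have qn: "q permutes {..<n}" using q by (rule C)
        have qs: "q s < n" "col_of \<nu> (q s) = col_of \<nu> s"
          using q s qn \<nu>(2) by (auto simp: col_stabilizer_def dest: permutes_in_image[of q _ s])
        have "c < \<nu> (row_of \<nu> (q s))"
          using box_position(2)[OF \<nu>(1), of "q s"] qs c \<nu>(2) by simp
        then obtain m where m: "m < n" "row_of \<nu> m = row_of \<nu> (q s)" "col_of \<nu> m = c"
          using box_exists[OF \<nu>(1)] \<nu>(2) by metis
        define t where "t = inv q m"
        have t: "q t = m" "t < n" "col_of \<nu> t = c"
        proof -
          show "q t = m" using qn by (simp add: t_def permutes_inverses)
          show "t < n" using m(1) permutes_in_image[OF permutes_inv[OF qn], of m] by (simp add: t_def)
          then show "col_of \<nu> t = c"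
            using q \<nu>(2) m(3) \<open>q t = m\<close> by (auto simp: col_stabilizer_def)
        qed
        have "q \<circ> transpose s t = transpose (q s) (q t) \<circ> q"
          using qn by (simp add: transpose_comp_eq permutes_bij permutes_inverses)
        then have "act (transpose s t) (act q u) = act q (act (transpose (q s) (q t)) u)"
          using s t qs m qn u by (metis act_comp transpose_n)
        moreover have "act (transpose (q s) (q t)) u = u"
          using qs t m by (intro u_sym) auto
        ultimately have eq: "act (transpose s t) (act q u) = act q u" by simp
        have "s \<noteq> t" using t(3) c by auto
        then have 1: "alt (insert s ?K) (act (transpose s t) (act q u)) = - alt (insert s ?K) (act q u)"
          using t qn u A by (intro act_transpose_alt(2)) (auto intro: act_closed)
        show ?thesis by (rule fun_double_zero) (rule 1[unfolded eq])
      qed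
      have sc: "alt (insert s ?K) (fscale x w) = fscale x (alt (insert s ?K) w)" if "w \<in> T" for x w
        unfolding alt_def fun_vs.scale_sum_right using A that
        by (intro sum.cong refl) (simp add: act_scale permutes_n mult.commute)
      have "alt (insert s ?K) (fscale (of_int (sign q)) (act q u)) = 0" if "q \<in> ?C" for q
        using sc[OF act_closed[OF C[OF that] u]] zero[OF that] by simp
      then have "(\<Sum>q\<in>?C. alt (insert s ?K) (fscale (of_int (sign q)) (act q u))) = 0"
        by (rule sum.neutral[OF ballI])
      moreover have "alt (insert s ?K) (young \<nu> id v) =
          (\<Sum>q\<in>?C. alt (insert s ?K) (fscale (of_int (sign q)) (act q u)))"
        unfolding y using C u A by (intro alt_sum) (auto intro!: scale_T act_closed)
      ultimately show ?thesis by (rule trans[rotated])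
    qed
    \<comment> \<open>Column c is already antisymmetric, so \<open>alt ?K\<close> only multiplies by
      a factorial, which cancels.\<close>
    then have "fscale (of_nat (fact (card ?K))) (young \<nu> id v) =
        (\<Sum>t\<in>?K. act (transpose s t) (fscale (of_nat (fact (card ?K))) (young \<nu> id v)))"
      using alt_insert[OF yT K(1,3) s] altK by simp
    also have "\<dots> = fscale (of_nat (fact (card ?K))) (\<Sum>t\<in>?K. act (transpose t s) (young \<nu> id v))"
      unfolding fun_vs.scale_sum_right using s yT
      by (intro sum.cong refl) (simp add: act_scale transpose_n transpose_commute)
    finally show ?thesis by (simp del: of_nat_fact)
  qed
  then show ?thesis
    unfolding column_relations_def using yT anti by auto
qed

end

section \<open>Column relations on words with few letters\<close>

context super_tensor
begin

abbreviation "support t n \<equiv> {w \<in> words n. cf t w \<noteq> 0}"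

text \<open>If \<open>Q\<close> admits the words with letters in \<open>U0 \<union> U1\<close>, this
  is the degree n part of the projection from T(V) to T(U).\<close>

definition component :: "nat \<Rightarrow> ('v list \<Rightarrow> bool) \<Rightarrow> (('v \<Rightarrow> 'f) list \<Rightarrow> 'f) \<Rightarrow> ('v \<Rightarrow> 'f) list \<Rightarrow> 'f" where
  "component n Q t = (\<Sum>w | w \<in> words n \<and> Q w. fscale (cf t w) (tensor scale w))"

lemma component_in: "component n Q t \<in> TP n"
  unfolding component_def
  by (auto intro!: fun_vs.subspace_sum[OF subspace_TP] fun_vs.subspace_scale[OF subspace_TP] tensor_in)

lemma cf_component: "w \<in> words n \<Longrightarrow> cf (component n Q t) w = (if Q w then cf t w else 0)"
proof -
  assume w: "w \<in> words n"
  have "cf (component n Q t) w = (\<Sum>w' | w' \<in> words n \<and> Q w'. if w' = w then cf t w' else 0)"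
    unfolding component_def cf_sum cf_scale using w
    by (intro sum.cong refl) (auto simp: cf_tensor)
  also have "\<dots> = (if Q w then cf t w else 0)" using w finite_words[of n] by (simp add: sum.delta)
  finally show ?thesis .
qed

lemma cf_eqI: "s \<in> TP n \<Longrightarrow> t \<in> TP n \<Longrightarrow> (\<And>w. w \<in> words n \<Longrightarrow> cf s w = cf t w) \<Longrightarrow> s = t"
  using cf_eq_zero[of "s - t" n] fun_vs.subspace_diff[OF subspace_TP] by (simp add: cf_def)

lemma component_act:
  assumes \<sigma>: "\<sigma> permutes {..<n}" and t: "t \<in> TP n"
    and Q: "\<And>w. w \<in> words n \<Longrightarrow> Q (permute_list \<sigma> w) \<longleftrightarrow> Q w"
  shows "act n \<sigma> (component n Q t) = component n Q (act n \<sigma> t)"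
proof (rule cf_eqI[of _ n])
  fix w assume w: "w \<in> words n"
  define w' where "w' = permute_list (inv \<sigma>) w"
  have w': "w' \<in> words n" unfolding w'_def using permutes_inv[OF \<sigma>] w by (rule permute_words)
  have ww: "permute_list \<sigma> w' = w" using permute_list_inv(2)[OF \<sigma>, of w] w by (simp add: w'_def words_def)
  show "cf (act n \<sigma> (component n Q t)) w = cf (component n Q (act n \<sigma> t)) w"
    using cf_act[OF \<sigma> t w'] cf_act[OF \<sigma> component_in[of n Q t] w'] Q[OF w'] w w'
    by (simp add: ww cf_component)
qed (use \<sigma> t in \<open>auto intro: act_in component_in\<close>)

text \<open>The even letter \<open>x\<close> occurs at most once in each column. Restricting to the words in which it
  occupies the positions \<open>X\<close>, with \<open>X\<close> as far to the right as possible, preserves the relations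
  among the other positions: the words that contribute an error term have \<open>x\<close> further right.\<close>

lemma remove_letter:
  assumes x: "x \<in> B0" and t0: "t \<noteq> 0" and P: "P \<subseteq> {..<n}" and r: "tp.column_relations n col P t"
  shows "\<exists>P' t'. P' \<subseteq> P \<and> t' \<noteq> 0 \<and> tp.column_relations n col P' t' \<and>
    inj_on col (P - P') \<and> support t' n \<subseteq> support t n \<and> (\<forall>w\<in>support t' n. \<forall>m\<in>P'. w ! m \<noteq> x)"
proof -
  have t: "t \<in> TP n" using r by (simp add: tp.column_relations_def)
  have anti: "\<And>s s'. s \<in> P \<Longrightarrow> s' \<in> P \<Longrightarrow> s \<noteq> s' \<Longrightarrow> col s = col s' \<Longrightarrow> act n (transpose s s') t = - t"
    and rel: "\<And>s c. s \<in> P \<Longrightarrow> c < col s \<Longrightarrow> (\<Sum>s' | s' \<in> P \<and> col s' = c. act n (transpose s' s) t) = t"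
    using r by (auto simp: tp.column_relations_def)
  have finP: "finite P" using P finite_subset by blast
  define pos where "pos w = {m \<in> P. w ! m = x}" for w
  have posP: "pos w \<subseteq> P" for w by (auto simp: pos_def)
  obtain w0 where w0: "w0 \<in> support t n" using cf_eq_zero[OF t] t0 by blast
  \<comment> \<open>Measures how far to the right the letter x stands.\<close>
  define f where "f w = (\<Sum>m\<in>pos w. col m)" for w
  obtain w1 where w1: "w1 \<in> support t n" and max: "\<And>w. w \<in> support t n \<Longrightarrow> f w \<le> f w1"
  proof -
    have fin: "finite (f ` support t n)" using finite_words[of n] by simp
    then have "Max (f ` support t n) \<in> f ` support t n" using w0 by (intro Max_in) auto
    then obtain w1 where "w1 \<in> support t n" "Max (f ` support t n) = f w1" by blast
    then show thesis using that[of w1] Max_ge[OF fin] by force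
  qed
  define X where "X = pos w1"
  define t' where "t' = component n (\<lambda>w. pos w = X) t"
  have cft': "cf t' w = (if pos w = X then cf t w else 0)" if "w \<in> words n" for w
    unfolding t'_def using that by (rule cf_component)
  have supp: "w \<in> support t' n \<longleftrightarrow> w \<in> support t n \<and> pos w = X" for w
    using cft'[of w] by (auto split: if_splits)
  have XP: "X \<subseteq> P" unfolding X_def by (rule posP)
  have comm: "act n (transpose s s') t' = component n (\<lambda>w. pos w = X) (act n (transpose s s') t)"
    if ss: "s \<in> P - X" "s' \<in> P - X" for s s'
  proof -
    have tr: "transpose s s' permutes {..<n}" using ss P by (auto intro!: permutes_swap_id)
    have "pos (permute_list (transpose s s') w) = X \<longleftrightarrow> pos w = X" if w: "w \<in> words n" for w
    proof -
      have len: "length w = n" using w by (simp add: words_def)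
      have "pos (permute_list (transpose s s') w) = transpose s s' ` pos w"
      proof -
        have "m \<in> pos (permute_list (transpose s s') w) \<longleftrightarrow> transpose s s' m \<in> pos w" for m
        proof -
          have "m \<in> P \<longleftrightarrow> transpose s s' m \<in> P" using ss by (auto simp: transpose_def)
          then show ?thesis
            using P len tr by (auto simp: pos_def permute_list_nth subset_iff)
        qed
        then show ?thesis by (intro set_eqI) (simp only: in_transpose_image_iff)
      qed
      moreover have "transpose s s' ` X = X"
      proof -
        have "transpose s s' m = m" if "m \<in> X" for m using that ss by (auto simp: transpose_def)
        then show ?thesis by force
      qed
      ultimately show ?thesis by (metis inj_image_eq_iff inj_transpose)
    qed
    then show ?thesis unfolding t'_def using tr t by (intro component_act) auto
  qed
  have neg: "component n Q (- y) = - component n Q y" for Q y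
    by (simp add: component_def cf_neg sum_negf)
  have csum: "component n Q (sum g A) = (\<Sum>a\<in>A. component n Q (g a))" for Q A and g :: "nat \<Rightarrow> _"
  proof -
    have "component n Q (sum g A) = (\<Sum>w | w \<in> words n \<and> Q w. \<Sum>a\<in>A. fscale (cf (g a) w) (tensor scale w))"
      by (simp add: component_def cf_sum fun_vs.scale_sum_left)
    also have "\<dots> = (\<Sum>a\<in>A. component n Q (g a))" unfolding component_def by (rule sum.swap)
    finally show ?thesis .
  qed
  have "tp.column_relations n col (P - X) t'"
    unfolding tp.column_relations_def
  proof (intro conjI ballI impI allI)
    show "t' \<in> TP n" unfolding t'_def by (rule component_in)
    fix s s' assume "s \<in> P - X" "s' \<in> P - X" "s \<noteq> s' \<and> col s = col s'"
    then show "act n (transpose s s') t' = - t'" by (simp add: comm anti neg) (simp add: t'_def)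
  next
    fix s c assume s: "s \<in> P - X" and c: "c < col s"
    have sn: "s < n" using s P by auto
    let ?K = "{s' \<in> P. col s' = c}"
    have zero: "component n (\<lambda>w. pos w = X) (act n (transpose y s) t) = 0" if y: "y \<in> X" "col y = c" for y
    proof (rule cf_eq_zero[of _ n])
      fix w assume w: "w \<in> words n"
      have yn: "y < n" using y XP P by auto
      have tr: "transpose y s permutes {..<n}" using yn sn by (intro permutes_swap_id) auto
      show "cf (component n (\<lambda>w. pos w = X) (act n (transpose y s) t)) w = 0"
      proof (cases "pos w = X")
        case True
        let ?w = "permute_list (transpose y s) w"
        have len: "length w = n" using w by (simp add: words_def)
        have wy: "w ! y = x" "w ! s \<noteq> x" using True y s by (auto simp: pos_def)
        have "pos ?w = insert s (X - {y})"
        proof (intro set_eqI)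
          fix m
          have "m \<in> P \<Longrightarrow> ?w ! m = w ! transpose y s m"
            using len tr P by (auto simp: permute_list_nth)
          then show "m \<in> pos ?w \<longleftrightarrow> m \<in> insert s (X - {y})"
            using True wy s y XP by (auto simp: pos_def transpose_def)
        qed
        then have "f ?w = col s + (\<Sum>m\<in>X - {y}. col m)"
          using s finite_subset[OF XP finP] by (simp add: f_def)
        moreover have "f w1 = col y + (\<Sum>m\<in>X - {y}. col m)"
          unfolding f_def X_def[symmetric] using y finite_subset[OF XP finP] by (simp add: sum.remove)
        ultimately have "f w1 < f ?w" using c y by simp
        then have "cf t ?w = 0" using max[of ?w] permute_words[OF tr w] by fastforce
        then have "cf (act n (transpose y s) t) w = 0"
          using cf_act_transpose[OF yn sn t w] by (metis mult_zero_right)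
        then show ?thesis using w by (simp add: cf_component)
      qed (use w in \<open>simp add: cf_component\<close>)
    qed (rule component_in)
    have "t' = component n (\<lambda>w. pos w = X) (\<Sum>s'\<in>?K. act n (transpose s' s) t)"
      using rel[of s c] s c by (simp add: t'_def)
    also have "\<dots> = (\<Sum>s'\<in>?K. component n (\<lambda>w. pos w = X) (act n (transpose s' s) t))"
      by (rule csum)
    also have "\<dots> = (\<Sum>s' | s' \<in> P - X \<and> col s' = c. component n (\<lambda>w. pos w = X) (act n (transpose s' s) t))"
      using finP zero by (intro sum.mono_neutral_right) auto
    also have "\<dots> = (\<Sum>s' | s' \<in> P - X \<and> col s' = c. act n (transpose s' s) t')"
      using s by (intro sum.cong refl) (simp add: comm)
    finally show "(\<Sum>s' | s' \<in> P - X \<and> col s' = c. act n (transpose s' s) t') = t'" by simp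
  qed
  \<comment> \<open>Two positions of X in one column would both hold the even letter x in
    \<open>w1\<close>, against the antisymmetry along columns.\<close>
  moreover have "inj_on col (P - (P - X))"
  proof (rule inj_onI, rule ccontr)
    fix i j assume ij: "i \<in> P - (P - X)" "j \<in> P - (P - X)" "col i = col j" "i \<noteq> j"
    then have X: "i \<in> X" "j \<in> X" by auto
    have ijP: "i \<in> P" "j \<in> P" "i < n" "j < n" using ij P by auto
    have "w1 ! i = x" "w1 ! j = x" using X by (auto simp: X_def pos_def)
    moreover have "x \<notin> B1" using x disjoint by auto
    ultimately have "cf t w1 = 0"
      using w1 ijP ij anti[of i j] by (intro cf_equal_letters[OF ijP(3,4) ij(4) t]) auto
    then show False using w1 by simp
  qed
  moreover have "t' \<noteq> 0" using supp[of w1] w1 by (auto simp: X_def cf_zero)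
  moreover have "support t' n \<subseteq> support t n" using supp by blast
  moreover have "w ! m \<noteq> x" if "w \<in> support t' n" "m \<in> P - X" for w m
    using that supp by (auto simp: pos_def)
  ultimately show ?thesis by (intro exI[of _ "P - X"] exI[of _ t'] conjI ballI) auto
qed

text \<open>Positions deleted for one letter lie in different columns, so each letter costs a column
  at most one position; a column with more than \<open>card E\<close> positions keeps one.\<close>

lemma remove_letters:
  assumes "finite E" "E \<subseteq> B0" and t0: "t \<noteq> 0" and P: "P \<subseteq> {..<n}" and r: "tp.column_relations n col P t"
  shows "\<exists>P' t'. P' \<subseteq> P \<and> t' \<noteq> 0 \<and> tp.column_relations n col P' t' \<and>
    (\<forall>c. card {m \<in> P. col m = c} \<le> card {m \<in> P'. col m = c} + card E) \<and>
    support t' n \<subseteq> support t n \<and> (\<forall>w\<in>support t' n. \<forall>m\<in>P'. w ! m \<notin> E)"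
  using assms(1,2)
proof (induction E rule: finite_induct)
  case empty
  show ?case by (rule exI[of _ P], rule exI[of _ t]) (use t0 r in simp)
next
  case (insert x E)
  then obtain P1 t1 where 1: "P1 \<subseteq> P" "t1 \<noteq> 0" "tp.column_relations n col P1 t1"
    "\<And>c. card {m \<in> P. col m = c} \<le> card {m \<in> P1. col m = c} + card E"
    "support t1 n \<subseteq> support t n" "\<And>w m. w \<in> support t1 n \<Longrightarrow> m \<in> P1 \<Longrightarrow> w ! m \<notin> E"
    by auto
  have P1: "P1 \<subseteq> {..<n}" using 1(1) P by auto
  have x: "x \<in> B0" using insert.prems by simp
  obtain P2 t2 where 2: "P2 \<subseteq> P1" "t2 \<noteq> 0" "tp.column_relations n col P2 t2"
    "inj_on col (P1 - P2)" "support t2 n \<subseteq> support t1 n"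
    "\<And>w m. w \<in> support t2 n \<Longrightarrow> m \<in> P2 \<Longrightarrow> w ! m \<noteq> x"
    using remove_letter[OF x 1(2) P1 1(3)] by auto
  have loss: "card {m \<in> P1. col m = c} \<le> card {m \<in> P2. col m = c} + 1" for c
  proof -
    have "{m \<in> P1. col m = c} = {m \<in> P2. col m = c} \<union> {m \<in> P1 - P2. col m = c}" using 2(1) by auto
    then have "card {m \<in> P1. col m = c} \<le> card {m \<in> P2. col m = c} + card {m \<in> P1 - P2. col m = c}"
      by (simp only: card_Un_le)
    moreover have "card {m \<in> P1 - P2. col m = c} \<le> card {c}"
      using 2(4) by (intro card_inj_on_le[of col]) (auto simp: inj_on_def)
    ultimately show ?thesis by simp
  qed
  show ?case
  proof (rule exI[of _ P2], rule exI[of _ t2], intro conjI allI ballI)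
    show "card {m \<in> P. col m = c} \<le> card {m \<in> P2. col m = c} + card (insert x E)" for c
      using 1(4)[of c] loss[of c] insert.hyps by simp
    show "w ! m \<notin> insert x E" if "w \<in> support t2 n" "m \<in> P2" for w m
      using 1(6)[of w m] 2(1,5) 2(6)[of w m] that by blast
  qed (use 1 2 in auto)
qed

text \<open>Once all even letters are removed, one can still symmetrize over \<open>card U1 + 1\<close> positions; two of
  them carry the same odd letter.\<close>

lemma column_relations_zero:
  assumes U0: "U0 \<subseteq> B0" and U1: "U1 \<subseteq> B1"
    and r: "tp.column_relations n col {..<n} t"
    and supp: "\<And>w. w \<in> support t n \<Longrightarrow> set w \<subseteq> U0 \<union> U1"
    and len: "\<And>c. c \<le> card U1 \<Longrightarrow> card U0 < card {m \<in> {..<n}. col m = c}"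
  shows "t = 0"
proof (rule ccontr)
  assume t0: "t \<noteq> 0"
  have fin: "finite U0" "finite U1" using U0 U1 B0(1) B1(1) finite_subset by blast+
  obtain P z where P: "P \<subseteq> {..<n}" "z \<noteq> 0" "tp.column_relations n col P z"
    "\<And>c. card {m \<in> {..<n}. col m = c} \<le> card {m \<in> P. col m = c} + card U0"
    "support z n \<subseteq> support t n" "\<And>w m. w \<in> support z n \<Longrightarrow> m \<in> P \<Longrightarrow> w ! m \<notin> U0"
    using remove_letters[OF fin(1) U0 t0 subset_refl r] by auto
  have zT: "z \<in> TP n" using P(3) by (simp add: tp.column_relations_def)
  have "\<exists>m\<in>P. col m = c" if "c \<le> card U1" for c
  proof -
    have "card {m \<in> P. col m = c} \<noteq> 0" using len[OF that] P(4)[of c] by simp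
    then show ?thesis by (auto simp: card_eq_0_iff)
  qed
  \<comment> \<open>One surviving position in each of the columns 0, ..., card U1: one more than
    there are letters in U1.\<close>
  then obtain d where d: "\<And>c. c \<le> card U1 \<Longrightarrow> d c \<in> P \<and> col (d c) = c" by metis
  define S where "S = d ` {..card U1}"
  have S: "S \<subseteq> P" "inj_on col S" using d by (auto simp: S_def inj_on_def)
  have Sn: "S \<subseteq> {..<n}" using S P by auto
  have "inj_on d {..card U1}" using d by (metis atMost_iff inj_onI)
  then have cardS: "card S = Suc (card U1)" by (simp add: S_def card_image)
  define y where "y = (\<Sum>q | q permutes S. act n q z)"
  have y0: "y \<noteq> 0" and ysym: "\<And>i j. i \<in> S \<Longrightarrow> j \<in> S \<Longrightarrow> act n (transpose i j) y = y"
    using tp.column_relations_symmetrize[OF P(3,2,1) S] by (simp_all add: y_def)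
  have yT: "y \<in> TP n"
    unfolding y_def using zT Sn
    by (auto intro!: fun_vs.subspace_sum[OF subspace_TP] act_in intro: permutes_subset)
  obtain w where w: "w \<in> words n" "cf y w \<noteq> 0" using cf_eq_zero[OF yT] y0 by blast
  have lenw: "length w = n" using w by (simp add: words_def)
  \<comment> \<open>On S the word w is a rearrangement of a word w' in the support of z, and w' has
    no letter of U0 there.\<close>
  have "(\<Sum>q | q permutes S. cf (act n q z) w) \<noteq> 0" using w(2) by (simp add: y_def cf_sum)
  then obtain q where q: "q permutes S" "cf (act n q z) w \<noteq> 0"
    by (metis (mono_tags, lifting) mem_Collect_eq sum.neutral)
  have qn: "q permutes {..<n}" using q(1) Sn by (rule permutes_subset)
  define w' where "w' = permute_list (inv q) w"
  have w': "w' \<in> words n" unfolding w'_def using permutes_inv[OF qn] w(1) by (rule permute_words)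
  have ww: "permute_list q w' = w" unfolding w'_def using qn lenw by (rule permute_list_inv(2))
  have "cf z w' \<noteq> 0" using cf_act[OF qn zT w'] q(2) ww by auto
  then have w's: "w' \<in> support z n" using w' by simp
  have "w ! m \<in> U1" if m: "m \<in> S" for m
  proof -
    have "q m \<in> S" using q(1) m by (simp add: permutes_in_image)
    then have qm: "q m \<in> P" "q m < n" using S P by auto
    have "w ! m = w' ! q m"
      using ww m Sn w' permute_list_nth[of q w' m] qn by (auto simp: words_def)
    moreover have "w' ! q m \<in> U0 \<union> U1"
    proof -
      have "w' \<in> support t n" using w's P(5) by blast
      then have "set w' \<subseteq> U0 \<union> U1" by (rule supp)
      moreover have "w' ! q m \<in> set w'" using qm(2) w' by (simp add: words_def)
      ultimately show ?thesis by blast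
    qed
    ultimately show ?thesis using P(6)[OF w's qm(1)] by auto
  qed
  then have "(\<lambda>m. w ! m) ` S \<subseteq> U1" by auto
  then have "card ((\<lambda>m. w ! m) ` S) < card S"
    using card_mono[OF fin(2)] cardS by (metis le_imp_less_Suc)
  then have "\<not> inj_on (\<lambda>m. w ! m) S" using card_image by fastforce
  then obtain i j where ij: "i \<in> S" "j \<in> S" "i \<noteq> j" "w ! i = w ! j" by (auto simp: inj_on_def)
  have "w ! i \<in> B1" using \<open>(\<lambda>m. w ! m) ` S \<subseteq> U1\<close> ij(1) U1 by auto
  then have "cf y w = 0"
    using ij Sn ysym yT w by (intro cf_equal_letters[of i n j]) auto
  then show False using w(2) by simp
qed

end

section \<open>Dimensions of quotients and the lower bound\<close>

text \<open>A basis of \<open>W\<close> is extended by elements of \<open>U\<close>; the added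
  vectors form \<open>B\<close>.\<close>

lemma basis_mod_exists:
  fixes U W :: "('x \<Rightarrow> 'f::field) set"
  assumes W: "fun_vs.subspace W"
  shows "\<exists>B. basis_mod U W B"
proof -
  obtain C where C: "C \<subseteq> W" "fun_vs.independent C" "W \<subseteq> fun_vs.span C"
    using fun_vs.maximal_independent_subset by blast
  have spanC: "fun_vs.span C = W" using C W by (metis fun_vs.span_minimal subset_antisym)
  obtain D where D: "C \<subseteq> D" "D \<subseteq> W \<union> U" "fun_vs.independent D" "W \<union> U \<subseteq> fun_vs.span D"
    using fun_vs.maximal_independent_subset_extend[of C "W \<union> U"] C by blast
  have "basis_mod U W (D - C)"
    unfolding basis_mod_def
  proof (intro conjI allI impI ballI)
    have "x \<notin> W" if "x \<in> D - C" for x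
    proof
      assume "x \<in> W"
      then have "x \<in> fun_vs.span (D - {x})"
        using fun_vs.span_mono[of C "D - {x}"] spanC that D(1) by auto
      then show False using D(3) that by (auto simp: fun_vs.dependent_def)
    qed
    then show "D - C \<subseteq> U" using D(2) by blast
    have "D \<subseteq> (D - C) \<union> W" using C(1) by blast
    then have "fun_vs.span D \<subseteq> fun_vs.span ((D - C) \<union> W)" by (rule fun_vs.span_mono)
    then show "U \<subseteq> fun_vs.span ((D - C) \<union> W)" using D(4) by blast
    fix S c b assume S: "finite S \<and> S \<subseteq> D - C \<and> (\<Sum>b\<in>S. fscale (c b) b) \<in> W" and b: "b \<in> S"
    show "c b = 0"
    proof (rule ccontr)
      assume cb: "c b \<noteq> 0"
      have "(\<Sum>b\<in>S. fscale (c b) b) = fscale (c b) b + (\<Sum>b\<in>S - {b}. fscale (c b) b)"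
        using S b by (intro sum.remove) auto
      then have "fscale (c b) b = (\<Sum>b\<in>S. fscale (c b) b) - (\<Sum>b\<in>S - {b}. fscale (c b) b)" by simp
      moreover have "(\<Sum>b\<in>S. fscale (c b) b) \<in> fun_vs.span (D - {b})"
        using S b fun_vs.span_mono[of C "D - {b}"] spanC D(1) by auto
      moreover have "(\<Sum>b\<in>S - {b}. fscale (c b) b) \<in> fun_vs.span (D - {b})"
        using S by (intro fun_vs.span_sum fun_vs.span_scale fun_vs.span_base) auto
      ultimately have "fscale (c b) b \<in> fun_vs.span (D - {b})" by (simp add: fun_vs.span_diff)
      then have "fscale (inverse (c b)) (fscale (c b) b) \<in> fun_vs.span (D - {b})"
        by (rule fun_vs.span_scale)
      then have "b \<in> fun_vs.span (D - {b})" using cb by simp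
      then show False using D(3) S b by (auto simp: fun_vs.dependent_def)
    qed
  qed
  then show ?thesis by blast
qed

text \<open>\<open>B\<close> together with a basis of \<open>W\<close> is independent, so the
  projection to the span of \<open>B\<close> along \<open>W\<close> can be prescribed on it. It
  turns statements modulo \<open>W\<close> into statements about vectors.\<close>

lemma basis_mod_projection:
  fixes U W :: "('x \<Rightarrow> 'f::field) set"
  assumes W: "fun_vs.subspace W" and B: "basis_mod U W B"
  obtains P where "Vector_Spaces.linear fscale fscale P" "\<And>b. b \<in> B \<Longrightarrow> P b = b"
    "\<And>w. w \<in> W \<Longrightarrow> P w = 0" "fun_vs.independent B"
proof -
  interpret pr: vector_space_pair "fscale :: 'f \<Rightarrow> ('x \<Rightarrow> 'f) \<Rightarrow> _" "fscale :: 'f \<Rightarrow> ('x \<Rightarrow> 'f) \<Rightarrow> _" ..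
  have indep: "\<And>S c b. finite S \<Longrightarrow> S \<subseteq> B \<Longrightarrow> (\<Sum>b\<in>S. fscale (c b) b) \<in> W \<Longrightarrow> b \<in> S \<Longrightarrow> c b = 0"
    using B unfolding basis_mod_def by blast
  obtain C where C: "C \<subseteq> W" "fun_vs.independent C" "W \<subseteq> fun_vs.span C"
    using fun_vs.maximal_independent_subset by blast
  have BW: "b \<notin> W" if "b \<in> B" for b
    using indep[of "{b}" "\<lambda>_. 1" b] that by auto
  have BC: "fun_vs.independent (B \<union> C)"
    unfolding fun_vs.independent_explicit_module
  proof (intro allI impI)
    fix t u v assume t: "finite t" "t \<subseteq> B \<union> C" "(\<Sum>v\<in>t. fscale (u v) v) = 0" "v \<in> t"
    have split: "(\<Sum>v\<in>t \<inter> B. fscale (u v) v) + (\<Sum>v\<in>t - B. fscale (u v) v) = 0"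
      using sum.Int_Diff[OF t(1), of "\<lambda>v. fscale (u v) v" B] t(3) by (simp only:)
    have "(\<Sum>v\<in>t - B. fscale (u v) v) \<in> W"
      using t C(1) W by (intro fun_vs.subspace_sum fun_vs.subspace_scale) auto
    then have "(\<Sum>v\<in>t \<inter> B. fscale (u v) v) \<in> W"
      using fun_vs.subspace_neg[OF W] add_eq_0_iff2[THEN iffD1, OF split] by (simp only:)
    then have zB: "u x = 0" if "x \<in> t \<inter> B" for x
      using indep[of "t \<inter> B" u x] t(1) that by auto
    then have "(\<Sum>v\<in>t \<inter> B. fscale (u v) v) = 0" by (intro sum.neutral) auto
    then have "(\<Sum>v\<in>t - B. fscale (u v) v) = 0" using split by simp
    then have "u x = 0" if "x \<in> t - B" for x
      using fun_vs.independentD[OF C(2), of "t - B" u x] t(1,2) that by blast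
    then show "u v = 0" using zB t(4) by blast
  qed
  obtain P where P: "Vector_Spaces.linear fscale fscale P" "\<forall>x\<in>B \<union> C. P x = (if x \<in> B then x else 0)"
    using pr.linear_independent_extend[OF BC, of "\<lambda>x. if x \<in> B then x else 0"] by blast
  have "P w = 0" if "w \<in> W" for w
  proof (rule pr.linear_eq_0_on_span[OF P(1)])
    show "w \<in> fun_vs.span C" using that C(3) by blast
    show "P x = 0" if "x \<in> C" for x using that P(2) BW C(1) by auto
  qed
  moreover have "fun_vs.independent B" using BC by (rule fun_vs.independent_mono) auto
  ultimately show thesis using that[OF P(1)] P(2) by simp
qed

text \<open>The projection maps \<open>G\<close> to a set whose span contains the independent set
  \<open>B\<close>.\<close>

lemma basis_mod_card:
  fixes U W :: "('x \<Rightarrow> 'f::field) set"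
  assumes W: "fun_vs.subspace W" and B: "basis_mod U W B" and G: "finite G" "U \<subseteq> fun_vs.span (G \<union> W)"
  shows "finite B" "card B \<le> card G"
proof -
  interpret pr: vector_space_pair "fscale :: 'f \<Rightarrow> ('x \<Rightarrow> 'f) \<Rightarrow> _" "fscale :: 'f \<Rightarrow> ('x \<Rightarrow> 'f) \<Rightarrow> _" ..
  obtain P where P: "Vector_Spaces.linear fscale fscale P" "\<And>b. b \<in> B \<Longrightarrow> P b = b"
    "\<And>w. w \<in> W \<Longrightarrow> P w = 0" and ind: "fun_vs.independent B"
    using basis_mod_projection[OF W B] by blast
  have "B \<subseteq> fun_vs.span (P ` G)"
  proof
    fix b assume b: "b \<in> B"
    then have "b \<in> fun_vs.span (G \<union> W)" using B G(2) by (auto simp: basis_mod_def)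
    then have "P b \<in> fun_vs.span (P ` (G \<union> W))"
      by (simp add: pr.linear_span_image[OF P(1)])
    moreover have "P ` (G \<union> W) \<subseteq> fun_vs.span (P ` G)"
      using P(3) by (auto simp: fun_vs.span_zero intro: fun_vs.span_base)
    then have "fun_vs.span (P ` (G \<union> W)) \<subseteq> fun_vs.span (P ` G)"
      by (intro fun_vs.span_minimal) auto
    ultimately show "b \<in> fun_vs.span (P ` G)" using P(2)[OF b] by auto
  qed
  then have "finite B \<and> card B \<le> card (P ` G)"
    using G(1) ind by (intro fun_vs.independent_span_bound) auto
  then show "finite B" "card B \<le> card G" using card_image_le[OF G(1), of P] by auto
qed

lemma quot_dim_le:
  fixes U W :: "('x \<Rightarrow> 'f::field) set"
  assumes "fun_vs.subspace W" "finite G" "U \<subseteq> fun_vs.span (G \<union> W)"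
  shows "quot_dim U W \<le> card G"
  unfolding quot_dim_def
  using basis_mod_card(2)[OF assms(1) someI_ex[OF basis_mod_exists[OF assms(1)]] assms(2,3)] .

text \<open>A vector in the span of \<open>S\<close> differs from its projection by an element of
  \<open>W\<close>, so the projection is injective there. The finite set \<open>G\<close> guarantees
  that the basis chosen in \<open>quot_dim\<close> is finite; an infinite one would have
  \<open>card\<close> 0.\<close>

lemma quot_dim_ge:
  fixes U W :: "('x \<Rightarrow> 'f::field) set"
  assumes W: "fun_vs.subspace W" and G: "finite G" "U \<subseteq> fun_vs.span (G \<union> W)"
    and S: "finite S" "S \<subseteq> U" "fun_vs.independent S" "fun_vs.span S \<inter> W \<subseteq> {0}"
  shows "card S \<le> quot_dim U W"
proof -
  interpret pr: vector_space_pair "fscale :: 'f \<Rightarrow> ('x \<Rightarrow> 'f) \<Rightarrow> _" "fscale :: 'f \<Rightarrow> ('x \<Rightarrow> 'f) \<Rightarrow> _" ..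
  define B where "B = (SOME B. basis_mod U W B)"
  have B: "basis_mod U W B" unfolding B_def by (rule someI_ex[OF basis_mod_exists[OF W]])
  obtain P where P: "Vector_Spaces.linear fscale fscale P" "\<And>b. b \<in> B \<Longrightarrow> P b = b"
    "\<And>w. w \<in> W \<Longrightarrow> P w = 0" and "fun_vs.independent B"
    using basis_mod_projection[OF W B] by blast
  have SB: "fun_vs.span S \<subseteq> fun_vs.span (B \<union> W)"
    using S(2) B by (intro fun_vs.span_minimal) (auto simp: basis_mod_def)
  have diff: "x - P x \<in> W \<and> P x \<in> fun_vs.span B" if "x \<in> fun_vs.span (B \<union> W)" for x
  proof -
    let ?D = "{x. x - P x \<in> W \<and> P x \<in> fun_vs.span B}"
    have "fun_vs.subspace ?D"
      unfolding fun_vs.subspace_def mem_Collect_eq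
    proof (intro conjI ballI allI)
      show "0 - P 0 \<in> W" "P 0 \<in> fun_vs.span B"
        unfolding pr.linear_0[OF P(1)] diff_0_right
        using W by (auto intro: fun_vs.subspace_0 fun_vs.span_zero)
      fix x y assume "x \<in> ?D" "y \<in> ?D"
      then have x: "x - P x \<in> W" "P x \<in> fun_vs.span B" and y: "y - P y \<in> W" "P y \<in> fun_vs.span B"
        by blast+
      have "x + y - P (x + y) = (x - P x) + (y - P y)" by (simp add: pr.linear_add[OF P(1)])
      then show "x + y - P (x + y) \<in> W" using fun_vs.subspace_add[OF W x(1) y(1)] by (simp only:)
      show "P (x + y) \<in> fun_vs.span B"
        unfolding pr.linear_add[OF P(1)] using x(2) y(2) by (rule fun_vs.span_add)
    next
      fix c x assume "x \<in> ?D"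
      then have x: "x - P x \<in> W" "P x \<in> fun_vs.span B" by blast+
      have "fscale c x - P (fscale c x) = fscale c (x - P x)"
        by (simp add: pr.linear_scale[OF P(1)] fun_vs.scale_right_diff_distrib)
      then show "fscale c x - P (fscale c x) \<in> W" using fun_vs.subspace_scale[OF W x(1)] by (simp only:)
      show "P (fscale c x) \<in> fun_vs.span B"
        unfolding pr.linear_scale[OF P(1)] using x(2) by (rule fun_vs.span_scale)
    qed
    moreover have "B \<union> W \<subseteq> ?D"
    proof
      fix x assume "x \<in> B \<union> W"
      then show "x \<in> ?D"
      proof
        assume "x \<in> B"
        then have "P x = x" "x \<in> fun_vs.span B" using P(2) by (auto intro: fun_vs.span_base)
        then show ?thesis using fun_vs.subspace_0[OF W] by (simp only: mem_Collect_eq diff_self)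
      next
        assume x: "x \<in> W"
        then have "P x = 0" by (rule P(3))
        then show ?thesis using fun_vs.span_zero[of B] x by (simp only: mem_Collect_eq diff_0_right)
      qed
    qed
    ultimately have "fun_vs.span (B \<union> W) \<subseteq> ?D" by (intro fun_vs.span_minimal)
    then show ?thesis using that by blast
  qed
  have inj: "inj_on P (fun_vs.span S)"
  proof (rule inj_onI)
    fix x y assume xy: "x \<in> fun_vs.span S" "y \<in> fun_vs.span S" "P x = P y"
    have d: "x - y \<in> fun_vs.span S" using xy by (intro fun_vs.span_diff)
    moreover have "P (x - y) = 0" using xy(3) by (simp add: pr.linear_diff[OF P(1)])
    ultimately have "x - y \<in> W" using diff[of "x - y"] SB by auto
    then have "x - y = 0" using d S(4) by blast
    then show "x = y" by simp
  qed
  have "inj_on P S" by (rule inj_on_subset[OF inj]) (rule fun_vs.span_superset)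
  then have "card S = card (P ` S)" by (rule card_image[symmetric])
  also have "\<dots> \<le> card B"
  proof -
    have "fun_vs.independent (P ` S)"
      using P(1) S(3) inj by (rule pr.linear_independent_injective_image)
    moreover have "P ` S \<subseteq> fun_vs.span B"
      using diff SB fun_vs.span_superset[of S] by blast
    ultimately show ?thesis
      using fun_vs.independent_span_bound[OF basis_mod_card(1)[OF W B G]] by blast
  qed
  finally show ?thesis by (simp add: quot_dim_def B_def)
qed

section \<open>Projection to a subsuperspace and the lower bound\<close>

context sym_action
begin

lemma mult_linear_map:
  assumes add: "\<And>x y. x \<in> T \<Longrightarrow> y \<in> T \<Longrightarrow> f (x + y) = f x + f y"
    and scale: "\<And>c x. x \<in> T \<Longrightarrow> f (fscale c x) = fscale c (f x)"
    and comm: "\<And>\<sigma> x. \<sigma> permutes {..<n} \<Longrightarrow> x \<in> T \<Longrightarrow> f (act \<sigma> x) = act \<sigma> (f x)"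
    and x: "x \<in> T"
  shows "f (mult x z) = mult (f x) z"
proof -
  have f0: "f 0 = 0" using scale[OF zero_T, of 0] by (simp only: fun_vs.scale_zero_left)
  have fs: "f (sum g A) = (\<Sum>a\<in>A. f (g a))" if "\<And>a. a \<in> A \<Longrightarrow> g a \<in> T" for g :: "(nat \<Rightarrow> nat) \<Rightarrow> _" and A
    using that
  proof (induction A rule: infinite_finite_induct)
    case (insert a A)
    then show ?case using add[of "g a" "sum g A"] by (simp add: sum_T)
  qed (simp_all add: f0)
  then show ?thesis
    unfolding mult_def using x by (subst fs) (auto simp: scale_T act_closed scale comm)
qed

end

context super_tensor
begin

lemma component_add: "component n Q (s + t) = component n Q s + component n Q t"
  by (simp add: component_def cf_add fun_vs.scale_left_distrib sum.distrib)

lemma component_scale: "component n Q (fscale c t) = fscale c (component n Q t)"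
  by (simp add: component_def cf_scale fun_vs.scale_sum_right)

lemma component_zero: "component n Q 0 = 0"
  by (simp add: component_def cf_zero)

lemma component_other_degree:
  assumes "t \<in> TP m" "m \<noteq> n" shows "component n Q t = 0"
  using assms(1) unfolding tensor_power_words
proof (induction rule: fun_vs.span_induct_alt)
  case base
  then show ?case by (simp add: component_zero)
next
  case (step c x y)
  then obtain w where w: "w \<in> words m" "x = tensor scale w" by blast
  have "component n Q x = 0"
    unfolding component_def w(2) using w(1) assms(2)
    by (intro sum.neutral) (auto simp: cf_tensor, auto simp: words_def)
  then show ?case using step.IH by (simp add: component_add component_scale)
qed

text \<open>Let x0 in \<open>N\<close> correspond to the Young symmetrizer e; it generates
  \<open>N\<close>. As e z e = c e, the element c x0 equals x0 z e, so its projection lies in the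
  image of e and satisfies the column relations. The box in row \<open>card U0\<close> and column
  \<open>card U1\<close> makes the columns 0, ..., card U1 longer than \<open>card U0\<close>, and
  \<open>column_relations_zero\<close> applies.\<close>

lemma component_affords_zero:
  assumes U0: "U0 \<subseteq> B0" and U1: "U1 \<subseteq> B1"
    and \<nu>: "\<nu> \<in> partitions" "psize \<nu> = n" and big: "card U1 < \<nu> (card U0)"
    and sub: "submodule scale V0 V1 n N" and aff: "affords scale V0 V1 \<nu> N" and t: "t \<in> N"
  shows "component n (\<lambda>w. set w \<subseteq> U0 \<union> U1) t = 0"
proof -
  let ?\<Pi> = "component n (\<lambda>w. set w \<subseteq> U0 \<union> U1)" and ?e = "young_symmetrizer \<nu> :: _ \<Rightarrow> 'f"
  have N: "tp.submod n N"
    using sub by (auto simp: submodule_def tp.submod_def)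
  have NT: "\<And>x. x \<in> N \<Longrightarrow> x \<in> TP n" using N by (auto simp: tp.submod_def)
  obtain f where lin: "linear_between N f" and bij: "bij_betw f N (irreducible_module \<nu>)"
    and eqv: "\<And>\<sigma> x. \<sigma> permutes {..<n} \<Longrightarrow> x \<in> N \<Longrightarrow> f (act n \<sigma> x) = right_mult \<sigma> (f x)"
    using aff unfolding affords_def \<nu>(2) by blast
  have f_add: "\<And>x y. x \<in> N \<Longrightarrow> y \<in> N \<Longrightarrow> f (x + y) = f x + f y"
    and f_scale: "\<And>c x. x \<in> N \<Longrightarrow> f (fscale c x) = fscale c (f x)"
    using lin by (auto simp: linear_between_def)
  have sN: "fun_vs.subspace N" and aN: "\<And>\<sigma> x. \<sigma> permutes {..<n} \<Longrightarrow> x \<in> N \<Longrightarrow> act n \<sigma> x \<in> N"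
    using N by (auto simp: tp.submod_def)
  \<comment> \<open>An isomorphism for the permutations is one for the group algebra.\<close>
  have f_mult: "f (tp.mult n x z) = regular.mult n (f x) z" if x: "x \<in> N" for x z
  proof -
    have f0: "f 0 = 0" using f_scale[OF fun_vs.subspace_0[OF sN], of 0] by (simp only: fun_vs.scale_zero_left)
    have fs: "f (sum g A) = (\<Sum>a\<in>A. f (g a))" if "\<And>a. a \<in> A \<Longrightarrow> g a \<in> N" for g :: "(nat \<Rightarrow> nat) \<Rightarrow> _" and A
      using that
    proof (induction A rule: infinite_finite_induct)
      case (insert a A)
      then show ?case using f_add[of "g a" "sum g A"] by (simp add: fun_vs.subspace_sum[OF sN])
    qed (simp_all add: f0)
    show ?thesis
      unfolding tp.mult_def regular.mult_def using x
      by (subst fs) (auto simp: fun_vs.subspace_scale[OF sN] aN f_scale eqv)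
  qed
  have "?e \<in> irreducible_module \<nu>"
    using regular.mult_perm_unit[OF young_symmetrizer_in[OF \<nu>(2)]] irreducible_module_eq[OF \<nu>(2)]
    by (metis rangeI)
  then obtain x0 where x0: "x0 \<in> N" "f x0 = ?e"
    using bij by (metis bij_betw_imp_surj_on imageE)
  have inj: "inj_on f N" using bij by (rule bij_betw_imp_inj_on)
  have x0T: "x0 \<in> TP n" using x0 NT by blast
  have gen: "\<exists>z. x = tp.mult n x0 z" if x: "x \<in> N" for x
  proof -
    have "f x \<in> irreducible_module \<nu>" using bij x by (metis bij_betw_apply)
    then obtain z where "f x = regular.mult n ?e z" using irreducible_module_eq[OF \<nu>(2)] by blast
    then have "f x = f (tp.mult n x0 z)" using f_mult[OF x0(1)] x0(2) by simp
    then show ?thesis using inj x tp.mult_submod[OF N x0(1)] by (metis inj_onD)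
  qed
  \<comment> \<open>Permuting positions does not change the set of letters, so the projection is
    equivariant.\<close>
  have \<Pi>_mult: "?\<Pi> (tp.mult n x z) = tp.mult n (?\<Pi> x) z" if "x \<in> TP n" for x z
  proof (rule tp.mult_linear_map[OF _ _ _ that])
    fix \<sigma> y assume \<sigma>: "\<sigma> permutes {..<n}" and y: "y \<in> TP n"
    have "set (permute_list \<sigma> w) = set w" if "w \<in> words n" for w
      using \<sigma> that by (intro set_permute_list) (simp add: words_def)
    then show "?\<Pi> (act n \<sigma> y) = act n \<sigma> (?\<Pi> y)"
      using component_act[OF \<sigma> y, of "\<lambda>w. set w \<subseteq> U0 \<union> U1"] by simp
  qed (rule component_add component_scale)+
  obtain z c where zc: "c \<noteq> 0" "regular.mult n (regular.mult n ?e z) ?e = fscale c ?e"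
    using young_symmetrizer_sandwich[OF \<nu>] by blast
  define y where "y = tp.mult n (tp.mult n x0 z) ?e"
  have xzT: "tp.mult n x0 z \<in> TP n" using x0T by (rule tp.mult_T)
  have "f y = regular.mult n (regular.mult n ?e z) ?e"
    unfolding y_def using f_mult tp.mult_submod[OF N x0(1)] x0 by simp
  then have "f y = f (fscale c x0)" using zc(2) f_scale[OF x0(1)] x0(2) by simp
  moreover have "y \<in> N" unfolding y_def by (intro tp.mult_submod[OF N] x0)
  moreover have "fscale c x0 \<in> N" using x0(1) by (intro fun_vs.subspace_scale[OF sN])
  ultimately have y_eq: "y = fscale c x0" using inj by (metis inj_onD)
  have "?\<Pi> y = 0"
  proof (rule column_relations_zero[OF U0 U1, where col = "col_of \<nu>" and n = n])
    have "?\<Pi> y = tp.young n \<nu> id (tp.mult n (?\<Pi> x0) z)"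
      unfolding y_def \<Pi>_mult[OF xzT] \<Pi>_mult[OF x0T]
      using \<nu>(2) by (intro tp.mult_young_symmetrizer tp.mult_T component_in)
    then show "tp.column_relations n (col_of \<nu>) {..<n} (?\<Pi> y)"
      using tp.young_column_relations[OF \<nu> tp.mult_T[OF component_in]] by simp
    show "set w \<subseteq> U0 \<union> U1" if "w \<in> support (?\<Pi> y) n" for w
      using that by (auto simp: cf_component split: if_splits)
    show "card U0 < card {m \<in> {..<n}. col_of \<nu> m = c}" if c: "c \<le> card U1" for c
    proof -
      have "\<exists>m<n. row_of \<nu> m = r \<and> col_of \<nu> m = c" if "r \<le> card U0" for r
      proof -
        have "antimono \<nu>" using \<nu>(1) by (simp add: partitions_def)
        then have "\<nu> (card U0) \<le> \<nu> r" using that by (rule antimonoD)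
        then show ?thesis using box_exists[OF \<nu>(1), of c r] c big \<nu>(2) by auto
      qed
      then have "{..card U0} \<subseteq> row_of \<nu> ` {m \<in> {..<n}. col_of \<nu> m = c}" by fastforce
      then have "card {..card U0} \<le> card {m \<in> {..<n}. col_of \<nu> m = c}"
        by (intro surj_card_le) auto
      then show ?thesis by simp
    qed
  qed
  then have "fscale c (?\<Pi> x0) = 0" by (simp add: y_eq component_scale)
  then have "?\<Pi> x0 = 0" using zc(1) by (simp add: fun_vs.scale_eq_0_iff)
  moreover obtain z' where "t = tp.mult n x0 z'" using gen[OF t] by blast
  ultimately show ?thesis using \<Pi>_mult[OF x0T] by (simp add: tp.mult_zero_left)
qed

text \<open>The ideal has parts in all degrees; those of degree other than n are killed by
  \<open>component n\<close> anyway.\<close>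

lemma component_filter_ideal_zero:
  assumes U0: "U0 \<subseteq> B0" and U1: "U1 \<subseteq> B1" and \<Omega>: "\<Omega> \<subseteq> partitions"
    and big: "\<And>\<nu>. \<nu> \<in> \<Omega> \<Longrightarrow> card U1 < \<nu> (card U0)"
    and t: "t \<in> filter_ideal scale V0 V1 \<Omega>"
  shows "component n (\<lambda>w. set w \<subseteq> U0 \<union> U1) t = 0"
proof -
  let ?K = "{t. component n (\<lambda>w. set w \<subseteq> U0 \<union> U1) t = 0}"
  have sub: "fun_vs.subspace ?K"
    by (auto simp: fun_vs.subspace_def component_zero component_add component_scale)
  have "isotypic_component scale V0 V1 \<nu> \<subseteq> ?K" if \<nu>: "\<nu> \<in> \<Omega>" for \<nu>
    unfolding isotypic_component_def
  proof (rule fun_vs.span_minimal[OF _ sub], rule subsetI)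
    fix t assume "t \<in> \<Union>{N. submodule scale V0 V1 (psize \<nu>) N \<and> affords scale V0 V1 \<nu> N}"
    then obtain N where N: "submodule scale V0 V1 (psize \<nu>) N" "affords scale V0 V1 \<nu> N" "t \<in> N" by blast
    show "t \<in> ?K"
    proof (cases "psize \<nu> = n")
      case True
      then show ?thesis
        using component_affords_zero[of U0 U1 \<nu> n N t, OF U0 U1 _ True big[OF \<nu>]] N \<nu> \<Omega> by auto
    next
      case False
      moreover have "t \<in> TP (psize \<nu>)" using N by (auto simp: submodule_def)
      ultimately show ?thesis using component_other_degree by blast
    qed
  qed
  then have "filter_ideal scale V0 V1 \<Omega> \<subseteq> ?K"
    unfolding filter_ideal_def by (intro fun_vs.span_minimal[OF _ sub]) auto
  then show ?thesis using t by blast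
qed

text \<open>The projection is the identity on the span of the words over
  \<open>U0 \<union> U1\<close> and 0 on the ideal, so these words stay independent in the
  quotient.\<close>

theorem dim_A_ge:
  assumes U0: "U0 \<subseteq> B0" and U1: "U1 \<subseteq> B1" and \<Omega>: "\<Omega> \<subseteq> partitions"
    and big: "\<And>\<nu>. \<nu> \<in> \<Omega> \<Longrightarrow> card U1 < \<nu> (card U0)"
  shows "(card U0 + card U1) ^ n \<le> dim_A scale V0 V1 \<Omega> n"
proof -
  let ?W = "{w. set w \<subseteq> U0 \<union> U1 \<and> length w = n}" and ?Q = "\<lambda>w. set w \<subseteq> U0 \<union> U1"
  have fin: "finite (U0 \<union> U1)" using U0 U1 B0(1) B1(1) finite_subset by blast
  have W: "?W \<subseteq> words n" using U0 U1 by (auto simp: words_def letters_def)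
  have "card (U0 \<union> U1) = card U0 + card U1"
    using fin U0 U1 disjoint by (intro card_Un_disjoint) auto
  then have cardW: "card ?W = (card U0 + card U1) ^ n" using card_lists_length_eq[OF fin, of n] by simp
  have finW: "finite ?W" using W finite_words finite_subset by blast
  have inj: "inj_on (tensor scale) ?W"
  proof (rule inj_onI)
    fix w w' assume w: "w \<in> ?W" "w' \<in> ?W" "tensor scale w = tensor scale w'"
    then have "cf (tensor scale w) w = cf (tensor scale w') w" by simp
    moreover have "w \<in> words n" "w' \<in> words n" using w W by blast+
    ultimately show "w = w'" using cf_tensor[of w n w n] cf_tensor[of w' n w n] by (simp split: if_splits)
  qed
  have "fun_vs.independent (tensor scale ` ?W)"
    unfolding fun_vs.independent_explicit_module
  proof (intro allI impI)
    fix S u v assume S: "finite S" "S \<subseteq> tensor scale ` ?W" "(\<Sum>v\<in>S. fscale (u v) v) = 0" "v \<in> S"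
    then obtain w where w: "w \<in> ?W" "v = tensor scale w" by blast
    have "0 = cf (\<Sum>v\<in>S. fscale (u v) v) w" using S(3) by (simp add: cf_zero)
    also have "\<dots> = (\<Sum>x\<in>S. u x * cf x w)" by (simp add: cf_sum cf_scale)
    also have "\<dots> = (\<Sum>x\<in>S. if x = v then u v else 0)"
    proof (intro sum.cong refl)
      fix x assume "x \<in> S"
      then obtain w' where w': "w' \<in> ?W" "x = tensor scale w'" using S(2) by blast
      then have "x = v \<longleftrightarrow> w' = w" using w inj by (auto simp: inj_on_def)
      then show "u x * cf x w = (if x = v then u v else 0)"
      proof -
        have "w \<in> words n" "w' \<in> words n" using w w' W by blast+
        then show ?thesis using cf_tensor[of w' n w n] w(2) w'(2) \<open>x = v \<longleftrightarrow> w' = w\<close> by auto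
      qed
    qed
    also have "\<dots> = u v" using S(1,4) by simp
    finally show "u v = 0" by simp
  qed
  moreover have "fun_vs.span (tensor scale ` ?W) \<inter> filter_ideal scale V0 V1 \<Omega> \<subseteq> {0}"
  proof
    fix t assume t: "t \<in> fun_vs.span (tensor scale ` ?W) \<inter> filter_ideal scale V0 V1 \<Omega>"
    have "component n ?Q t = t" if "t \<in> fun_vs.span (tensor scale ` ?W)" for t
      using that
    proof (induction rule: fun_vs.span_induct_alt)
      case base
      then show ?case by (simp add: component_zero)
    next
      case (step c x y)
      then obtain w where w: "w \<in> ?W" "x = tensor scale w" by blast
      have "component n ?Q x = x"
      proof (rule cf_eqI[OF component_in])
        show "x \<in> TP n" using w W tensor_in by auto
        fix w' assume w': "w' \<in> words n"
        have wn: "w \<in> words n" using w W by blast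
        show "cf (component n ?Q x) w' = cf x w'"
          using w cf_tensor[OF wn w'] by (cases "w = w'") (simp_all add: cf_component[OF w'])
      qed
      then show ?case using step.IH by (simp add: component_add component_scale)
    qed
    then have "component n ?Q t = t" using t by blast
    moreover have "component n ?Q t = 0"
      by (rule component_filter_ideal_zero[OF U0 U1 \<Omega>]) (use big t in blast)+
    ultimately show "t \<in> {0}" by simp
  qed
  moreover have "tensor scale ` ?W \<subseteq> TP n" using W tensor_in by blast
  moreover have "TP n \<subseteq> fun_vs.span (tensor scale ` words n \<union> filter_ideal scale V0 V1 \<Omega>)"
    unfolding tensor_power_words by (rule fun_vs.span_mono) auto
  ultimately have "card (tensor scale ` ?W) \<le> dim_A scale V0 V1 \<Omega> n"
    unfolding dim_A_def using finW finite_words[of n]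
    by (intro quot_dim_ge[of _ "tensor scale ` words n"])
      (auto simp: filter_ideal_def fun_vs.subspace_span)
  then show ?thesis using card_image[OF inj] cardW by simp
qed

end

section \<open>The upper bound\<close>

context sym_action
begin

lemma submod_span:
  assumes X: "X \<subseteq> T" and cl: "\<And>\<sigma> x. \<sigma> permutes {..<n} \<Longrightarrow> x \<in> X \<Longrightarrow> act \<sigma> x \<in> fun_vs.span X"
  shows "submod (fun_vs.span X)"
proof -
  have "x \<in> T \<and> act \<sigma> x \<in> fun_vs.span X" if \<sigma>: "\<sigma> permutes {..<n}" and x: "x \<in> fun_vs.span X" for \<sigma> x
    using x
  proof (induction rule: fun_vs.span_induct_alt)
    case base
    then show ?case by (simp add: zero_T act_zero[OF \<sigma>] fun_vs.span_zero)
  next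
    case (step c x y)
    then show ?case
      using X cl[OF \<sigma>] \<sigma>
      by (auto simp: act_add act_scale scale_T add_T fun_vs.span_add fun_vs.span_scale subset_iff)
  qed
  then show ?thesis
    unfolding submod_def using fun_vs.subspace_span permutes_id by blast
qed

text \<open>The row sum a multiplies the row-symmetric v by a nonzero integer, so v a b = 0 gives v
  b = 0, and then b kills v q for every q in the column stabilizer. But
  \<open>garnir_columns\<close> finds a nonzero w in their span that is antisymmetric along all
  columns, and b multiplies w by the order of the column stabilizer.\<close>

lemma garnir_young_nonzero:
  assumes \<nu>: "\<nu> \<in> partitions" "psize \<nu> = n" and g: "garnir (row_of \<nu>) {..<n} v" and v0: "v \<noteq> 0"
  shows "young \<nu> id v \<noteq> 0"
proof
  assume zero: "young \<nu> id v = 0"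
  let ?R = "row_stabilizer \<nu>" and ?C = "col_stabilizer \<nu>"
  have v: "v \<in> T" and sym: "\<And>s t. s < n \<Longrightarrow> t < n \<Longrightarrow> row_of \<nu> s = row_of \<nu> t \<Longrightarrow> act (transpose s t) v = v"
    using g by (auto simp: garnir_def)
  have C: "q permutes {..<n}" if "q \<in> ?C" for q using that stabilizer_permutes \<nu>(2) by metis
  have R: "p permutes {..<n}" if "p \<in> ?R" for p using that stabilizer_permutes \<nu>(2) by metis
  have Ceq: "?C = {q. q permutes {..<n} \<and> (\<forall>m\<in>{..<n}. col_of \<nu> (q m) = col_of \<nu> m)}"
    using \<nu>(2) by (auto simp: col_stabilizer_def)
  have left: "\<exists>m'\<in>{..<n}. row_of \<nu> m' = row_of \<nu> m \<and> col_of \<nu> m' = k" if "m \<in> {..<n}" "k < col_of \<nu> m" for m k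
    using box_exists[OF \<nu>(1), of k "row_of \<nu> m"] box_position(2)[OF \<nu>(1), of m] that \<nu>(2) by auto
  have inj: "inj_on (\<lambda>m. (row_of \<nu> m, col_of \<nu> m)) {..<n}" using box_inj[OF \<nu>(1)] \<nu>(2) by simp
  obtain w where w0: "w \<noteq> 0" and w: "w \<in> fun_vs.span {act q v | q. q permutes {..<n} \<and> (\<forall>m\<in>{..<n}. col_of \<nu> (q m) = col_of \<nu> m)}"
    and anti: "\<And>s t. s \<in> {..<n} \<Longrightarrow> t \<in> {..<n} \<Longrightarrow> s \<noteq> t \<Longrightarrow> col_of \<nu> s = col_of \<nu> t \<Longrightarrow> col_of \<nu> s < n \<Longrightarrow>
      act (transpose s t) w = - w"
    using garnir_columns[OF g v0 subset_refl inj left, of n] by blast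
  \<comment> \<open>The bound K = n in \<open>garnir_columns\<close> thus covers all
    columns.\<close>
  have colless: "col_of \<nu> m < n" if "m < n" for m using that by (simp add: col_of_def less_imp_diff_less)
  define b where "b x = (\<Sum>q\<in>?C. fscale (of_int (sign q)) (act q x))" for x
  have act_p: "act p v = v" if p: "p \<in> ?R" for p
  proof -
    have "finite {..<n}" by simp
    moreover have "p permutes {..<n}" using p by (rule R)
    moreover have "\<forall>m\<in>{..<n}. row_of \<nu> (p m) = row_of \<nu> m"
      using p \<nu>(2) by (simp add: row_stabilizer_def)
    ultimately show ?thesis
    proof (induction p rule: color_perm_induct)
      case id
      show ?case by (rule act_id[OF v])
    next
      case (swap q s t)
      then show ?case using v sym by (subst act_comp) (auto intro: transpose_n)
    qed
  qed
  have "young \<nu> id v = (\<Sum>p\<in>?R. \<Sum>q\<in>?C. fscale (of_int (sign q)) (act q v))"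
    unfolding young_def
  proof (intro sum.cong refl)
    fix p q assume "p \<in> ?R" "q \<in> ?C"
    then show "fscale (of_int (sign q)) (act (p \<circ> id \<circ> q) v) = fscale (of_int (sign q)) (act q v)"
      using act_comp[OF R C v] act_p by simp
  qed
  then have "fscale (of_nat (card ?R)) (b v) = 0"
    using zero by (simp only: b_def fun_vs.sum_constant_scale)
  moreover have "card ?R \<noteq> 0" using finite_stabilizer(1)[of \<nu>] stabilizer_id(1)[of \<nu>] by auto
  ultimately have bv: "b v = 0" by (simp add: fun_vs.scale_eq_0_iff)
  have b_act: "b (act q v) = 0" if q: "q \<in> ?C" for q
  proof -
    have sg: "sign (q \<circ> r) = sign q * sign r" if "r \<in> ?C" for r
      using C[OF q] C[OF that] by (intro sign_compose) (auto intro: permutation_psize)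
    have "b (act q v) = (\<Sum>r\<in>?C. fscale (of_int (sign r)) (act (q \<circ> r) v))"
      unfolding b_def using C q v by (intro sum.cong refl) (simp add: act_comp)
    also have "\<dots> = (\<Sum>r\<in>?C. fscale (of_int (sign q)) (fscale (of_int (sign r)) (act r v)))"
    proof (rule sum.reindex_bij_witness[of _ "\<lambda>r. inv q \<circ> r" "\<lambda>r. q \<circ> r"])
      fix r assume r: "r \<in> ?C"
      show "inv q \<circ> (q \<circ> r) = r" "q \<circ> (inv q \<circ> r) = r"
        using C[OF q] by (simp_all only: o_assoc permutes_inv_o id_o)
      show "q \<circ> r \<in> ?C" "inv q \<circ> r \<in> ?C" using q r by (simp_all add: stabilizer_comp stabilizer_inv)
      have "of_int (sign q) * of_int (sign (q \<circ> r)) = (of_int (sign r) :: 'f)"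
        unfolding sg[OF r] by (simp only: of_int_mult[symmetric] sign_left_idempotent)
      then show "fscale (of_int (sign q)) (fscale (of_int (sign (q \<circ> r))) (act (q \<circ> r) v)) =
          fscale (of_int (sign r)) (act (q \<circ> r) v)"
        by (simp only: fun_vs.scale_scale)
    qed
    also have "\<dots> = fscale (of_int (sign q)) (b v)" by (simp only: b_def fun_vs.scale_sum_right)
    finally show ?thesis using bv by simp
  qed
  have "w \<in> T \<and> b w = 0"
    using w unfolding Ceq[symmetric]
  proof (induction rule: fun_vs.span_induct_alt)
    case base
    have "b 0 = 0" unfolding b_def using C by (intro sum.neutral) (simp add: act_zero)
    then show ?case using zero_T by simp
  next
    case (step c x y)
    then obtain q where q: "q \<in> ?C" "x = act q v" using Ceq by blast
    have xT: "x \<in> T" using q C v by (simp add: act_closed)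
    have "b (fscale c x + y) = fscale c (b x) + b y"
      unfolding b_def fun_vs.scale_sum_right sum.distrib[symmetric]
      using C xT step.IH
      by (intro sum.cong refl) (simp add: act_add act_scale scale_T fun_vs.scale_right_distrib mult.commute)
    then show ?case using b_act[OF q(1)] q(2) step.IH xT by (simp add: add_T scale_T)
  qed
  then have wT: "w \<in> T" and bw: "b w = 0" by auto
  have "fscale (of_int (sign q)) (act q w) = w" if q: "q \<in> ?C" for q
  proof -
    have "finite {..<n}" by simp
    moreover have "q permutes {..<n}" using q by (rule C)
    moreover have "\<forall>m\<in>{..<n}. col_of \<nu> (q m) = col_of \<nu> m"
      using q \<nu>(2) by (simp add: col_stabilizer_def)
    ultimately show ?thesis
    proof (induction q rule: color_perm_induct)
      case id
      show ?case by (simp only: sign_id of_int_1 fun_vs.scale_one act_id[OF wT])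
    next
      case (swap q s t)
      have "act (transpose s t \<circ> q) w = act q (- w)"
        using swap wT by (subst act_comp) (auto intro: transpose_n simp: anti colless)
      moreover have "sign (transpose s t \<circ> q) = - sign q"
        using swap by (simp add: sign_compose permutation_psize permutation_swap_id sign_swap_id)
      ultimately have "fscale (of_int (sign (transpose s t \<circ> q))) (act (transpose s t \<circ> q) w) =
          fscale (of_int (sign q)) (act q w)"
        using swap(5) wT by (simp only: act_neg) simp
      then show ?case using swap(7) by (simp only:)
    qed
  qed
  then have "b w = (\<Sum>q\<in>?C. w)" unfolding b_def by (intro sum.cong) auto
  then have "fscale (of_nat (card ?C)) w = 0" using bw by (simp only: fun_vs.sum_constant_scale)
  moreover have "card ?C \<noteq> 0" using finite_stabilizer(2)[of \<nu>] stabilizer_id(2)[of \<nu>] by auto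
  ultimately show False using w0 by (simp add: fun_vs.scale_eq_0_iff)
qed

text \<open>Symmetric in the positions of each colour below \<open>i\<close>, antisymmetric in those of each colour from
  \<open>i\<close> to \<open>r - 1\<close>; positions of colour \<open>r\<close> or more are unrestricted.\<close>

definition blocks :: "nat \<Rightarrow> nat \<Rightarrow> (nat \<Rightarrow> nat) \<Rightarrow> ('x \<Rightarrow> 'f) set" where
  "blocks r i g = {t \<in> T. \<forall>s<n. \<forall>s'<n. s \<noteq> s' \<and> g s = g s' \<and> g s < r \<longrightarrow>
     act (transpose s s') t = (if g s < i then t else - t)}"

lemma act_blocks:
  assumes \<tau>: "\<tau> permutes {..<n}" and t: "t \<in> blocks r i g"
  shows "act \<tau> t \<in> blocks r i (g \<circ> \<tau>)"
proof -
  have tT: "t \<in> T" using t by (simp add: blocks_def)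
  have \<tau>n: "\<tau> m < n" if "m < n" for m using \<tau> that by (metis lessThan_iff permutes_in_image)
  have "act (transpose s s') (act \<tau> t) = (if (g \<circ> \<tau>) s < i then act \<tau> t else - act \<tau> t)"
    if s: "s < n" "s' < n" "s \<noteq> s'" "(g \<circ> \<tau>) s = (g \<circ> \<tau>) s'" "(g \<circ> \<tau>) s < r" for s s'
  proof -
    have "\<tau> \<circ> transpose s s' = transpose (\<tau> s) (\<tau> s') \<circ> \<tau>"
      using \<tau> by (simp add: transpose_comp_eq permutes_bij permutes_inverses)
    then have "act (transpose s s') (act \<tau> t) = act \<tau> (act (transpose (\<tau> s) (\<tau> s')) t)"
      using s \<tau> \<tau>n tT by (metis act_comp transpose_n)
    moreover have "\<tau> s \<noteq> \<tau> s'" using \<tau> s(3) by (metis permutes_inverses(2))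
    then have "act (transpose (\<tau> s) (\<tau> s')) t = (if g (\<tau> s) < i then t else - t)"
      using t s \<tau>n by (auto simp: blocks_def)
    ultimately show ?thesis using \<tau> tT by (simp add: act_neg)
  qed
  then show ?thesis using act_closed[OF \<tau> tT] by (simp add: blocks_def)
qed

text \<open>The rows from i on form a diagram of their own, for which v is again a highest weight
  vector, so its first j columns can be antisymmetrized. This moves no position of the first i rows,
  and the symmetry there persists.\<close>

lemma garnir_blocks:
  assumes \<nu>: "\<nu> \<in> partitions" "psize \<nu> = n" and g: "garnir (row_of \<nu>) {..<n} v" and v0: "v \<noteq> 0"
    and M: "submod M" "v \<in> M"
  obtains w where "w \<noteq> 0" "w \<in> M"
    "w \<in> blocks r i (\<lambda>m. if row_of \<nu> m < i then row_of \<nu> m else if col_of \<nu> m < j then i + col_of \<nu> m else r)"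
proof -
  have v: "v \<in> T" and sym: "\<And>s t. s < n \<Longrightarrow> t < n \<Longrightarrow> row_of \<nu> s = row_of \<nu> t \<Longrightarrow> act (transpose s t) v = v"
    and rel: "\<And>s i. s < n \<Longrightarrow> i < row_of \<nu> s \<Longrightarrow> v + (\<Sum>t | t \<in> {..<n} \<and> row_of \<nu> t = i. act (transpose t s) v) = 0"
    using g by (auto simp: garnir_def)
  define P where "P = {m. m < n \<and> i \<le> row_of \<nu> m}"
  have P: "P \<subseteq> {..<n}" by (auto simp: P_def)
  have g': "garnir (\<lambda>m. row_of \<nu> m - i) P v"
    unfolding garnir_def
  proof (intro conjI ballI allI impI)
    fix s c assume s: "s \<in> P" "c < row_of \<nu> s - i"
    have "{t. t \<in> P \<and> row_of \<nu> t - i = c} = {t. t \<in> {..<n} \<and> row_of \<nu> t = c + i}"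
      by (auto simp: P_def)
    then show "v + (\<Sum>t | t \<in> P \<and> row_of \<nu> t - i = c. act (transpose t s) v) = 0"
      using rel[of s "c + i"] s by (simp add: P_def)
  qed (use v sym in \<open>auto simp: P_def\<close>)
  have inj: "inj_on (\<lambda>m. (row_of \<nu> m - i, col_of \<nu> m)) P"
  proof (rule inj_onI)
    fix x y assume "x \<in> P" "y \<in> P" "(row_of \<nu> x - i, col_of \<nu> x) = (row_of \<nu> y - i, col_of \<nu> y)"
    then have "x < psize \<nu>" "y < psize \<nu>" "row_of \<nu> x = row_of \<nu> y" "col_of \<nu> x = col_of \<nu> y"
      using \<nu>(2) by (auto simp: P_def)
    then show "x = y" using box_inj[OF \<nu>(1)] by (auto simp: inj_on_def)
  qed
  have left: "\<exists>m'\<in>P. row_of \<nu> m' - i = row_of \<nu> m - i \<and> col_of \<nu> m' = k"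
    if "m \<in> P" "k < col_of \<nu> m" for m k
    using box_exists[OF \<nu>(1), of k "row_of \<nu> m"] box_position(2)[OF \<nu>(1), of m] that \<nu>(2)
    by (auto simp: P_def)
  obtain w where w: "w \<noteq> 0" "w \<in> fun_vs.span {act q v | q. q permutes P \<and> (\<forall>m\<in>P. col_of \<nu> (q m) = col_of \<nu> m)}"
    "\<And>s t. s \<in> P \<Longrightarrow> t \<in> P \<Longrightarrow> s \<noteq> t \<Longrightarrow> col_of \<nu> s = col_of \<nu> t \<Longrightarrow> col_of \<nu> s < j \<Longrightarrow> act (transpose s t) w = - w"
    using garnir_columns[OF g' v0 P inj left, of j] by blast
  \<comment> \<open>What w inherits from v: membership in M and symmetry in the first i rows both
    survive permutations of P.\<close>
  define F where "F = {x \<in> M. \<forall>s<n. \<forall>t<n. row_of \<nu> s = row_of \<nu> t \<and> row_of \<nu> s < i \<longrightarrow> act (transpose s t) x = x}"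
  have MT: "\<And>x. x \<in> M \<Longrightarrow> x \<in> T" and sM: "fun_vs.subspace M" using M by (auto simp: submod_def)
  have "fun_vs.subspace F"
    unfolding fun_vs.subspace_def F_def
    using fun_vs.subspace_0[OF sM] fun_vs.subspace_add[OF sM] fun_vs.subspace_scale[OF sM] MT
    by (auto simp: act_zero act_add act_scale transpose_n)
  moreover have "act q v \<in> F" if q: "q permutes P" for q
  proof -
    have qn: "q permutes {..<n}" using q P by (rule permutes_subset)
    have "act (transpose s t) (act q v) = act q v"
      if st: "s < n" "t < n" "row_of \<nu> s = row_of \<nu> t" "row_of \<nu> s < i" for s t
    proof -
      have "s \<notin> P" "t \<notin> P" using st by (auto simp: P_def)
      then have "q s = s" "q t = t" using q by (auto simp: permutes_not_in)
      then have "q \<circ> transpose s t = transpose s t \<circ> q"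
        using transpose_comp_eq[of q s t] qn by (metis permutes_bij permutes_inverses(2))
      then have "act (transpose s t) (act q v) = act q (act (transpose s t) v)"
        using st qn v by (metis act_comp transpose_n)
      then show ?thesis using sym st by simp
    qed
    then show ?thesis using M qn by (auto simp: F_def submod_def)
  qed
  then have "{act q v | q. q permutes P \<and> (\<forall>m\<in>P. col_of \<nu> (q m) = col_of \<nu> m)} \<subseteq> F" by blast
  ultimately have "w \<in> F" using w(2) fun_vs.span_minimal by blast
  then have wM: "w \<in> M" and ws: "\<And>s t. s < n \<Longrightarrow> t < n \<Longrightarrow> row_of \<nu> s = row_of \<nu> t \<Longrightarrow> row_of \<nu> s < i \<Longrightarrow>
      act (transpose s t) w = w"
    by (auto simp: F_def)
  have "w \<in> blocks r i (\<lambda>m. if row_of \<nu> m < i then row_of \<nu> m else if col_of \<nu> m < j then i + col_of \<nu> m else r)"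
    unfolding blocks_def using MT[OF wM] ws w(3) by (auto simp: P_def split: if_splits)
  then show thesis using that w(1) wM by blast
qed

end

section \<open>Isotypic components and block-symmetric tensors\<close>

context super_tensor
begin

text \<open>With e the Young symmetrizer and v e nonzero, the map sending x to v x embeds the
  irreducible module by \<open>mult_inj_irreducible\<close>; its image is a submodule of the
  required type and contains v e.\<close>

lemma young_in_isotypic:
  assumes \<nu>: "\<nu> \<in> partitions" "psize \<nu> = n" and v: "v \<in> TP n"
  shows "tp.young n \<nu> id v \<in> isotypic_component scale V0 V1 \<nu>"
proof (cases "tp.young n \<nu> id v = 0")
  case True
  then show ?thesis by (simp add: isotypic_component_def fun_vs.span_zero)
next
  case False
  let ?I = "irreducible_module \<nu> :: (_ \<Rightarrow> 'f) set" and ?m = "tp.mult n v"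
  have young: "?m (young_symmetrizer \<nu>) = tp.young n \<nu> id v"
    using v \<nu>(2) by (rule tp.mult_young_symmetrizer)
  have inj: "inj_on ?m ?I"
    using tp.mult_inj_irreducible[OF \<nu> v] young False by simp
  have I: "regular.submod n ?I" using \<nu>(2) by (rule irreducible_submod)
  then have sI: "fun_vs.subspace ?I" and aI: "\<And>\<sigma> x. \<sigma> permutes {..<n} \<Longrightarrow> x \<in> ?I \<Longrightarrow> right_mult \<sigma> x \<in> ?I"
    by (auto simp: regular.submod_def)
  have act_m: "act n \<sigma> (?m x) = ?m (right_mult \<sigma> x)" if "\<sigma> permutes {..<n}" for \<sigma> x
    using tp.mult_right_mult[OF v that] by simp
  have "submodule scale V0 V1 n (?m ` ?I)"
    unfolding submodule_def
  proof (intro conjI allI impI)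
    show "fun_vs.subspace (?m ` ?I)"
      unfolding fun_vs.subspace_def
    proof (intro conjI ballI allI)
      show "0 \<in> ?m ` ?I" using tp.mult_zero fun_vs.subspace_0[OF sI] by (metis imageI)
      fix x y assume "x \<in> ?m ` ?I" "y \<in> ?m ` ?I"
      then show "x + y \<in> ?m ` ?I"
        by (auto simp: tp.mult_add[symmetric] intro!: imageI fun_vs.subspace_add[OF sI])
    next
      fix c x assume "x \<in> ?m ` ?I"
      then show "fscale c x \<in> ?m ` ?I"
        by (auto simp: tp.mult_scale[symmetric] intro!: imageI fun_vs.subspace_scale[OF sI])
    qed
    show "?m ` ?I \<subseteq> TP n" using tp.mult_T[OF v] by blast
    show "act n \<sigma> ` ?m ` ?I \<subseteq> ?m ` ?I" if "\<sigma> permutes {..<n}" for \<sigma>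
      using act_m[OF that] aI[OF that] by auto
  qed
  moreover have "affords scale V0 V1 \<nu> (?m ` ?I)"
    unfolding affords_def \<nu>(2)
  proof (intro exI[of _ "inv_into ?I ?m"] conjI allI impI ballI)
    show "bij_betw (inv_into ?I ?m) (?m ` ?I) ?I"
      using inj by (intro bij_betw_inv_into inj_on_imp_bij_betw)
    show "linear_between (?m ` ?I) (inv_into ?I ?m)"
      unfolding linear_between_def
    proof (intro conjI ballI allI)
      fix s t assume "s \<in> ?m ` ?I" "t \<in> ?m ` ?I"
      then obtain x y where xy: "x \<in> ?I" "y \<in> ?I" "s = ?m x" "t = ?m y" by blast
      have "x + y \<in> ?I" using xy by (intro fun_vs.subspace_add[OF sI])
      then show "inv_into ?I ?m (s + t) = inv_into ?I ?m s + inv_into ?I ?m t"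
        using xy inj by (simp add: tp.mult_add[symmetric] inv_into_f_f)
    next
      fix c t assume "t \<in> ?m ` ?I"
      then obtain x where x: "x \<in> ?I" "t = ?m x" by blast
      have "fscale c x \<in> ?I" using x by (intro fun_vs.subspace_scale[OF sI])
      then show "inv_into ?I ?m (fscale c t) = fscale c (inv_into ?I ?m t)"
        using x inj by (simp add: tp.mult_scale[symmetric] inv_into_f_f)
    qed
    fix \<sigma> t assume \<sigma>: "\<sigma> permutes {..<n}" and "t \<in> ?m ` ?I"
    then obtain x where x: "x \<in> ?I" "t = ?m x" by blast
    then show "inv_into ?I ?m (act n \<sigma> t) = right_mult \<sigma> (inv_into ?I ?m t)"
      using aI[OF \<sigma> x(1)] inj by (simp add: act_m[OF \<sigma>] inv_into_f_f)
  qed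
  moreover have "tp.young n \<nu> id v \<in> ?m ` ?I"
  proof -
    have "young_symmetrizer \<nu> \<in> ?I"
      using regular.mult_perm_unit[OF young_symmetrizer_in[OF \<nu>(2)]] irreducible_module_eq[OF \<nu>(2)]
      by (metis rangeI)
    then show ?thesis using young by (metis imageI)
  qed
  ultimately show ?thesis
    unfolding isotypic_component_def \<nu>(2) by (intro fun_vs.span_base) blast
qed

lemma isotypic_submod:
  assumes "psize \<nu> = n"
  shows "tp.submod n (isotypic_component scale V0 V1 \<nu>)"
  unfolding isotypic_component_def assms
proof (rule tp.submod_span)
  let ?X = "\<Union>{U. submodule scale V0 V1 n U \<and> affords scale V0 V1 \<nu> U}"
  show "?X \<subseteq> TP n" by (auto simp: submodule_def)
  fix \<sigma> x assume \<sigma>: "\<sigma> permutes {..<n}" and "x \<in> ?X"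
  then obtain U where U: "submodule scale V0 V1 n U" "affords scale V0 V1 \<nu> U" "x \<in> U" by blast
  then have "act n \<sigma> x \<in> U" using \<sigma> by (auto simp: submodule_def)
  then have "act n \<sigma> x \<in> ?X" using U by blast
  then show "act n \<sigma> x \<in> fun_vs.span ?X" by (rule fun_vs.span_base)
qed

text \<open>Within a class all coefficients are multiples of the one at a representative, by factors
  common to all t in \<open>Q\<close>. So one vector per class, the combination h of its words,
  suffices.\<close>

lemma span_by_classes:
  assumes Q: "Q \<subseteq> TP n"
    and cls: "\<And>w w'. w \<in> words n \<Longrightarrow> w' \<in> words n \<Longrightarrow> cls w = cls w' \<Longrightarrow> \<exists>e. \<forall>t\<in>Q. cf t w' = e * cf t w"
  obtains G where "finite G" "card G \<le> card (cls ` words n)" "Q \<subseteq> fun_vs.span G"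
proof -
  define rep where "rep x = (SOME w. w \<in> words n \<and> cls w = x)" for x
  have rep: "rep (cls w) \<in> words n \<and> cls (rep (cls w)) = cls w" if "w \<in> words n" for w
    unfolding rep_def by (rule someI[of "\<lambda>u. u \<in> words n \<and> cls u = cls w" w]) (simp add: that)
  have "\<forall>w. \<exists>e. w \<in> words n \<longrightarrow> (\<forall>t\<in>Q. cf t w = e * cf t (rep (cls w)))"
  proof
    fix w
    show "\<exists>e. w \<in> words n \<longrightarrow> (\<forall>t\<in>Q. cf t w = e * cf t (rep (cls w)))"
      using cls[of "rep (cls w)" w] rep[of w] by blast
  qed
  then obtain e where e: "\<And>w t. w \<in> words n \<Longrightarrow> t \<in> Q \<Longrightarrow> cf t w = e w * cf t (rep (cls w))" by metis
  define h where "h x = (\<Sum>w | w \<in> words n \<and> cls w = x. fscale (e w) (tensor scale w))" for x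
  have "t \<in> fun_vs.span (h ` cls ` words n)" if t: "t \<in> Q" for t
  proof -
    have "t = (\<Sum>w\<in>words n. fscale (cf t w) (tensor scale w))" using word_expansion t Q by blast
    also have "\<dots> = (\<Sum>x\<in>cls ` words n. \<Sum>w | w \<in> words n \<and> cls w = x. fscale (cf t w) (tensor scale w))"
      using finite_words by (intro sum.group[symmetric]) auto
    also have "\<dots> = (\<Sum>x\<in>cls ` words n. fscale (cf t (rep x)) (h x))"
      unfolding h_def fun_vs.scale_sum_right using e t
      by (intro sum.cong refl) (auto simp: mult.commute)
    also have "\<dots> \<in> fun_vs.span (h ` cls ` words n)"
      by (intro fun_vs.span_sum fun_vs.span_scale fun_vs.span_base) auto
    finally show ?thesis .
  qed
  moreover have "card (h ` cls ` words n) \<le> card (cls ` words n)"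
    using finite_words by (intro card_image_le) auto
  ultimately show thesis using that[of "h ` cls ` words n"] finite_words by blast
qed

text \<open>Permutations that preserve the blocks and fix the free positions act by scalars. Up to a
  factor, a coefficient thus depends only on how often each letter occurs in each block, which the
  first factor of the bound counts, and on the letters in the free positions, which the second
  counts. Its base \<open>card letters + 1\<close> is positive even for an empty alphabet, so the
  exponent may be raised to K.\<close>

lemma blocks_dim:
  assumes K: "card {m. m < n \<and> \<not> g m < r} \<le> K"
  obtains G where "finite G" "card G \<le> (n + 1) ^ (r * card letters) * (card letters + 1) ^ K"
    "tp.blocks n r i g \<subseteq> fun_vs.span G"
proof -
  let ?Q = "tp.blocks n r i g" and ?F = "{m. m < n \<and> \<not> g m < r}"
  let ?A = "{..<r} \<times> letters"
  \<comment> \<open>The free positions get pairwise different colours, so a permutation preserving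
    \<open>key\<close> fixes them.\<close>
  define key where "key m = (if g m < r then g m else r + m)" for m
  define cls where "cls w = (\<lambda>x\<in>?A. card {m. m < n \<and> g m = fst x \<and> w ! m = snd x}, \<lambda>m\<in>?F. w ! m)" for w
  have QT: "?Q \<subseteq> TP n" by (auto simp: tp.blocks_def)
  have scal: "\<exists>e. e \<noteq> 0 \<and> (\<forall>t\<in>?Q. act n q t = fscale e t)"
    if "q permutes {..<n}" "\<forall>m\<in>{..<n}. key (q m) = key m" for q
    using finite_lessThan that
  proof (induction q rule: color_perm_induct)
    case id
    show ?case using tp.act_id[of _ n] QT by (intro exI[of _ 1]) (auto simp: id_def)
  next
    case (swap q s t)
    then obtain e where e: "e \<noteq> 0" "\<And>x. x \<in> ?Q \<Longrightarrow> act n q x = fscale e x" by blast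
    have st: "s < n" "t < n" "s \<noteq> t" "g s = g t" "g s < r"
      using swap(1-4) by (auto simp: key_def split: if_splits)
    have h: "act n (transpose s t \<circ> q) x = fscale (if g s < i then e else - e) x" if x: "x \<in> ?Q" for x
    proof -
      have "act n (transpose s t \<circ> q) x = act n q (act n (transpose s t) x)"
        using st swap(5) x QT by (intro tp.act_comp tp.transpose_n) auto
      also have "act n (transpose s t) x = (if g s < i then x else - x)"
        using x st by (auto simp: tp.blocks_def)
      finally have eq: "act n (transpose s t \<circ> q) x = act n q (if g s < i then x else - x)" .
      have xT: "x \<in> TP n" using x QT by blast
      show ?thesis
        unfolding eq
        by (cases "g s < i")
          (simp_all only: if_True if_False tp.act_neg[OF swap(5) xT] e(2)[OF x] fun_vs.scale_minus_left)
    qed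
    show ?case
      by (intro exI[of _ "if g s < i then e else - e"] conjI ballI h) (use e(1) in simp)
  qed
  have "\<exists>e. \<forall>t\<in>?Q. cf t w' = e * cf t w"
    if w: "w \<in> words n" "w' \<in> words n" and eq: "cls w = cls w'" for w w'
  proof -
    have len: "length w = n" "length w' = n" using w by (auto simp: words_def)
    have eq1: "card {m. m < n \<and> g m = c \<and> w ! m = l} = card {m. m < n \<and> g m = c \<and> w' ! m = l}"
      if "c < r" for c l
    proof (cases "l \<in> letters")
      case True
      then show ?thesis
        using fun_cong[OF arg_cong[OF eq, of fst], of "(c, l)"] that by (simp add: cls_def)
    next
      case False
      then have "{m. m < n \<and> g m = c \<and> w ! m = l} = {}" "{m. m < n \<and> g m = c \<and> w' ! m = l} = {}"
        using words_nth w by auto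
      then show ?thesis by (simp only:)
    qed
    have eq2: "w ! m = w' ! m" if "m < n" "\<not> g m < r" for m
      using fun_cong[OF arg_cong[OF eq, of snd], of m] that by (simp add: cls_def)
    \<comment> \<open>Every pair of a key and a letter occurs equally often in both words, so a
      permutation preserving \<open>key\<close> carries w to w'.\<close>
    have "image_mset (\<lambda>m. (key m, w' ! m)) (mset_set {..<n}) = image_mset (\<lambda>m. (key m, w ! m)) (mset_set {..<n})"
    proof (rule multiset_eqI)
      fix x :: "nat \<times> 'v"
      obtain c l where x: "x = (c, l)" by (cases x)
      have "card {m \<in> {..<n}. (key m, w' ! m) = x} = card {m \<in> {..<n}. (key m, w ! m) = x}"
      proof (cases "c < r")
        case True
        then have "{m \<in> {..<n}. (key m, u ! m) = x} = {m. m < n \<and> g m = c \<and> u ! m = l}" for u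
          by (auto simp: x key_def)
        then show ?thesis using eq1[OF True] by simp
      next
        case False
        then have "{m \<in> {..<n}. (key m, w' ! m) = x} = {m \<in> {..<n}. (key m, w ! m) = x}"
          using eq2 by (auto simp: x key_def)
        then show ?thesis by simp
      qed
      then show "count (image_mset (\<lambda>m. (key m, w' ! m)) (mset_set {..<n})) x =
          count (image_mset (\<lambda>m. (key m, w ! m)) (mset_set {..<n})) x"
        by (simp add: count_image_mset_eq_card_vimage)
    qed
    then obtain q where q: "q permutes {..<n}" "\<forall>m\<in>{..<n}. (key m, w' ! m) = (key (q m), w ! q m)"
      by (rule image_mset_eq_implies_permutes[OF finite_lessThan])
    have "\<forall>m\<in>{..<n}. key (q m) = key m" using q(2) by auto
    then obtain e where e: "e \<noteq> 0" "\<And>t. t \<in> ?Q \<Longrightarrow> act n q t = fscale e t" using scal[OF q(1)] by blast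
    have w': "permute_list q w = w'"
      using q len by (intro nth_equalityI) (auto simp: permute_list_nth)
    have "cf t w' = (sgn w q / e) * cf t w" if t: "t \<in> ?Q" for t
    proof -
      have "cf (act n q t) w' = sgn w q * cf t w" using cf_act[OF q(1) _ w(1)] t QT w' by auto
      then show ?thesis using e t by (simp add: cf_scale field_simps)
    qed
    then show ?thesis by blast
  qed
  then obtain G where G: "finite G" "card G \<le> card (cls ` words n)" "?Q \<subseteq> fun_vs.span G"
    using span_by_classes[OF QT] by blast
  have finF: "finite ?F" by auto
  have "cls ` words n \<subseteq> PiE ?A (\<lambda>_. {..n}) \<times> PiE ?F (\<lambda>_. letters)"
  proof
    fix x assume "x \<in> cls ` words n"
    then obtain w where w: "w \<in> words n" "x = cls w" by blast
    have "card {m. m < n \<and> g m = c \<and> w ! m = l} \<le> n" for c l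
      using card_mono[of "{..<n}" "{m. m < n \<and> g m = c \<and> w ! m = l}"] by auto
    then show "x \<in> PiE ?A (\<lambda>_. {..n}) \<times> PiE ?F (\<lambda>_. letters)"
      using words_nth[OF w(1)] by (auto simp: w(2) cls_def)
  qed
  then have "card (cls ` words n) \<le> card (PiE ?A (\<lambda>_. {..n}) \<times> PiE ?F (\<lambda>_. letters))"
    using finite_letters finF by (intro card_mono finite_cartesian_product finite_PiE) auto
  also have "\<dots> = (n + 1) ^ (r * card letters) * card letters ^ card ?F"
    using finite_letters finF by (simp add: card_cartesian_product card_PiE)
  also have "\<dots> \<le> (n + 1) ^ (r * card letters) * (card letters + 1) ^ K"
    using K by (intro mult_left_mono order_trans[OF power_mono power_increasing]) auto
  finally show thesis using that G by (meson order_trans)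
qed

end

section \<open>Counting the choices of blocks\<close>

text \<open>Colour r marks the positions that belong to no block; the functions are extensional so
  that there are finitely many.\<close>

definition colourings :: "nat \<Rightarrow> nat \<Rightarrow> nat \<Rightarrow> (nat \<Rightarrow> nat) set" where
  "colourings n r K = {g \<in> {..<n} \<rightarrow>\<^sub>E {..r}. card {m. m < n \<and> \<not> g m < r} \<le> K}"

lemma finite_colourings: "finite (colourings n r K)"
  by (rule finite_subset[of _ "{..<n} \<rightarrow>\<^sub>E {..r}"]) (auto simp: colourings_def intro: finite_PiE)

text \<open>Without blocks all positions are free. This settles the case a = 1, where the quotient
  vanishes in large degrees.\<close>

lemma colourings_empty: "K < n \<Longrightarrow> colourings n 0 K = {}"
  by (auto simp: colourings_def)

text \<open>Such a subset is the image of a map on K points, where n is a dummy value for the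
  surplus points and is removed afterwards.\<close>

lemma card_small_subsets: "card {F. F \<subseteq> {..<n} \<and> card F \<le> K} \<le> (n + 1) ^ K"
proof -
  let ?P = "{..<K} \<rightarrow>\<^sub>E {..n}"
  have finP: "finite ?P" by (intro finite_PiE) auto
  have "{F. F \<subseteq> {..<n} \<and> card F \<le> K} \<subseteq> (\<lambda>h. h ` {..<K} - {n}) ` ?P"
  proof
    fix F assume "F \<in> {F. F \<subseteq> {..<n} \<and> card F \<le> K}"
    then have F: "F \<subseteq> {..<n}" "card F \<le> K" by auto
    then have "finite F" using finite_subset by blast
    then obtain e where e: "bij_betw e {0..<card F} F" using ex_bij_betw_nat_finite by blast
    define h where "h = (\<lambda>m\<in>{..<K}. if m < card F then e m else n)"
    have eF: "e ` {0..<card F} = F" using e by (rule bij_betw_imp_surj_on)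
    have "h \<in> ?P" using eF F(1) by (fastforce simp: h_def)
    moreover have "h ` {..<K} - {n} = F"
    proof (intro set_eqI iffI)
      fix x assume "x \<in> h ` {..<K} - {n}"
      then show "x \<in> F" using eF by (auto simp: h_def split: if_splits)
    next
      fix x assume x: "x \<in> F"
      then have "x \<in> e ` {0..<card F}" by (simp only: eF)
      then obtain m where m: "m < card F" "x = e m" by auto
      then have "x = h m" "m < K" using F(2) by (auto simp: h_def)
      then show "x \<in> h ` {..<K} - {n}" using x F(1) by auto
    qed
    ultimately show "F \<in> (\<lambda>h. h ` {..<K} - {n}) ` ?P" by blast
  qed
  then have "card {F. F \<subseteq> {..<n} \<and> card F \<le> K} \<le> card ?P"
    using finP by (rule surj_card_le[rotated])
  then show ?thesis by (simp add: card_PiE)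
qed

text \<open>A colouring is determined by its free positions and the colours of the others; the value
  0 filled in at free positions is a colour below r because r > 0.\<close>

lemma card_colourings:
  assumes "0 < r"
  shows "card (colourings n r K) \<le> (n + 1) ^ K * r ^ n"
proof -
  let ?S = "{F. F \<subseteq> {..<n} \<and> card F \<le> K}" and ?P = "{..<n} \<rightarrow>\<^sub>E {..<r}"
  define f where "f g = ({m. m < n \<and> \<not> g m < r}, \<lambda>m\<in>{..<n}. if g m < r then g m else 0)" for g :: "nat \<Rightarrow> nat"
  have "inj_on f (colourings n r K)"
  proof (rule inj_onI)
    fix g h assume g: "g \<in> colourings n r K" and h: "h \<in> colourings n r K" and eq: "f g = f h"
    have "g m = h m" for m
    proof (cases "m < n")
      case True
      have 1: "g m < r \<longleftrightarrow> h m < r"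
        using arg_cong[OF eq, of "\<lambda>x. m \<in> fst x"] True by (simp add: f_def)
      have 2: "(if g m < r then g m else 0) = (if h m < r then h m else 0)"
        using arg_cong[OF eq, of "\<lambda>x. snd x m"] True by (simp add: f_def)
      have "g m \<le> r" "h m \<le> r" using g h True by (auto simp: colourings_def dest!: PiE_mem)
      then show ?thesis using 1 2 by (auto split: if_splits)
    next
      case False
      have "g \<in> {..<n} \<rightarrow>\<^sub>E {..r}" "h \<in> {..<n} \<rightarrow>\<^sub>E {..r}" using g h by (simp_all add: colourings_def)
      then show ?thesis using False PiE_arb[of g _ _ m] PiE_arb[of h _ _ m] by (metis lessThan_iff)
    qed
    then show "g = h" by (rule ext)
  qed
  moreover have "f ` colourings n r K \<subseteq> ?S \<times> ?P"
  proof (rule image_subsetI)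
    fix g assume "g \<in> colourings n r K"
    then have "card {m. m < n \<and> \<not> g m < r} \<le> K" by (simp add: colourings_def)
    moreover have "{m. m < n \<and> \<not> g m < r} \<subseteq> {..<n}" by blast
    moreover have "(\<lambda>m\<in>{..<n}. if g m < r then g m else 0) \<in> ?P"
      using assms by (simp add: restrict_PiE_iff)
    ultimately show "f g \<in> ?S \<times> ?P" unfolding f_def by blast
  qed
  moreover have "finite (?S \<times> ?P)"
    by (intro finite_cartesian_product finite_PiE) (auto intro: finite_subset[of _ "Pow {..<n}"])
  ultimately have "card (colourings n r K) \<le> card (?S \<times> ?P)" by (rule card_inj_on_le)
  also have "\<dots> = card ?S * r ^ n" by (simp add: card_cartesian_product card_PiE)
  also have "\<dots> \<le> (n + 1) ^ K * r ^ n" by (intro mult_right_mono card_small_subsets) auto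
  finally show ?thesis .
qed

section \<open>Partitions outside the filter\<close>

lemma hookrect_mono: "b \<le> b' \<Longrightarrow> hookrect a1 a2 b \<le> hookrect a1 a2 b'"
  by (auto simp: le_fun_def hookrect_def)

lemma hookrect_partition: "a2 \<le> b \<Longrightarrow> hookrect a1 a2 b \<in> partitions"
proof -
  assume "a2 \<le> b"
  then have "antimono (hookrect a1 a2 b)" by (auto simp: antimono_def hookrect_def)
  moreover have "{i. hookrect a1 a2 b i \<noteq> 0} \<subseteq> {..<max a1 b}" by (auto simp: hookrect_def split: if_splits)
  ultimately show ?thesis using finite_subset by (auto simp: partitions_def)
qed

text \<open>The last two conclusions put the boxes outside the first \<open>i\<close> rows and \<open>j\<close> columns into the
  square of side \<open>b\<close>.\<close>

lemma hook_shape: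
  assumes \<Omega>: "partition_filter \<Omega>" and b: "0 < b"
    and hook: "\<And>a1 a2. a1 + a2 = a \<Longrightarrow> hookrect a1 a2 b \<in> \<Omega>"
    and \<nu>: "\<nu> \<in> partitions" "\<nu> \<notin> \<Omega>"
  obtains i j where "i + j < a" "\<And>r. i \<le> r \<Longrightarrow> \<nu> r < b" "\<And>r c. j \<le> c \<Longrightarrow> c < \<nu> r \<Longrightarrow> r < b"
proof -
  have anti: "\<nu> y \<le> \<nu> x" if "x \<le> y" for x y
    using \<nu>(1) that by (auto simp: partitions_def dest: antimonoD)
  obtain L where L: "\<And>r. L \<le> r \<Longrightarrow> \<nu> r = 0" using partition_bounded[OF \<nu>(1)] by blast
  \<comment> \<open>The number of rows of length at least b.\<close>
  define i where "i = (LEAST r. \<nu> r < b)"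
  have "\<nu> L < b" using L b by simp
  then have i: "\<nu> i < b" unfolding i_def by (rule LeastI)
  have i_less: "b \<le> \<nu> r" if "r < i" for r
    using not_less_Least[of r "\<lambda>r. \<nu> r < b"] that by (simp add: i_def)
  \<comment> \<open>Rows are counted from 0, so this is the number of columns of height at least
    b.\<close>
  define j where "j = \<nu> (b - 1)"
  have "i + j < a"
  proof (rule ccontr)
    assume "\<not> i + j < a"
    \<comment> \<open>Truncated because i alone may exceed a; the hook shape for a1 and a - a1 then
      fits into \<nu>.\<close>
    define a1 where "a1 = min i a"
    have a1: "a1 \<le> i" "a1 + (a - a1) = a" "a - a1 \<le> j"
      using \<open>\<not> i + j < a\<close> by (auto simp: a1_def)
    have "hookrect a1 (a - a1) b x \<le> \<nu> x" for x
    proof -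
      consider "x < a1" | "a1 \<le> x" "x < b" | "a1 \<le> x" "b \<le> x" by linarith
      then show ?thesis
      proof cases
        case 1
        then show ?thesis using i_less[of x] a1 by (simp add: hookrect_def)
      next
        case 2
        then have "\<nu> (b - 1) \<le> \<nu> x" by (intro anti) simp
        then show ?thesis using 2 a1(3) by (simp add: hookrect_def j_def)
      qed (simp add: hookrect_def)
    qed
    then have "hookrect a1 (a - a1) b \<le> \<nu>" by (simp add: le_fun_def)
    then have "\<nu> \<in> \<Omega>" using \<Omega> hook[OF a1(2)] \<nu>(1) by (auto simp: partition_filter_def)
    then show False using \<nu>(2) by simp
  qed
  moreover have "\<nu> r < b" if "i \<le> r" for r using anti[OF that] i by simp
  moreover have "r < b" if "j \<le> c" "c < \<nu> r" for r c
  proof (rule ccontr)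
    assume "\<not> r < b"
    then have "\<nu> r \<le> j" unfolding j_def by (intro anti) simp
    then show False using that by simp
  qed
  ultimately show thesis by (rule that)
qed

section \<open>Decomposition of the tensor power and the upper bound\<close>

context super_tensor
begin

lemma blocks_cong: "(\<And>m. m < n \<Longrightarrow> g m = h m) \<Longrightarrow> tp.blocks n r i g = tp.blocks n r i h"
  by (auto simp: tp.blocks_def)

text \<open>The block spaces together span a submodule, because a permutation carries the space for
  g to the one for g composed with it; so Maschke's theorem applies. The bound b * b is the number
  of boxes of the square in \<open>hook_shape\<close>.\<close>

lemma tensor_power_decomposition:
  assumes \<Omega>: "partition_filter \<Omega>" and b: "0 < b"
    and hook: "\<And>a1 a2. a1 + a2 = Suc r \<Longrightarrow> hookrect a1 a2 b \<in> \<Omega>"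
  shows "TP n \<subseteq> fun_vs.span (filter_ideal scale V0 V1 \<Omega> \<union>
    (\<Union>i\<in>{..r}. \<Union>g\<in>colourings n r (b * b). tp.blocks n r i g))"
proof -
  let ?Y = "\<Union>i\<in>{..r}. \<Union>g\<in>colourings n r (b * b). tp.blocks n r i g"
  \<comment> \<open>Only the degree n part of the ideal lies in the tensor power; the other degrees
    are added at the end.\<close>
  define Z where "Z = \<Union>(isotypic_component scale V0 V1 ` {\<nu> \<in> \<Omega>. psize \<nu> = n})"
  define N where "N = fun_vs.span (Z \<union> ?Y)"
  have "Z \<union> ?Y \<subseteq> N" unfolding N_def by (rule fun_vs.span_superset)
  then have ZN: "Z \<subseteq> N" and YN: "?Y \<subseteq> N" by (simp_all only: Un_subset_iff)
  have "tp.submod n N"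
    unfolding N_def
  proof (rule tp.submod_span)
    show "Z \<union> ?Y \<subseteq> TP n"
    proof (rule Un_least)
      have "isotypic_component scale V0 V1 \<nu> \<subseteq> TP n" if "psize \<nu> = n" for \<nu>
        using isotypic_submod[OF that] by (simp add: tp.submod_def)
      then show "Z \<subseteq> TP n" unfolding Z_def by blast
      show "?Y \<subseteq> TP n" unfolding tp.blocks_def by blast
    qed
    fix \<tau> x assume \<tau>: "\<tau> permutes {..<n}" and x: "x \<in> Z \<union> ?Y"
    have "act n \<tau> x \<in> Z \<union> ?Y"
    proof (cases "x \<in> Z")
      case True
      then obtain \<nu> where \<nu>: "\<nu> \<in> \<Omega>" "psize \<nu> = n" "x \<in> isotypic_component scale V0 V1 \<nu>"
        by (auto simp: Z_def)
      then have "act n \<tau> x \<in> isotypic_component scale V0 V1 \<nu>"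
        using isotypic_submod[OF \<nu>(2)] \<tau> by (auto simp: tp.submod_def)
      then show ?thesis using \<nu> by (auto simp: Z_def)
    next
      case False
      then obtain i g where ig: "i \<le> r" "g \<in> colourings n r (b * b)" "x \<in> tp.blocks n r i g"
        using x by blast
      have \<tau>n: "\<tau> m < n" if "m < n" for m using \<tau> that by (metis lessThan_iff permutes_in_image)
      define h where "h = (\<lambda>m\<in>{..<n}. g (\<tau> m))"
      have "tp.blocks n r i (g \<circ> \<tau>) = tp.blocks n r i h"
        by (rule blocks_cong) (simp add: h_def)
      then have "act n \<tau> x \<in> tp.blocks n r i h" using tp.act_blocks[OF \<tau> ig(3)] by simp
      moreover have "h \<in> colourings n r (b * b)"
      proof -
        have "\<tau> ` {m. m < n \<and> \<not> h m < r} \<subseteq> {m. m < n \<and> \<not> g m < r}"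
          using \<tau>n by (auto simp: h_def)
        then have "card {m. m < n \<and> \<not> h m < r} \<le> card {m. m < n \<and> \<not> g m < r}"
          using permutes_inj[OF \<tau>] by (intro card_inj_on_le[of \<tau>]) (auto intro: inj_on_subset)
        then have "card {m. m < n \<and> \<not> h m < r} \<le> b * b" using ig(2) by (simp add: colourings_def)
        moreover have "h \<in> {..<n} \<rightarrow>\<^sub>E {..r}" using ig(2) \<tau>n by (auto simp: h_def colourings_def)
        ultimately show ?thesis by (simp add: colourings_def)
      qed
      ultimately show ?thesis using ig(1) by blast
    qed
    then show "act n \<tau> x \<in> fun_vs.span (Z \<union> ?Y)" by (rule fun_vs.span_base)
  qed
  then obtain M where M: "tp.submod n M" "N \<inter> M = {0}" "\<And>t. t \<in> TP n \<Longrightarrow> \<exists>x\<in>N. \<exists>y\<in>M. t = x + y"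
    using tp.maschke by metis
  have "M = {0}"
  proof (rule ccontr)
    assume "M \<noteq> {0}"
    then obtain \<nu> v where \<nu>: "\<nu> \<in> partitions" "psize \<nu> = n" and v: "v \<in> M" "v \<noteq> 0"
      and g: "tp.garnir n (row_of \<nu>) {..<n} v"
      using tp.garnir_exists[OF M(1)] by metis
    have vT: "v \<in> TP n" using M(1) v(1) by (auto simp: tp.submod_def)
    show False
    proof (cases "\<nu> \<in> \<Omega>")
      case True
      then have "tp.young n \<nu> id v \<in> N"
        using young_in_isotypic[OF \<nu> vT] \<nu>(2) ZN by (auto simp: Z_def)
      moreover have "tp.young n \<nu> id v \<in> M"
        using tp.mult_submod[OF M(1) v(1)] tp.mult_young_symmetrizer[OF vT \<nu>(2)] by metis
      ultimately show False using M(2) tp.garnir_young_nonzero[OF \<nu> g v(2)] by blast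
    next
      case False
      obtain i j where ij: "i + j < Suc r" "\<And>x. i \<le> x \<Longrightarrow> \<nu> x < b" "\<And>x c. j \<le> c \<Longrightarrow> c < \<nu> x \<Longrightarrow> x < b"
        using hook_shape[OF \<Omega> b hook \<nu>(1) False] by metis
      \<comment> \<open>As i + j is at most r, the rows and columns used as blocks get colours below
        r, and r is left for the remaining boxes.\<close>
      let ?h = "\<lambda>m. if row_of \<nu> m < i then row_of \<nu> m else if col_of \<nu> m < j then i + col_of \<nu> m else r"
      obtain w where w: "w \<noteq> 0" "w \<in> M" "w \<in> tp.blocks n r i ?h"
        by (rule tp.garnir_blocks[OF \<nu> g v(2) M(1) v(1), of r i j])
      define h where "h = restrict ?h {..<n}"
      have "tp.blocks n r i ?h = tp.blocks n r i h" by (rule blocks_cong) (simp add: h_def)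
      then have wh: "w \<in> tp.blocks n r i h" using w(3) by simp
      have "h \<in> colourings n r (b * b)"
      proof -
        have "(\<lambda>m. (row_of \<nu> m, col_of \<nu> m)) ` {m. m < n \<and> \<not> h m < r} \<subseteq> {..<b} \<times> {..<b}"
        proof (rule image_subsetI)
          fix m assume m: "m \<in> {m. m < n \<and> \<not> h m < r}"
          have c: "col_of \<nu> m < \<nu> (row_of \<nu> m)" using box_position(2)[OF \<nu>(1), of m] m \<nu>(2) by simp
          have "i \<le> row_of \<nu> m" "j \<le> col_of \<nu> m" using m ij(1) by (auto simp: h_def split: if_splits)
          then show "(row_of \<nu> m, col_of \<nu> m) \<in> {..<b} \<times> {..<b}"
            using ij(2)[of "row_of \<nu> m"] ij(3)[OF _ c] c by simp
        qed
        moreover have "inj_on (\<lambda>m. (row_of \<nu> m, col_of \<nu> m)) {m. m < n \<and> \<not> h m < r}"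
          using box_inj[OF \<nu>(1)] \<nu>(2) by (auto simp: inj_on_def)
        ultimately have "card {m. m < n \<and> \<not> h m < r} \<le> card ({..<b} \<times> {..<b})"
          by (intro card_inj_on_le) auto
        moreover have "h \<in> {..<n} \<rightarrow>\<^sub>E {..r}" using ij(1) by (auto simp: h_def)
        ultimately show ?thesis by (simp add: colourings_def)
      qed
      then have "w \<in> N" using wh ij(1) YN by fastforce
      then show False using w M(2) by blast
    qed
  qed
  then have "TP n \<subseteq> N" using M(3) by fastforce
  also have "N \<subseteq> fun_vs.span (filter_ideal scale V0 V1 \<Omega> \<union> ?Y)"
    unfolding N_def
  proof (rule fun_vs.span_mono)
    have "Z \<subseteq> filter_ideal scale V0 V1 \<Omega>"
      unfolding Z_def filter_ideal_def by (auto intro: fun_vs.span_base)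
    then show "Z \<union> ?Y \<subseteq> filter_ideal scale V0 V1 \<Omega> \<union> ?Y" by blast
  qed
  finally show ?thesis .
qed

text \<open>The factor \<open>Suc r\<close> counts the possible numbers i of symmetric
  blocks.\<close>

theorem dim_A_le:
  assumes \<Omega>: "partition_filter \<Omega>" and b: "0 < b"
    and hook: "\<And>a1 a2. a1 + a2 = Suc r \<Longrightarrow> hookrect a1 a2 b \<in> \<Omega>"
  shows "dim_A scale V0 V1 \<Omega> n \<le> Suc r * card (colourings n r (b * b)) *
    ((n + 1) ^ (r * card letters) * (card letters + 1) ^ (b * b))"
proof -
  let ?E = "(n + 1) ^ (r * card letters) * (card letters + 1) ^ (b * b)"
  let ?C = "colourings n r (b * b)"
  have "\<exists>G. finite G \<and> card G \<le> ?E \<and> tp.blocks n r i g \<subseteq> fun_vs.span G" if "g \<in> ?C" for i g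
  proof -
    have "card {m. m < n \<and> \<not> g m < r} \<le> b * b" using that by (simp add: colourings_def)
    then show ?thesis by (rule blocks_dim) blast
  qed
  note ex = this
  define G where "G i g = (SOME G. finite G \<and> card G \<le> ?E \<and> tp.blocks n r i g \<subseteq> fun_vs.span G)" for i g
  have "finite (G i g) \<and> card (G i g) \<le> ?E \<and> tp.blocks n r i g \<subseteq> fun_vs.span (G i g)" if "g \<in> ?C" for i g
    unfolding G_def by (rule someI_ex[OF ex[OF that]])
  then have G: "\<And>i g. g \<in> ?C \<Longrightarrow> finite (G i g)" "\<And>i g. g \<in> ?C \<Longrightarrow> card (G i g) \<le> ?E"
    "\<And>i g. g \<in> ?C \<Longrightarrow> tp.blocks n r i g \<subseteq> fun_vs.span (G i g)" by blast+
  let ?G = "\<Union>i\<in>{..r}. \<Union>g\<in>?C. G i g"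
  have finG: "finite ?G" using G(1) finite_colourings by auto
  have sub: "tp.blocks n r i g \<subseteq> fun_vs.span (?G \<union> filter_ideal scale V0 V1 \<Omega>)" if "i \<le> r" "g \<in> ?C" for i g
    using G(3)[OF that(2)] fun_vs.span_mono[of "G i g" "?G \<union> filter_ideal scale V0 V1 \<Omega>"] that by blast
  have "TP n \<subseteq> fun_vs.span (?G \<union> filter_ideal scale V0 V1 \<Omega>)"
  proof (rule order_trans[OF tensor_power_decomposition[OF \<Omega> b hook]], assumption,
      rule fun_vs.span_minimal)
    show "filter_ideal scale V0 V1 \<Omega> \<union> (\<Union>i\<in>{..r}. \<Union>g\<in>?C. tp.blocks n r i g)
        \<subseteq> fun_vs.span (?G \<union> filter_ideal scale V0 V1 \<Omega>)"
      using sub fun_vs.span_superset[of "?G \<union> filter_ideal scale V0 V1 \<Omega>"] by blast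
  qed (rule fun_vs.subspace_span)
  then have "dim_A scale V0 V1 \<Omega> n \<le> card ?G"
    unfolding dim_A_def using finG
    by (intro quot_dim_le) (auto simp: filter_ideal_def fun_vs.subspace_span)
  also have "\<dots> \<le> (\<Sum>i\<le>r. card (\<Union>g\<in>?C. G i g))" by (intro card_UN_le) auto
  also have "\<dots> \<le> (\<Sum>i\<le>r. card ?C * ?E)"
  proof (rule sum_mono)
    fix i
    have "card (\<Union>g\<in>?C. G i g) \<le> (\<Sum>g\<in>?C. card (G i g))" by (intro card_UN_le finite_colourings)
    also have "\<dots> \<le> (\<Sum>g\<in>?C. ?E)" by (intro sum_mono G(2))
    finally show "card (\<Union>g\<in>?C. G i g) \<le> card ?C * ?E" by simp
  qed
  finally show ?thesis by (simp only: sum_constant card_atMost mult.assoc of_nat_id)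
qed

end

section \<open>The growth exponent\<close>

lemma super_tensor_exists:
  fixes scale :: "'f::field_char_0 \<Rightarrow> 'v::ab_group_add \<Rightarrow> 'v"
  assumes sp: "superspace scale V0 V1" and "has_findim scale V0 k" "has_findim scale V1 l"
  obtains B0 B1 where "super_tensor scale V0 V1 B0 B1" "card B0 = k" "card B1 = l"
proof -
  interpret vector_space scale using sp by (simp add: superspace_def)
  have basis: "\<exists>B. finite B \<and> independent B \<and> span B = U \<and> card B = d" if fd: "has_findim scale U d" for U d
  proof -
    obtain S where S: "finite S" "span S = U" and d: "dim U = d"
      using fd unfolding has_findim_def by blast
    obtain B where B: "B \<subseteq> U" "independent B" "U \<subseteq> span B" "card B = dim U"
      using basis_exists by blast
    have "finite B" using independent_span_bound[OF S(1) B(2)] B(1) S(2) by simp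
    moreover have "span B \<subseteq> U" using B(1) S(2) by (metis span_minimal subspace_span)
    ultimately show ?thesis using B d by auto
  qed
  obtain B0 where B0: "finite B0" "independent B0" "span B0 = V0" "card B0 = k" using basis[OF assms(2)] by blast
  obtain B1 where B1: "finite B1" "independent B1" "span B1 = V1" "card B1 = l" using basis[OF assms(3)] by blast
  have "super_tensor scale V0 V1 B0 B1"
    by unfold_locales (use sp B0 B1 in auto)
  then show thesis using that B0(4) B1(4) by blast
qed

theorem theorem5p7:
  fixes scale :: "'f::field_char_0 \<Rightarrow> 'v::ab_group_add \<Rightarrow> 'v"
    and V0 V1 :: "'v set"
    and k l a :: nat
    and \<Omega> :: "(nat \<Rightarrow> nat) set"
  assumes "superspace scale V0 V1"
    and "has_findim scale V0 k"
    and "has_findim scale V1 l"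
    and "partition_filter \<Omega>"
    and "\<Omega> \<noteq> partitions"
    and "rect (k + 1) (l + 1) \<in> \<Omega>"
    and "a = h_r \<Omega>"
  shows "a \<ge> 1 \<and> has_Exp (\<lambda>n. real (dim_A scale V0 V1 \<Omega> n)) (real a - 1)"
proof -
  have \<Omega>P: "\<Omega> \<subseteq> partitions" and up: "\<And>\<mu> \<nu>. \<mu> \<in> \<Omega> \<Longrightarrow> \<nu> \<in> partitions \<Longrightarrow> \<mu> \<le> \<nu> \<Longrightarrow> \<nu> \<in> \<Omega>"
    using assms(4) by (auto simp: partition_filter_def)
  obtain B0 B1 where B: "super_tensor scale V0 V1 B0 B1" "card B0 = k" "card B1 = l"
    using super_tensor_exists[OF assms(1-3)] by blast
  interpret super_tensor scale V0 V1 B0 B1 by (rule B(1))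
  \<comment> \<open>If a1 + a2 = k + l + 1, then a1 > k or a2 > l, so each of these shapes with b =
    k + l + 1 contains the rectangle. Hence the least value defining \<open>h_r\<close>
    exists.\<close>
  have "hook_rectangular_condition \<Omega> (k + l + 1)"
    unfolding hook_rectangular_condition_def
  proof (intro exI[of _ "k + l + 1"] conjI allI impI)
    fix a1 a2 assume "a1 + a2 = k + l + 1"
    then have "rect (k + 1) (l + 1) \<le> hookrect a1 a2 (k + l + 1)"
      by (auto simp: le_fun_def rect_def hookrect_def)
    then show "hookrect a1 a2 (k + l + 1) \<in> \<Omega>"
      using \<open>a1 + a2 = k + l + 1\<close> by (intro up[OF assms(6)] hookrect_partition) auto
  qed auto
  then have cond: "hook_rectangular_condition \<Omega> a"
    unfolding assms(7) h_r_def by (rule LeastI)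
  have a1: "a \<ge> 1"
  proof (rule ccontr)
    assume "\<not> a \<ge> 1"
    then have "a = 0" by simp
    then obtain b where "hookrect 0 0 b \<in> \<Omega>"
      using cond unfolding hook_rectangular_condition_def by auto
    \<comment> \<open>This shape is the empty partition, which only the full filter
      contains.\<close>
    moreover have "hookrect 0 0 b \<le> \<nu>" for \<nu> by (auto simp: le_fun_def hookrect_def)
    ultimately have "partitions \<subseteq> \<Omega>" using up by blast
    then show False using \<Omega>P assms(5) by blast
  qed
  define r where "r = a - 1"
  have ar: "a = Suc r" "real a - 1 = real r" using a1 by (simp_all add: r_def)
  obtain b where b: "0 < b" "\<And>a1 a2. a1 + a2 = Suc r \<Longrightarrow> hookrect a1 a2 b \<in> \<Omega>"
    using cond unfolding hook_rectangular_condition_def ar(1) by blast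
  let ?d = "dim_A scale V0 V1 \<Omega>" and ?D = "card letters"
  have upper: "?d n \<le> Suc r * card (colourings n r (b * b)) *
      ((n + 1) ^ (r * ?D) * (?D + 1) ^ (b * b))" for n
    by (rule dim_A_le[OF assms(4) b(1)]) (rule b(2))
  have "has_Exp (\<lambda>n. real (?d n)) (real r)"
  \<comment> \<open>Exponent 0 means that the dimension vanishes eventually, so it is treated
    separately.\<close>
  proof (cases "r = 0")
    case True
    have "?d n = 0" if "b * b < n" for n
      using upper[of n] colourings_empty[OF that] True by simp
    then have "\<forall>\<^sub>F n in sequentially. real (?d n) = 0"
      unfolding eventually_sequentially by (intro exI[of _ "Suc (b * b)"]) auto
    then show ?thesis using True by (simp add: has_Exp_def)
  next
    case False
    have "\<exists>a1\<le>r. \<forall>c. hookrect a1 (r - a1) c \<notin> \<Omega>"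
    proof (rule ccontr)
      assume "\<not> ?thesis"
      then obtain c where c: "\<And>x. x \<le> r \<Longrightarrow> hookrect x (r - x) (c x) \<in> \<Omega>" by metis
      \<comment> \<open>One size for all shapes: the sum bounds every c x, and \<open>Suc r\<close>
        makes m positive and at least r.\<close>
      define m where "m = Suc r + (\<Sum>x\<le>r. c x)"
      have "hookrect a1 a2 m \<in> \<Omega>" if "a1 + a2 = r" for a1 a2
      proof -
        have a1: "a1 \<le> r" "a2 = r - a1" using that by auto
        have "c a1 \<le> (\<Sum>x\<le>r. c x)" using a1(1) by (intro member_le_sum) auto
        then have "c a1 \<le> m" by (simp add: m_def)
        then show ?thesis
          using a1 c[OF a1(1)] by (intro up[OF c[OF a1(1)]] hookrect_partition) (auto simp: m_def intro: hookrect_mono)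
      qed
      then have "hook_rectangular_condition \<Omega> r"
        unfolding hook_rectangular_condition_def by (intro exI[of _ m]) (auto simp: m_def)
      then have "h_r \<Omega> \<le> r" unfolding h_r_def by (rule Least_le)
      then show False using assms(7) ar(1) by simp
    qed
    then obtain a1 where a1: "a1 \<le> r" "\<And>c. hookrect a1 (r - a1) c \<notin> \<Omega>" by blast
    have big: "r - a1 < \<nu> a1" if \<nu>: "\<nu> \<in> \<Omega>" for \<nu>
    proof (rule ccontr)
      assume "\<not> r - a1 < \<nu> a1"
      have \<nu>P: "\<nu> \<in> partitions" using \<nu> \<Omega>P by blast
      have anti: "\<nu> y \<le> \<nu> x" if "x \<le> y" for x y
        using \<nu>P that by (auto simp: partitions_def dest: antimonoD)
      obtain L where L: "\<And>x. L \<le> x \<Longrightarrow> \<nu> x = 0" using partition_bounded[OF \<nu>P] by blast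
      \<comment> \<open>L bounds the number of rows and \<nu> 0 their length, while r keeps the hook
        shape a partition.\<close>
      define c where "c = L + \<nu> 0 + r"
      have "\<nu> x \<le> hookrect a1 (r - a1) c x" for x
        using anti[of 0 x] anti[of a1 x] L[of x] \<open>\<not> r - a1 < \<nu> a1\<close> by (auto simp: hookrect_def c_def)
      then have "hookrect a1 (r - a1) c \<in> \<Omega>"
        by (intro up[OF \<nu>] hookrect_partition) (auto simp: le_fun_def c_def)
      then show False using a1(2) by blast
    qed
    \<comment> \<open>The rectangle itself must contain the box in row a1 and column r - a1; this is
      what makes room for a subsuperspace of these dimensions in V.\<close>
    have "a1 \<le> k" "r - a1 \<le> l"
      using big[OF assms(6)] by (auto simp: rect_def split: if_splits)
    then obtain U0 U1 where U: "U0 \<subseteq> B0" "card U0 = a1" "U1 \<subseteq> B1" "card U1 = r - a1"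
      using B(2,3) by (metis obtain_subset_with_card_n)
    have lower: "r ^ n \<le> ?d n" for n
      using dim_A_ge[OF U(1,3) \<Omega>P, of n] big U(2,4) a1(1) by simp
    have ge: "Exp_ge (\<lambda>n. real (?d n)) (real r)"
      unfolding Exp_ge_def
    proof (intro exI[of _ "[:1:]"] conjI)
      show "\<forall>\<^sub>F n in sequentially. poly [:1:] (real n) * real r ^ n \<le> real (?d n)"
        using lower by (intro always_eventually allI) (simp flip: of_nat_power)
    qed simp
    define C where "C = real (Suc r * (?D + 1) ^ (b * b))"
    \<comment> \<open>The exponent b * b comes from choosing the free positions, and r * ?D from the
      letter counts in the blocks.\<close>
    define p where "p = smult C ([:1, 1:] ^ (b * b + r * ?D))"
    have p: "poly p (real n) = C * (real n + 1) ^ (b * b + r * ?D)" for n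
      by (simp add: p_def poly_power add.commute)
    have "real (?d n) \<le> poly p (real n) * real r ^ n" for n
    proof -
      have "?d n \<le> Suc r * ((n + 1) ^ (b * b) * r ^ n) * ((n + 1) ^ (r * ?D) * (?D + 1) ^ (b * b))"
        using upper[of n] card_colourings[of r n "b * b"] False
        by (meson order_trans mult_le_mono le_refl neq0_conv)
      also have "\<dots> = Suc r * (?D + 1) ^ (b * b) * (n + 1) ^ (b * b + r * ?D) * r ^ n"
        by (simp only: power_add ac_simps)
      finally have "real (?d n) \<le> real (Suc r * (?D + 1) ^ (b * b) * (n + 1) ^ (b * b + r * ?D) * r ^ n)"
        by (rule of_nat_mono)
      also have "\<dots> = poly p (real n) * real r ^ n"
        unfolding p C_def by (simp add: add.commute)
      finally show ?thesis .
    qed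
    moreover have "0 < C" unfolding C_def of_nat_0_less_iff by simp
    then have "0 < poly p (real n)" for n
      unfolding p by (intro mult_pos_pos zero_less_power) auto
    ultimately have "Exp_le (\<lambda>n. real (?d n)) (real r)"
      unfolding Exp_le_def by (intro exI[of _ p] conjI always_eventually allI)
    then show ?thesis using ge False by (simp add: has_Exp_def)
  qed
  then show ?thesis using a1 ar(2) by simp
qed

end
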